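(* Let $(\mathcal{R},\mu)$ and $(\mathcal{S},\nu)$ be nonatomic $\sigma$-finite measure spaces. Let $X(\mathcal{R},\mu)$ and $Y(\mathcal{S},\nu)$ be rearrangement-invariant function spaces. Assume that $$\lim_{t\to0^+}\|\chi_{(0,t)}\|_{\bar X(0,\mu(\mathcal{R}))}=0.$$ Let $1<p<q$, and let $\lambda\in(0,1)$ be such that $\lambda p>1$. Let $B$ be a linear operator defined on characteristic functions of $\mu$-measurable subsets of $\mathcal{R}$ of finite measure and taking values in $\mathfrak{M}_0(\mathcal{S},\nu)$. Let $G$ be an order preserving $(\lambda p,\lambda q)$-sawyerable operator. Assume that $R_{p,q}$ is bounded from $\bar X(0,\mu(\mathcal{R}))$ to $\bar Y(0,\nu(\mathcal{S}))$, and that there is a constant $C>0$ such that for every $\mu$-measurable set $E\subseteq\mathcal{R}$ of finite measure $$|B\chi_E(y)|\le C\,|G\chi_E(y)|^{\lambda}\quad\text{for }\nu\text{-a.e. }y\in\mathcal{S}.$$ Then $B$ is bounded from $\Lambda_X(\mathcal{R},\mu)$ to $Y^{\langle p\rangle}(\mathcal{S},\nu)$.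
   Context: $\mathfrak{M}(\mathcal{R},\mu)$ is the set of $\mu$-measurable functions, $\mathfrak{M}^+$ the nonnegative ones, $\mathfrak{M}_0$ those finite a.e. The nonincreasing rearrangement is $f^*_\mu(t)=\inf\{\lambda>0:\mu(\{|f|>\lambda\})\le t\}$ and $f^{**}_\mu(t)=\frac1t\int_0^tf^*_\mu(s)\,ds$; on intervals with Lebesgue measure the subscript is omitted. Two functions are equimeasurable if their moduli have the same distribution function. A rearrangement-invariant (r.i.) function norm is a functional $\|\cdot\|_{X(\mathcal{R},\mu)}:\mathfrak{M}^+(\mathcal{R},\mu)\to[0,\infty]$ that is a norm (vanishing only for functions equal to $0$ a.e., positively homogeneous, subadditive), is monotone, has the Fatou property ($f_j\nearrow f$ a.e. implies $\|f_j\|\nearrow\|f\|$), satisfies $\|\chi_E\|<\infty$ and $\int_Ef\,d\mu\le C_E\|f\|$ whenever $\mu(E)<\infty$, and gives equal values to equimeasurable functions. It is extended by $\|f\|=\|\,|f|\,\|$; $X(\mathcal{R},\mu)=\{f:\|f\|_{X(\mathcal{R},\mu)}<\infty\}$ is an r.i. function space. Its representation space $\bar X(0,\mu(\mathcal{R}))$ is the unique r.i. function space over $(0,\mu(\mathcal{R}))$ with Lebesgue measure such that $\|f\|_{X(\mathcal{R},\mu)}=\|f^*_\mu\|_{\bar X(0,\mu(\mathcal{R}))}$ for all $f$. The fundamental function is $\varphi_X(t)=\|\chi_{(0,t)}\|_{\bar X(0,\mu(\mathcal{R}))}$, $t\in(0,\mu(\mathcal R))$; there is always an equivalent r.i. norm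 on $X$ for which it is concave. The space $\Lambda_X(\mathcal R,\mu)$ is given by the functional $$\|f\|_{\Lambda_X(\mathcal{R},\mu)}=\|f\|_{L^\infty(\mathcal{R},\mu)}\varphi_X(0^+)+\int_0^{\infty}f^*_\mu(s)\varphi_X'(s)\,ds$$ (the integrand being $0$ for $s\ge\mu(\mathcal R)$). $\|f\|_{L^{b,\infty}}=\sup_{t>0}t^{1/b}f^*_\mu(t)$; the sum $X+Z$ has norm $\inf_{f=g+h}(\|g\|_X+\|h\|_Z)$. $Y^{\langle p\rangle}(\mathcal{S},\nu)$ is the set of $f$ with $\|f\|_{Y^{\langle p\rangle}(\mathcal{S},\nu)}=\big\|\big((|f|^p)^{**}_\nu\big)^{1/p}\big\|_{\bar Y(0,\nu(\mathcal{S}))}<\infty$. With $r=\frac{q}{q-p}$, $R_{p,q}g(t)=\big(\frac1t\int_0^{t^{r}}g^*(s)^p\,ds\big)^{1/p}$, $t\in(0,\infty)$ (functions $g$ on $(0,\mu(\mathcal R))$ are extended by $0$, and $R_{p,q}g$ is considered on $(0,\nu(\mathcal S))$). An operator $T$ is quasi-linear if for some $k\ge1$, $|T(f+g)|\le k(|Tf|+|Tg|)$ and $|T(\alpha f)|=|\alpha||Tf|$ $\nu$-a.e. for all $f,g$ in its (linear) domain and all scalars $\alpha$. For $1<a<b$, an operator $T$ defined on $(L^a+L^{b,\infty})(\mathcal{R},\mu)$ with values in $\mathfrak{M}_0(\mathcal{S},\nu)$ is $(a,b)$-sawyerable if it is quasi-linear and is bounded from $L^a(\mathcal{R},\mu)$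 to $L^a(\mathcal{S},\nu)$ and from $L^{b,\infty}(\mathcal{R},\mu)$ to $L^\infty(\mathcal{S},\nu)$. $T$ is order preserving if $0\le f\le g$ $\mu$-a.e. implies $0\le Tf\le Tg$ $\nu$-a.e. The operator $B$, given initially on characteristic functions of sets of finite measure (and by linearity on simple functions), is understood in the conclusion as its unique bounded linear extension to $\Lambda_X(\mathcal R,\mu)$.
   Formalization: When μ(R)=∞ and 0<ν(S)<∞, the formal theorem additionally assumes that φ_X(t) ≥ c t^{1/q} for some c>0 and all t≥1; without this the claim fails, e.g. for X=L^p+L^∞ on (0,∞) and Y=L^1(0,1). *)

theory Defs
  imports "HOL-Probability.Essential_Supremum"
begin

text \<open>
  Nonnegative measurable functions are \<open>[0,\<infinity>]\<close>-valued, i.e. of type \<open>'a \<Rightarrow> ennreal\<close>. Functions that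
  are finite a.e. are represented by scalar-valued ones; the sort
  \<open>{real_normed_field, euclidean_space}\<close> covers both real and complex scalars.
  All function norms are functionals on \<open>'a \<Rightarrow> ennreal\<close> and are applied to the modulus of a
  scalar-valued function.
\<close>

definition modulus :: "('a \<Rightarrow> 'k::real_normed_vector) \<Rightarrow> 'a \<Rightarrow> ennreal" where
  "modulus f = (\<lambda>x. ennreal (norm (f x)))"

text \<open>Only used for exponents \<open>a > 0\<close>.\<close>

definition epowr :: "ennreal \<Rightarrow> real \<Rightarrow> ennreal" where
  "epowr x a = (if x = \<infinity> then \<infinity> else ennreal (enn2real x powr a))"

definition nonatomic :: "'a measure \<Rightarrow> bool" where
  "nonatomic M \<longleftrightarrow>
     (\<forall>A\<in>sets M. 0 < emeasure M A \<longrightarrow>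
        (\<exists>B\<in>sets M. B \<subseteq> A \<and> 0 < emeasure M B \<and> emeasure M B < emeasure M A))"

text \<open>The interval \<open>(0,L)\<close>, for \<open>L \<in> [0,\<infinity>]\<close>, with Lebesgue measure.\<close>

definition interval :: "ennreal \<Rightarrow> real set" where
  "interval L = {s. 0 < s \<and> ennreal s < L}"

abbreviation leb_interval :: "ennreal \<Rightarrow> real measure" where
  "leb_interval L \<equiv> lebesgue_on (interval L)"

abbreviation total_mass :: "'a measure \<Rightarrow> ennreal" where
  "total_mass M \<equiv> emeasure M (space M)"

definition distr_fun :: "'a measure \<Rightarrow> ('a \<Rightarrow> ennreal) \<Rightarrow> real \<Rightarrow> ennreal" where
  "distr_fun M f l = emeasure M {x \<in> space M. ennreal l < f x}"

definition rearr :: "'a measure \<Rightarrow> ('a \<Rightarrow> ennreal) \<Rightarrow> real \<Rightarrow> ennreal" where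
  "rearr M f t = Inf {ennreal l | l. 0 < l \<and> distr_fun M f l \<le> ennreal t}"

definition rearr_avg :: "'a measure \<Rightarrow> ('a \<Rightarrow> ennreal) \<Rightarrow> real \<Rightarrow> ennreal" where
  "rearr_avg M f t = (\<integral>\<^sup>+s\<in>{0<..<t}. rearr M f s \<partial>lborel) / ennreal t"

definition ri_norm :: "'a measure \<Rightarrow> (('a \<Rightarrow> ennreal) \<Rightarrow> ennreal) \<Rightarrow> bool" where
  "ri_norm M \<rho> \<longleftrightarrow>
     (\<forall>f\<in>borel_measurable M. \<rho> f = 0 \<longleftrightarrow> (AE x in M. f x = 0)) \<and>
     (\<forall>f\<in>borel_measurable M. \<forall>c::real. 0 \<le> c \<longrightarrow> \<rho> (\<lambda>x. ennreal c * f x) = ennreal c * \<rho> f) \<and>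
     (\<forall>f\<in>borel_measurable M. \<forall>g\<in>borel_measurable M. \<rho> (\<lambda>x. f x + g x) \<le> \<rho> f + \<rho> g) \<and>
     (\<forall>f\<in>borel_measurable M. \<forall>g\<in>borel_measurable M. (AE x in M. f x \<le> g x) \<longrightarrow> \<rho> f \<le> \<rho> g) \<and>
     (\<forall>F f. (\<forall>j::nat. F j \<in> borel_measurable M) \<and> f \<in> borel_measurable M \<and>
        (AE x in M. incseq (\<lambda>j. F j x) \<and> (\<lambda>j. F j x) \<longlonglongrightarrow> f x) \<longrightarrow>
        incseq (\<lambda>j. \<rho> (F j)) \<and> (\<lambda>j. \<rho> (F j)) \<longlonglongrightarrow> \<rho> f) \<and>
     (\<forall>E\<in>sets M. emeasure M E < \<infinity> \<longrightarrow>
        \<rho> (indicator E) < \<infinity> \<and>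
        (\<exists>C::real. \<forall>f\<in>borel_measurable M. (\<integral>\<^sup>+x\<in>E. f x \<partial>M) \<le> ennreal C * \<rho> f)) \<and>
     (\<forall>f\<in>borel_measurable M. \<forall>g\<in>borel_measurable M.
        (\<forall>l\<ge>0. distr_fun M f l = distr_fun M g l) \<longrightarrow> \<rho> f = \<rho> g)"

text \<open>The two conditions determine \<open>\<rho>bar\<close> uniquely on measurable functions.\<close>

definition representation_norm ::
  "'a measure \<Rightarrow> (('a \<Rightarrow> ennreal) \<Rightarrow> ennreal) \<Rightarrow> ((real \<Rightarrow> ennreal) \<Rightarrow> ennreal) \<Rightarrow> bool" where
  "representation_norm M \<rho> \<rho>bar \<longleftrightarrow>
     ri_norm (leb_interval (total_mass M)) \<rho>bar \<and>
     (\<forall>f\<in>borel_measurable M. \<rho> f = \<rho>bar (rearr M f))"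

definition fn_space ::
  "'a measure \<Rightarrow> (('a \<Rightarrow> ennreal) \<Rightarrow> ennreal) \<Rightarrow> ('a \<Rightarrow> 'k::{real_normed_field, euclidean_space}) set" where
  "fn_space M \<rho> = {f \<in> borel_measurable M. \<rho> (modulus f) < \<infinity>}"

definition Lp_norm :: "'a measure \<Rightarrow> real \<Rightarrow> ('a \<Rightarrow> ennreal) \<Rightarrow> ennreal" where
  "Lp_norm M a f = epowr (\<integral>\<^sup>+x. epowr (f x) a \<partial>M) (1 / a)"

definition weak_norm :: "'a measure \<Rightarrow> real \<Rightarrow> ('a \<Rightarrow> ennreal) \<Rightarrow> ennreal" where
  "weak_norm M b f = (SUP t\<in>{0<..}. ennreal (t powr (1 / b)) * rearr M f t)"

definition sum_space ::
  "('a \<Rightarrow> 'k::real_normed_field) set \<Rightarrow> ('a \<Rightarrow> 'k) set \<Rightarrow> ('a \<Rightarrow> 'k) set" where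
  "sum_space V W = {\<lambda>x. g x + h x | g h. g \<in> V \<and> h \<in> W}"

definition fundamental :: "((real \<Rightarrow> ennreal) \<Rightarrow> ennreal) \<Rightarrow> real \<Rightarrow> ennreal" where
  "fundamental \<rho>bar t = \<rho>bar (indicator {0<..<t})"

text \<open>
  Here \<open>\<infinity> * 0 = 0\<close>, so the first summand vanishes if \<open>\<phi>(0+) = 0\<close>. The fundamental function is
  quasiconcave, hence locally Lipschitz: \<open>deriv\<close> is its derivative off a null set.
\<close>

definition Lambda_norm ::
  "'a measure \<Rightarrow> ((real \<Rightarrow> ennreal) \<Rightarrow> ennreal) \<Rightarrow> ('a \<Rightarrow> ennreal) \<Rightarrow> ennreal" where
  "Lambda_norm M \<rho>bar f =
     esssup M f * Lim (at_right 0) (fundamental \<rho>bar) +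
     (\<integral>\<^sup>+s\<in>interval (total_mass M).
        rearr M f s * ennreal (deriv (\<lambda>t. enn2real (fundamental \<rho>bar t)) s) \<partial>lborel)"

text \<open>The norm of \<open>Y\<^sup>\<langle>\<^sup>p\<^sup>\<rangle>\<close>, with \<open>\<rho>bar\<close> the representation norm of \<open>Y\<close>.\<close>

definition power_avg_norm ::
  "'b measure \<Rightarrow> ((real \<Rightarrow> ennreal) \<Rightarrow> ennreal) \<Rightarrow> real \<Rightarrow> ('b \<Rightarrow> ennreal) \<Rightarrow> ennreal" where
  "power_avg_norm N \<rho>bar p f =
     \<rho>bar (\<lambda>t. epowr (rearr_avg N (\<lambda>y. epowr (f y) p) t) (1 / p))"

text \<open>
  \<open>R\<^sub>p\<^sub>,\<^sub>q\<close> for functions on \<open>(0,L)\<close>. The rearrangement over \<open>(0,L)\<close> vanishes on \<open>[L,\<infinity>)\<close>, so it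
  coincides with that of the extension by \<open>0\<close>.
\<close>

definition R_op :: "ennreal \<Rightarrow> real \<Rightarrow> real \<Rightarrow> (real \<Rightarrow> ennreal) \<Rightarrow> real \<Rightarrow> ennreal" where
  "R_op L p q g t =
     epowr ((\<integral>\<^sup>+s\<in>{0<..<t powr (q / (q - p))}. epowr (rearr (leb_interval L) g s) p \<partial>lborel)
            / ennreal t) (1 / p)"

definition R_bounded ::
  "ennreal \<Rightarrow> real \<Rightarrow> real \<Rightarrow> ((real \<Rightarrow> ennreal) \<Rightarrow> ennreal) \<Rightarrow> ((real \<Rightarrow> ennreal) \<Rightarrow> ennreal) \<Rightarrow> bool" where
  "R_bounded L p q Xbar Ybar \<longleftrightarrow>
     (\<exists>C::real. \<forall>g\<in>borel_measurable (leb_interval L).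
        Xbar g < \<infinity> \<longrightarrow> Ybar (R_op L p q g) \<le> ennreal C * Xbar g)"

definition quasi_linear ::
  "'b measure \<Rightarrow> ('a \<Rightarrow> 'k::real_normed_field) set \<Rightarrow> (('a \<Rightarrow> 'k) \<Rightarrow> 'b \<Rightarrow> 'k) \<Rightarrow> bool" where
  "quasi_linear N V T \<longleftrightarrow>
     (\<exists>k\<ge>1. \<forall>f\<in>V. \<forall>g\<in>V. AE y in N.
        norm (T (\<lambda>x. f x + g x) y) \<le> k * (norm (T f y) + norm (T g y))) \<and>
     (\<forall>\<alpha>. \<forall>f\<in>V. AE y in N. norm (T (\<lambda>x. \<alpha> * f x) y) = norm \<alpha> * norm (T f y))"

definition linear_op ::
  "'b measure \<Rightarrow> ('a \<Rightarrow> 'k::{real_normed_field, euclidean_space}) set \<Rightarrow>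
   (('a \<Rightarrow> 'k) \<Rightarrow> 'b \<Rightarrow> 'k) \<Rightarrow> bool" where
  "linear_op N V T \<longleftrightarrow>
     (\<forall>f\<in>V. T f \<in> borel_measurable N) \<and>
     (\<forall>f\<in>V. \<forall>g\<in>V. AE y in N. T (\<lambda>x. f x + g x) y = T f y + T g y) \<and>
     (\<forall>\<alpha>. \<forall>f\<in>V. AE y in N. T (\<lambda>x. \<alpha> * f x) y = \<alpha> * T f y)"

definition bounded_op ::
  "'a measure \<Rightarrow> (('a \<Rightarrow> ennreal) \<Rightarrow> ennreal) \<Rightarrow> (('b \<Rightarrow> ennreal) \<Rightarrow> ennreal) \<Rightarrow>
   (('a \<Rightarrow> 'k::{real_normed_field, euclidean_space}) \<Rightarrow> 'b \<Rightarrow> 'k) \<Rightarrow> bool" where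
  "bounded_op M \<rho> \<sigma> T \<longleftrightarrow>
     (\<exists>C::real. \<forall>f\<in>fn_space M \<rho>. \<sigma> (modulus (T f)) \<le> ennreal C * \<rho> (modulus f))"

definition sawyerable_domain ::
  "'a measure \<Rightarrow> real \<Rightarrow> real \<Rightarrow> ('a \<Rightarrow> 'k::{real_normed_field, euclidean_space}) set" where
  "sawyerable_domain M a b = sum_space (fn_space M (Lp_norm M a)) (fn_space M (weak_norm M b))"

definition sawyerable ::
  "real \<Rightarrow> real \<Rightarrow> 'a measure \<Rightarrow> 'b measure \<Rightarrow>
   (('a \<Rightarrow> 'k::{real_normed_field, euclidean_space}) \<Rightarrow> 'b \<Rightarrow> 'k) \<Rightarrow> bool" where
  "sawyerable a b M N T \<longleftrightarrow>
     1 < a \<and> a < b \<and>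
     (\<forall>f\<in>sawyerable_domain M a b. T f \<in> borel_measurable N) \<and>
     quasi_linear N (sawyerable_domain M a b) T \<and>
     bounded_op M (Lp_norm M a) (Lp_norm N a) T \<and>
     bounded_op M (weak_norm M b) (esssup N) T"

text \<open>The relation \<open>0 \<le> z \<le> w\<close>, which for complex scalars includes that \<open>z\<close> and \<open>w\<close> are real.\<close>

definition nonneg_le :: "'k::real_normed_field \<Rightarrow> 'k \<Rightarrow> bool" where
  "nonneg_le z w \<longleftrightarrow> (\<exists>s t::real. 0 \<le> s \<and> s \<le> t \<and> z = of_real s \<and> w = of_real t)"

definition order_preserving ::
  "'a measure \<Rightarrow> 'b measure \<Rightarrow> ('a \<Rightarrow> 'k::real_normed_field) set \<Rightarrow>
   (('a \<Rightarrow> 'k) \<Rightarrow> 'b \<Rightarrow> 'k) \<Rightarrow> bool" where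
  "order_preserving M N V T \<longleftrightarrow>
     (\<forall>f\<in>V. \<forall>g\<in>V. (AE x in M. nonneg_le (f x) (g x)) \<longrightarrow> (AE y in N. nonneg_le (T f y) (T g y)))"

text \<open>
  The linear span of the characteristic functions of sets of finite measure. Its elements vanish
  off \<open>space M\<close>, so that they carry no information beyond their values on \<open>space M\<close>.
\<close>

definition simple_space :: "'a measure \<Rightarrow> ('a \<Rightarrow> 'k::{real_normed_field, euclidean_space}) set" where
  "simple_space M =
     {\<lambda>x. \<Sum>i<n. c i * indicator (E i) x | (n::nat) c E.
        \<forall>i<n. E i \<in> sets M \<and> emeasure M (E i) < \<infinity>}"

definition bounded_linear_extension ::
  "'a measure \<Rightarrow> 'b measure \<Rightarrow> (('a \<Rightarrow> ennreal) \<Rightarrow> ennreal) \<Rightarrow> (('b \<Rightarrow> ennreal) \<Rightarrow> ennreal) \<Rightarrow>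
   (('a \<Rightarrow> 'k::{real_normed_field, euclidean_space}) \<Rightarrow> 'b \<Rightarrow> 'k) \<Rightarrow>
   (('a \<Rightarrow> 'k) \<Rightarrow> 'b \<Rightarrow> 'k) \<Rightarrow> bool" where
  "bounded_linear_extension M N \<rho> \<sigma> B T \<longleftrightarrow>
     (\<forall>f\<in>simple_space M. f \<in> fn_space M \<rho> \<and> (AE y in N. T f y = B f y)) \<and>
     linear_op N (fn_space M \<rho>) T \<and>
     bounded_op M \<rho> \<sigma> T"

end

theory Submission
  imports Defs
begin

text \<open>
  For a set \<open>E\<close> of measure \<open>u\<close>, the two endpoint bounds of \<open>G\<close> give
  \<open>((|B \<chi>\<^sub>E|\<^sup>p)\<^sup>*\<^sup>*)\<^sup>1\<^sup>/\<^sup>p (t) \<le> C min (u\<^sup>1\<^sup>/\<^sup>q) ((u/t)\<^sup>1\<^sup>/\<^sup>p)\<close>. For large \<open>t\<close> the right-hand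
  side is \<open>R\<^sub>p\<^sub>,\<^sub>q \<chi>\<^sub>(\<^sub>0\<^sub>,\<^sub>u\<^sub>)\<close>, and its initial plateau is dominated by a translate of a piece of the
  increasing part of that function, so rearrangement invariance and the boundedness of
  \<open>R\<^sub>p\<^sub>,\<^sub>q\<close> bound \<open>B \<chi>\<^sub>E\<close> by \<open>\<phi>\<^sub>X u\<close>. By the layer cake formula the \<open>\<Lambda>\<^sub>X\<close>-functional of \<open>f\<close> is
  \<open>\<integral>\<^sub>0\<^sup>\<infinity> \<phi>\<^sub>X (\<mu>{|f| > l}) dl\<close>, which is additive over the layers of a simple function; hence \<open>B\<close> is
  bounded on simple functions, and these are dense because \<open>\<phi>\<^sub>X\<close> is unbounded when
  \<open>\<mu>(R) = \<infinity>\<close>. Only the quasiconcavity of \<open>\<phi>\<^sub>X\<close> is available, so that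
  \<open>\<integral>\<^sub>0\<^sup>u \<phi>\<^sub>X' = \<phi>\<^sub>X u\<close> needs the almost everywhere differentiability of locally Lipschitz functions,
  and \<open>\<Lambda>\<^sub>X\<close> is merely a quasi-norm with constant \<open>2\<close>.
\<close>

section \<open>Differentiation of monotone functions\<close>

text \<open>The parameter \<open>lam\<close> acts only on exponents: raising the endpoint bounds of
  \<open>G\<close> at \<open>lam * p\<close> and \<open>lam * q\<close> to the power
  \<open>lam\<close> gives bounds at \<open>p\<close> and \<open>q\<close>, the two branches of the
  minimum. The delicate case is a domain of infinite measure with a target of finite measure. On the
  short target interval \<open>R_op\<close> applied to the indicator of (0,u) stops depending on
  \<open>u\<close> once \<open>u\<close> is large, so its boundedness says nothing about the growth
  of the fundamental function of X; there the growth hypothesis of the theorem takes over. If both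
  measures are infinite, that growth follows from the boundedness itself. The factor 2 in the
  triangle inequality of the Lorentz functional does not accumulate, because long sums are never
  split on that side: a nonnegative simple function is cut into nested layers, on which the
  functional is exactly additive, and the triangle inequality for many terms is applied only in the
  target, where Minkowski's inequality gives constant 1. The factor is paid only for sums of two
  functions, when passing from simple functions to limits.\<close>

lemma emeasure_disjoint_UN_le:
  assumes [measurable]: "\<And>i. i \<in> C \<Longrightarrow> A i \<in> sets borel" and C: "countable C" "disjoint_family_on A C"
    and [simp]: "sets \<mu> = sets borel" "sets \<nu> = sets borel"
    and le: "\<And>i. i \<in> C \<Longrightarrow> emeasure \<nu> (A i) \<le> c * emeasure \<mu> (A i)"
  shows "emeasure \<nu> (\<Union>i\<in>C. A i) \<le> c * emeasure \<mu> (\<Union>i\<in>C. A i)"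
proof -
  have "emeasure \<nu> (\<Union>i\<in>C. A i) = (\<integral>\<^sup>+i. emeasure \<nu> (A i) \<partial>count_space C)"
    using C by (intro emeasure_UN_countable) auto
  also have "\<dots> \<le> (\<integral>\<^sup>+i. c * emeasure \<mu> (A i) \<partial>count_space C)"
    using le by (intro nn_integral_mono) auto
  also have "\<dots> = c * emeasure \<mu> (\<Union>i\<in>C. A i)"
    using C by (subst emeasure_UN_countable) (auto simp: nn_integral_cmult)
  finally show ?thesis .
qed

lemma isCont_less_right:
  fixes \<phi> :: "real \<Rightarrow> real"
  assumes "isCont \<phi> 0" "\<phi> 0 < 0" "0 < d"
  obtains e where "0 < e" "e < d" "\<phi> e < 0"
proof -
  have "(\<phi> \<longlongrightarrow> \<phi> 0) (at_right 0)"
    using assms(1) by (simp add: isCont_def filterlim_at_split)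
  then have "\<forall>\<^sub>F e in at_right 0. \<phi> e < 0"
    using assms(2) by (rule order_tendstoD)
  with eventually_at_right_real[OF assms(3)] have "\<forall>\<^sub>F e in at_right 0. e \<in> {0<..<d} \<and> \<phi> e < 0"
    by (rule eventually_conj)
  then show ?thesis
    using that eventually_happens'[OF trivial_limit_at_right_real] by force
qed

text \<open>The quotient compares \<open>x\<close> with \<open>x + h\<close>, so \<open>x\<close> is
  an endpoint of the interval. Because the bound is strict and \<open>G\<close> is continuous, this
  endpoint can be pushed slightly past \<open>x\<close>; covering by open balls needs
  \<open>x\<close> inside.\<close>

lemma difference_quotient_open_interval:
  fixes G :: "real \<Rightarrow> real"
  assumes G: "isCont G x" and h: "h \<noteq> 0" "\<bar>h\<bar> < d" and q: "(G (x + h) - G x) / h < c"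
  obtains u v where "u < x" "x < v" "x - d < u" "v < x + d" "G v - G u < c * (v - u)"
proof (cases "0 < h")
  have d: "0 < d" using h by linarith
  case True
  have "isCont (\<lambda>e. G (x - e)) 0"
    by (rule isCont_o2[of _ "\<lambda>e. x - e"]) (use G in simp_all)
  then have "isCont (\<lambda>e. G (x + h) - G (x - e) - c * (h + e)) 0"
    by (rule isCont_diff[OF isCont_diff[OF continuous_const]]) simp
  moreover have "G (x + h) - G (x - 0) - c * (h + 0) < 0"
    using q True by (simp add: field_simps)
  ultimately obtain e where "0 < e" "e < d" "G (x + h) - G (x - e) - c * (h + e) < 0"
    using isCont_less_right[OF _ _ d] by blast
  then show ?thesis using that[of "x - e" "x + h"] True h by auto
next
  have d: "0 < d" using h by linarith
  case False
  have "isCont (\<lambda>e. G (x + e)) 0"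
    by (rule isCont_o2[of _ "\<lambda>e. x + e"]) (use G in simp_all)
  then have "isCont (\<lambda>e. G (x + e) - G (x + h) - c * (e - h)) 0"
    by (rule isCont_diff[OF isCont_diff[OF _ continuous_const]]) simp
  moreover have "G (x + 0) - G (x + h) - c * (0 - h) < 0"
    using q False h by (simp add: field_simps)
  ultimately obtain e where "0 < e" "e < d" "G (x + e) - G (x + h) - c * (e - h) < 0"
    using isCont_less_right[OF _ _ d] by blast
  then show ?thesis using that[of "x + h" "x + e"] False h by auto
qed

text \<open>Every open interval is a ball about its midpoint, so the intervals of slope below
  \<open>c\<close> form a fine cover of \<open>S\<close> to which the Vitali theorem for balls
  applies. Slopes above a bound are obtained from the same statement for \<open>- G\<close>.\<close>

lemma Vitali_difference_quotient:
  fixes G :: "real \<Rightarrow> real"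
  assumes G: "continuous_on UNIV G" and U: "open U" "S \<subseteq> U"
    and q: "\<And>x d. x \<in> S \<Longrightarrow> 0 < d \<Longrightarrow> \<exists>h. h \<noteq> 0 \<and> \<bar>h\<bar> < d \<and> (G (x + h) - G x) / h < c"
  obtains C :: "(real \<times> real) set" where "countable C" "disjoint_family_on (\<lambda>(u, v). {u<..<v}) C"
    "\<And>u v. (u, v) \<in> C \<Longrightarrow> u < v \<and> {u<..<v} \<subseteq> U \<and> G v - G u < c * (v - u)"
    "negligible (S - (\<Union>(u, v)\<in>C. {u<..<v}))"
proof -
  have isC: "isCont G x" for x using G by (simp add: continuous_on_eq_continuous_at)
  let ?K = "{(u, v). u < v \<and> {u<..<v} \<subseteq> U \<and> G v - G u < c * (v - u)}"
  let ?a = "\<lambda>(u, v). (u + v) / 2" and ?r = "\<lambda>(u, v). (v - u) / 2"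
  have ball: "ball (?a i) (?r i) = (\<lambda>(u, v). {u<..<v}) i" for i :: "real \<times> real"
    by (auto simp: ball_eq_greaterThanLessThan field_simps split: prod.split)
  have "\<exists>i. i \<in> ?K \<and> x \<in> ball (?a i) (?r i) \<and> ?r i < d" if x: "x \<in> S" and d: "0 < d" for x d
  proof -
    obtain e where e: "0 < e" "ball x e \<subseteq> U" using U x openE by blast
    obtain h where h: "h \<noteq> 0" "\<bar>h\<bar> < min d e" "(G (x + h) - G x) / h < c"
      using q[OF x, of "min d e"] d e by auto
    obtain u v where uv: "u < x" "x < v" "x - min d e < u" "v < x + min d e" "G v - G u < c * (v - u)"
      using difference_quotient_open_interval[OF isC h] by blast
    have "{u<..<v} \<subseteq> ball x e" using uv by (auto simp: dist_real_def)
    then show ?thesis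
      using uv e unfolding ball by (intro exI[of _ "(u, v)"]) auto
  qed
  then obtain C where C: "countable C" "C \<subseteq> ?K"
    "pairwise (\<lambda>i j. disjnt (ball (?a i) (?r i)) (ball (?a j) (?r j))) C"
    "negligible (S - (\<Union>i\<in>C. ball (?a i) (?r i)))"
    by (rule Vitali_covering_theorem_balls)
  show ?thesis
  proof (rule that)
    show "disjoint_family_on (\<lambda>(u, v). {u<..<v}) C"
      using C(3) unfolding ball by (auto simp: disjoint_family_on_def pairwise_def disjnt_def)
  qed (use C in \<open>auto simp: ball\<close>)
qed

text \<open>
  Two nested Vitali covers: intervals \<open>I\<close> of slope below \<open>\<alpha>\<close>, and inside their union intervals
  \<open>J\<close> of slope above \<open>\<beta>\<close>, so that \<open>\<beta> |J| \<le> \<nu> J \<le> \<nu> I \<le> \<alpha> |I|\<close> for the Stieltjes measure \<open>\<nu>\<close> of \<open>G\<close>.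
\<close>

lemma Vitali_gap_null:
  fixes G :: "real \<Rightarrow> real"
  assumes G: "continuous_on UNIV G" "mono G" and ab: "0 \<le> \<alpha>" "\<alpha> < \<beta>"
    and E [measurable]: "E \<in> sets borel" and fin: "emeasure lborel E < \<infinity>"
    and lo: "\<And>x d. x \<in> E \<Longrightarrow> 0 < d \<Longrightarrow> \<exists>h. h \<noteq> 0 \<and> \<bar>h\<bar> < d \<and> (G (x + h) - G x) / h < \<alpha>"
    and hi: "\<And>x d. x \<in> E \<Longrightarrow> 0 < d \<Longrightarrow> \<exists>h. h \<noteq> 0 \<and> \<bar>h\<bar> < d \<and> \<beta> < (G (x + h) - G x) / h"
  shows "emeasure lborel E = 0"
proof -
  define \<nu> where "\<nu> = interval_measure G"
  have cont: "continuous (at x within X) G" for x X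
    using G(1) by (meson UNIV_I continuous_at_imp_continuous_within continuous_on_eq_continuous_at open_UNIV)
  have \<nu>Ioc: "emeasure \<nu> {u<..v} = ennreal (G v - G u)" if "u \<le> v" for u v
    unfolding \<nu>_def using that by (intro emeasure_interval_measure_Ioc monoD[OF G(2)] cont) auto
  have "emeasure \<nu> {v..v} = ennreal (G v - G v)" for v
    unfolding \<nu>_def by (intro emeasure_interval_measure_Icc monoD[OF G(2)] G(1)) auto
  then have \<nu>sing: "emeasure \<nu> {v} = 0" for v by simp
  have [simp]: "sets \<nu> = sets borel" by (simp add: \<nu>_def)
  have \<nu>Ioo: "emeasure \<nu> {u<..<v} = ennreal (G v - G u)" if "u < v" for u v
  proof -
    have "emeasure \<nu> {u<..<v} = emeasure \<nu> ({u<..<v} \<union> {v})"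
      by (intro emeasure_Un_null_set[symmetric]) (auto simp: null_sets_def \<nu>sing)
    also have "{u<..<v} \<union> {v} = {u<..v}" using that by auto
    finally show ?thesis using \<nu>Ioc that by simp
  qed
  have key: "ennreal \<beta> * emeasure lborel E \<le> ennreal \<alpha> * (emeasure lborel E + ennreal e)" if e: "0 < e" for e
  proof -
    obtain U where U: "open U" "E \<subseteq> U" "emeasure lborel (U - E) < ennreal e"
      using outer_regular_lborel[OF E e] by blast
    obtain C where C: "countable C" "disjoint_family_on (\<lambda>(u, v). {u<..<v}) C"
      "\<And>u v. (u, v) \<in> C \<Longrightarrow> u < v \<and> {u<..<v} \<subseteq> U \<and> G v - G u < \<alpha> * (v - u)"
      "negligible (E - (\<Union>(u, v)\<in>C. {u<..<v}))"
      by (rule Vitali_difference_quotient[OF G(1) U(1,2) lo]) auto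
    define I where "I = (\<Union>(u, v)\<in>C. {u<..<v})"
    have oI: "open I" unfolding I_def by (auto intro!: open_UN)
    have "continuous_on UNIV (\<lambda>x. - G x)" using G(1) by (rule continuous_on_minus)
    moreover have "\<exists>h. h \<noteq> 0 \<and> \<bar>h\<bar> < d \<and> (- G (x + h) - - G x) / h < - \<beta>" if x: "x \<in> E \<inter> I" "0 < d" for x d
    proof -
      obtain h where "h \<noteq> 0" "\<bar>h\<bar> < d" "\<beta> < (G (x + h) - G x) / h" using hi[of x d] x by blast
      moreover have "(- G (x + h) - - G x) / h = - ((G (x + h) - G x) / h)"
        by (simp add: diff_divide_distrib)
      ultimately show ?thesis by (intro exI[of _ h]) simp
    qed
    ultimately obtain D where D: "countable D" "disjoint_family_on (\<lambda>(u, v). {u<..<v}) D"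
      "\<And>u v. (u, v) \<in> D \<Longrightarrow> u < v \<and> {u<..<v} \<subseteq> I \<and> - G v - - G u < - \<beta> * (v - u)"
      "negligible (E \<inter> I - (\<Union>(u, v)\<in>D. {u<..<v}))"
      using Vitali_difference_quotient[OF _ oI Int_lower2, of "\<lambda>x. - G x" E "- \<beta>"] by blast
    define J where "J = (\<Union>(u, v)\<in>D. {u<..<v})"
    have [measurable]: "open J" unfolding J_def by (auto intro!: open_UN)
    have [measurable]: "I \<in> sets borel" "J \<in> sets borel" "U \<in> sets borel"
      using oI \<open>open J\<close> U(1) by auto
    have "negligible (E - J)"
      using C(4) D(4) unfolding I_def[symmetric] J_def[symmetric]
      by (auto intro: negligible_subset[OF negligible_Un])
    then have nE: "emeasure lborel (E - J) = 0"
      by (simp add: negligible_iff_null_sets null_sets_def)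
    have "emeasure lborel E \<le> emeasure lborel (J \<union> (E - J))"
      by (intro emeasure_mono) auto
    also have "\<dots> \<le> emeasure lborel J + emeasure lborel (E - J)"
      by (rule emeasure_subadditive) auto
    finally have "ennreal \<beta> * emeasure lborel E \<le> ennreal \<beta> * emeasure lborel J"
      using nE by (auto intro!: mult_left_mono)
    also have "\<dots> \<le> emeasure \<nu> J"
    proof -
      have "emeasure lborel J \<le> ennreal (1 / \<beta>) * emeasure \<nu> J"
        unfolding J_def
      proof (rule emeasure_disjoint_UN_le)
        fix i assume "i \<in> D"
        obtain u v where i: "i = (u, v)" by force
        have uv: "u < v" "\<beta> * (v - u) < G v - G u" using D(3)[of u v] \<open>i \<in> D\<close> by (auto simp: i algebra_simps)
        have "ennreal (v - u) \<le> ennreal (1 / \<beta> * (G v - G u))"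
          using uv ab by (intro ennreal_leI) (simp add: field_simps)
        also have "\<dots> = ennreal (1 / \<beta>) * ennreal (G v - G u)"
          using uv ab monoD[OF G(2), of u v] by (intro ennreal_mult) auto
        finally show "emeasure lborel (case i of (u, v) \<Rightarrow> {u<..<v}) \<le> ennreal (1 / \<beta>) * emeasure \<nu> (case i of (u, v) \<Rightarrow> {u<..<v})"
          using uv \<nu>Ioo[OF uv(1)] by (simp add: i)
      qed (use D in auto)
      then have "ennreal \<beta> * emeasure lborel J \<le> ennreal \<beta> * (ennreal (1 / \<beta>) * emeasure \<nu> J)"
        by (rule mult_left_mono) simp
      also have "\<dots> = emeasure \<nu> J"
        using ab by (simp add: mult.assoc[symmetric] flip: ennreal_mult)
      finally show ?thesis .
    qed
    also have "\<dots> \<le> emeasure \<nu> I"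
      using D(3) by (intro emeasure_mono) (auto simp: J_def)
    also have "\<dots> \<le> ennreal \<alpha> * emeasure lborel I"
      unfolding I_def
    proof (rule emeasure_disjoint_UN_le)
      fix i assume "i \<in> C"
      obtain u v where i: "i = (u, v)" by force
      have uv: "u < v" "G v - G u < \<alpha> * (v - u)" using C(3) \<open>i \<in> C\<close> by (auto simp: i)
      then show "emeasure \<nu> (case i of (u, v) \<Rightarrow> {u<..<v}) \<le> ennreal \<alpha> * emeasure lborel (case i of (u, v) \<Rightarrow> {u<..<v})"
        using ab by (simp add: i \<nu>Ioo ennreal_leI flip: ennreal_mult)
    qed (use C in auto)
    also have "\<dots> \<le> ennreal \<alpha> * (emeasure lborel E + emeasure lborel (U - E))"
      using C(3) U
      by (intro mult_left_mono order_trans[OF emeasure_mono emeasure_subadditive]) (auto simp: I_def)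
    also have "\<dots> \<le> ennreal \<alpha> * (emeasure lborel E + ennreal e)"
      using U(3) by (intro mult_left_mono add_left_mono) auto
    finally show ?thesis .
  qed
  obtain m where m: "emeasure lborel E = ennreal m" "0 \<le> m" using fin by (metis ennreal_cases infinity_ennreal_def order_less_irrefl)
  have "\<beta> * m \<le> \<alpha> * (m + e)" if "0 < e" for e
    using key[OF that] that ab m by (simp flip: ennreal_plus ennreal_mult)
  note le = this
  have "\<beta> * m \<le> \<alpha> * m + e" if "0 < e" for e
  proof (cases "\<alpha> = 0")
    case False
    with ab that have "0 < e / \<alpha>" by simp
    from le[OF this] show ?thesis using False by (simp add: distrib_left)
  next
    case True
    with le[OF that] that show ?thesis by simp
  qed
  then have "\<beta> * m \<le> \<alpha> * m" by (rule field_le_epsilon)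
  then have "m \<le> 0" using ab m(2) by (simp add: mult_le_cancel_right)
  with m show ?thesis by simp
qed


text \<open>The union over uncountably many steps \<open>h\<close> is harmless because each of its
  members is open; this is the source of measurability for the sets where the quotients
  oscillate.\<close>

lemma open_difference_quotient_superlevel:
  fixes G :: "real \<Rightarrow> real"
  assumes G: "continuous_on UNIV G"
  shows "open {x. \<exists>h. h \<noteq> 0 \<and> \<bar>h\<bar> < d \<and> c < (G (x + h) - G x) / h}"
    and "open {x. \<exists>h. h \<noteq> 0 \<and> \<bar>h\<bar> < d \<and> (G (x + h) - G x) / h < c}"
proof -
  have *: "{x. \<exists>h. h \<noteq> 0 \<and> \<bar>h\<bar> < d \<and> P x h} = (\<Union>h\<in>{h. h \<noteq> 0 \<and> \<bar>h\<bar> < d}. {x. P x h})" for P :: "real \<Rightarrow> real \<Rightarrow> bool"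
    by auto
  have c: "continuous_on UNIV (\<lambda>x. (G (x + h) - G x) / h)" if "h \<noteq> 0" for h
    using that by (intro continuous_intros continuous_on_compose2[OF G]) auto
  show "open {x. \<exists>h. h \<noteq> 0 \<and> \<bar>h\<bar> < d \<and> c < (G (x + h) - G x) / h}"
    unfolding * using c by (auto intro!: open_UN open_Collect_less continuous_on_const)
  show "open {x. \<exists>h. h \<noteq> 0 \<and> \<bar>h\<bar> < d \<and> (G (x + h) - G x) / h < c}"
    unfolding * using c by (auto intro!: open_UN open_Collect_less continuous_on_const)
qed

text \<open>If the lower and upper limits of the quotients differ, two rationals fit between them,
  and the point lies in one of countably many sets \<open>E \<alpha> \<beta> k\<close>, each null by
  \<open>Vitali_gap_null\<close>; the ball in \<open>E\<close> supplies finite measure. Bounded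
  quotients rule out an infinite limit, and they come for free from a local Lipschitz bound.\<close>

lemma mono_differentiable_AE:
  fixes G :: "real \<Rightarrow> real"
  assumes G: "continuous_on UNIV G" "mono G"
  shows "AE x in lborel. (\<exists>K. \<forall>\<^sub>F h in at 0. \<bar>(G (x + h) - G x) / h\<bar> \<le> K) \<longrightarrow> G differentiable (at x)"
proof -
  define lo where "lo c n = {x. \<exists>h. h \<noteq> 0 \<and> \<bar>h\<bar> < 1 / real (Suc n) \<and> (G (x + h) - G x) / h < c}" for c n
  define hi where "hi c n = {x. \<exists>h. h \<noteq> 0 \<and> \<bar>h\<bar> < 1 / real (Suc n) \<and> c < (G (x + h) - G x) / h}" for c n
  define E where "E \<alpha> \<beta> k = ball 0 (real k) \<inter> (\<Inter>n. lo \<alpha> n) \<inter> (\<Inter>n. hi \<beta> n)" for \<alpha> \<beta> k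
  have [measurable]: "lo c n \<in> sets borel" "hi c n \<in> sets borel" for c n
    unfolding lo_def hi_def using open_difference_quotient_superlevel[OF G(1)] by (auto intro: borel_open)
  have Em [measurable]: "E \<alpha> \<beta> k \<in> sets borel" for \<alpha> \<beta> k unfolding E_def by measurable
  have null: "emeasure lborel (E \<alpha> \<beta> k) = 0" if "0 \<le> \<alpha>" "\<alpha> < \<beta>" for \<alpha> \<beta> k
  proof (rule Vitali_gap_null[OF G that])
    have "emeasure lborel (E \<alpha> \<beta> k) \<le> emeasure lborel (ball (0::real) (real k))"
      by (intro emeasure_mono) (auto simp: E_def)
    also have "\<dots> < \<infinity>" using emeasure_bounded_finite bounded_ball by blast
    finally show "emeasure lborel (E \<alpha> \<beta> k) < \<infinity>" .
  next
    fix x d assume x: "x \<in> E \<alpha> \<beta> k" and "0 < (d::real)"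
    then obtain n where n: "1 / real (Suc n) < d" using nat_approx_posE by metis
    have "x \<in> lo \<alpha> n" "x \<in> hi \<beta> n" using x by (auto simp: E_def)
    with n show "\<exists>h. h \<noteq> 0 \<and> \<bar>h\<bar> < d \<and> (G (x + h) - G x) / h < \<alpha>"
      "\<exists>h. h \<noteq> 0 \<and> \<bar>h\<bar> < d \<and> \<beta> < (G (x + h) - G x) / h"
      unfolding lo_def hi_def by (blast intro: less_trans)+
  qed auto
  have "AE x in lborel. \<forall>\<alpha>\<in>\<rat>. \<forall>\<beta>\<in>\<rat>. \<forall>k. 0 \<le> \<alpha> \<and> \<alpha> < \<beta> \<longrightarrow> x \<notin> E \<alpha> \<beta> k"
  proof (intro AE_ball_countable' countable_rat, subst AE_all_countable, intro allI)
    fix \<alpha> \<beta> k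
    show "AE x in lborel. 0 \<le> \<alpha> \<and> \<alpha> < \<beta> \<longrightarrow> x \<notin> E \<alpha> \<beta> k"
      using null[of \<alpha> \<beta> k] by (cases "0 \<le> \<alpha> \<and> \<alpha> < \<beta>") (auto intro!: AE_not_in simp: null_sets_def)
  qed
  then show ?thesis
  proof (rule eventually_mono, intro impI)
    fix x assume x: "\<forall>\<alpha>\<in>\<rat>. \<forall>\<beta>\<in>\<rat>. \<forall>k. 0 \<le> \<alpha> \<and> \<alpha> < \<beta> \<longrightarrow> x \<notin> E \<alpha> \<beta> k"
      and "\<exists>K. \<forall>\<^sub>F h in at 0. \<bar>(G (x + h) - G x) / h\<bar> \<le> K"
    then obtain K where K: "\<forall>\<^sub>F h in at 0. \<bar>(G (x + h) - G x) / h\<bar> \<le> K" by blast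
    let ?q = "\<lambda>h. (G (x + h) - G x) / h"
    let ?Q = "\<lambda>h. ereal (?q h)"
    obtain k where k: "\<bar>x\<bar> < real k" using reals_Archimedean2 by blast
    have nonneg: "0 \<le> ?q h" for h
      using monoD[OF G(2), of x "x + h"] monoD[OF G(2), of "x + h" x]
      by (cases "0 \<le> h") (auto simp: zero_le_divide_iff)
    have L0: "0 \<le> Liminf (at 0) ?Q"
      using nonneg by (intro Liminf_bounded) (auto simp: zero_ereal_def[symmetric])
    have UK: "Limsup (at 0) ?Q \<le> ereal K"
      using K by (intro Limsup_bounded, elim eventually_mono) (metis abs_le_D1 ereal_less_eq(3))
    have le: "Liminf (at 0) ?Q \<le> Limsup (at 0) ?Q" by (rule Liminf_le_Limsup) simp
    have eq: "Liminf (at 0) ?Q = Limsup (at 0) ?Q"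
    proof (rule ccontr)
      assume "Liminf (at 0) ?Q \<noteq> Limsup (at 0) ?Q"
      with le have "Liminf (at 0) ?Q < Limsup (at 0) ?Q" by simp
      moreover from this L0 UK le obtain l u where lu: "Liminf (at 0) ?Q = ereal l" "Limsup (at 0) ?Q = ereal u"
        by (cases "Liminf (at 0) ?Q"; cases "Limsup (at 0) ?Q") auto
      ultimately have "l < u" by simp
      obtain \<beta> where \<beta>: "\<beta> \<in> \<rat>" "l < \<beta>" "\<beta> < u" using Rats_dense_in_real[OF \<open>l < u\<close>] by blast
      obtain \<alpha> where \<alpha>: "\<alpha> \<in> \<rat>" "l < \<alpha>" "\<alpha> < \<beta>" using Rats_dense_in_real[OF \<beta>(2)] by blast
      have ex: "\<exists>h. h \<noteq> 0 \<and> \<bar>h\<bar> < 1 / real (Suc n) \<and> P h" if "\<exists>\<^sub>F h in at 0. P h" for P n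
      proof -
        have "\<forall>\<^sub>F h in at 0. h \<noteq> 0 \<and> \<bar>h\<bar> < 1 / real (Suc n)"
          by (auto simp: eventually_at dist_real_def intro!: exI[of _ "1 / real (Suc n)"])
        then show ?thesis
          using frequently_ex[OF frequently_eventually_conj[OF that]] by auto
      qed
      have "\<exists>\<^sub>F h in at 0. ?q h < \<alpha>"
      proof (rule ccontr)
        assume "\<not> ?thesis"
        then have "\<forall>\<^sub>F h in at 0. ereal \<alpha> \<le> ?Q h" by (simp add: not_frequently not_less)
        then have "ereal \<alpha> \<le> Liminf (at 0) ?Q" by (rule Liminf_bounded)
        with lu \<alpha> show False by simp
      qed
      moreover have "\<exists>\<^sub>F h in at 0. \<beta> < ?q h"
      proof (rule ccontr)
        assume "\<not> ?thesis"
        then have "\<forall>\<^sub>F h in at 0. ?Q h \<le> ereal \<beta>" by (simp add: not_frequently not_less)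
        then have "Limsup (at 0) ?Q \<le> ereal \<beta>" by (rule Limsup_bounded)
        with lu \<beta> show False by simp
      qed
      ultimately have "x \<in> E \<alpha> \<beta> k"
        using k ex unfolding E_def lo_def hi_def by (auto simp: dist_real_def)
      moreover have "0 \<le> \<alpha>" using L0 lu \<alpha> by simp
      ultimately show False using x \<alpha> \<beta> by blast
    qed
    have "0 \<le> Limsup (at 0) ?Q" using L0 le by (rule order_trans)
    with UK obtain l where "Limsup (at 0) ?Q = ereal l"
      by (cases "Limsup (at 0) ?Q") auto
    with eq have "(?Q \<longlongrightarrow> ereal l) (at 0)"
      by (intro Liminf_eq_Limsup) auto
    then have "(?q \<longlongrightarrow> l) (at 0)" by simp
    then have "(G has_real_derivative l) (at x)" by (simp add: DERIV_def)
    then show "G differentiable (at x)" by (auto simp: real_differentiable_def)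
  qed
qed


lemma DERIV_shift_quotient:
  assumes "(G has_real_derivative D) (at x)"
  shows "(\<lambda>n. (G (x + 1 / real (Suc n)) - G x) / (1 / real (Suc n))) \<longlonglongrightarrow> D"
proof -
  have "filterlim (\<lambda>n. 1 / real (Suc n)) (at 0) sequentially"
    using LIMSEQ_inverse_real_of_nat by (intro filterlim_atI) (auto simp: inverse_eq_divide)
  then show ?thesis
    using assms unfolding DERIV_def by (rule filterlim_compose[rotated])
qed

text \<open>The properties of a fundamental function used for differentiation. The Lipschitz
  constant may blow up as \<open>a\<close> tends to 0, as for a square root, hence the separate
  assumption \<open>lim0\<close>.\<close>

locale mono_locally_Lipschitz =
  fixes F :: "real \<Rightarrow> real"
  assumes mono: "mono F" and nonpos: "\<And>t. t \<le> 0 \<Longrightarrow> F t = 0" and lim0: "(F \<longlongrightarrow> 0) (at_right 0)"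
    and Lipschitz: "\<And>a b. 0 < a \<Longrightarrow> \<exists>K. \<forall>s t. a \<le> s \<longrightarrow> s \<le> t \<longrightarrow> t \<le> b \<longrightarrow> F t - F s \<le> K * (t - s)"
begin

lemma quotient_bound:
  assumes "0 < a"
  obtains K where "0 \<le> K" "\<And>x y. a \<le> x \<Longrightarrow> x \<le> b \<Longrightarrow> a \<le> y \<Longrightarrow> y \<le> b \<Longrightarrow> \<bar>F y - F x\<bar> \<le> K * \<bar>y - x\<bar>"
proof -
  from Lipschitz[OF assms, of b] obtain K where
    K: "\<And>s t. a \<le> s \<Longrightarrow> s \<le> t \<Longrightarrow> t \<le> b \<Longrightarrow> F t - F s \<le> K * (t - s)" by blast
  have "\<bar>F y - F x\<bar> \<le> max 0 K * \<bar>y - x\<bar>" if "a \<le> x" "x \<le> b" "a \<le> y" "y \<le> b" for x y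
    using that K[of x y] K[of y x] monoD[OF mono, of x y] monoD[OF mono, of y x]
      mult_right_mono[of K "max 0 K" "y - x"] mult_right_mono[of K "max 0 K" "x - y"]
    by (cases x y rule: le_cases) (auto simp: abs_if split: if_splits)
  then show ?thesis using that[of "max 0 K"] by simp
qed

lemma isCont: "isCont F x"
proof (cases "0 < x")
  case True
  obtain K where K: "0 \<le> K" "\<And>y z. x / 2 \<le> y \<Longrightarrow> y \<le> 2 * x \<Longrightarrow> x / 2 \<le> z \<Longrightarrow> z \<le> 2 * x \<Longrightarrow> \<bar>F z - F y\<bar> \<le> K * \<bar>z - y\<bar>"
    using quotient_bound[of "x / 2" "2 * x"] True by auto
  have "((\<lambda>z. K * \<bar>z - x\<bar>) \<longlongrightarrow> K * \<bar>x - x\<bar>) (at x)" by (intro tendsto_intros)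
  then have "((\<lambda>z. K * \<bar>z - x\<bar>) \<longlongrightarrow> 0) (at x)" by simp
  moreover have "\<forall>\<^sub>F z in at x. z \<in> {x / 2<..<2 * x}"
    using True by (intro eventually_at_in_open') auto
  then have "\<forall>\<^sub>F z in at x. norm (F z - F x) \<le> K * \<bar>z - x\<bar>"
    by (rule eventually_mono) (use True in \<open>auto intro!: K(2)\<close>)
  ultimately have "((\<lambda>z. F z - F x) \<longlongrightarrow> 0) (at x)"
    by (rule Lim_null_comparison[rotated])
  then show ?thesis by (simp add: isCont_def LIM_zero_iff)
next
  case False
  have "(F \<longlongrightarrow> 0) (at_left x)"
    using False by (intro tendsto_eventually) (auto simp: eventually_at_filter nonpos)
  moreover have "(F \<longlongrightarrow> 0) (at_right x)"
  proof (cases "x = 0")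
    case False
    with \<open>\<not> 0 < x\<close> have "\<forall>\<^sub>F z in at_right x. z \<in> {x<..<0}" by (intro eventually_at_right_real) auto
    then show ?thesis by (intro tendsto_eventually) (auto elim!: eventually_mono simp: nonpos)
  qed (simp add: lim0)
  ultimately show ?thesis
    using False by (simp add: isCont_def filterlim_split_at nonpos)
qed

lemma continuous: "continuous_on A F"
  by (simp add: continuous_at_imp_continuous_on isCont)

lemma differentiable_AE: "AE x in lborel. 0 < x \<longrightarrow> F differentiable (at x)"
  using mono_differentiable_AE[OF continuous mono]
proof (rule eventually_mono, intro impI)
  fix x :: real
  assume *: "(\<exists>K. \<forall>\<^sub>F h in at 0. \<bar>(F (x + h) - F x) / h\<bar> \<le> K) \<longrightarrow> F differentiable (at x)" and x: "0 < x"
  obtain K where K: "0 \<le> K" "\<And>y z. x / 2 \<le> y \<Longrightarrow> y \<le> 2 * x \<Longrightarrow> x / 2 \<le> z \<Longrightarrow> z \<le> 2 * x \<Longrightarrow> \<bar>F z - F y\<bar> \<le> K * \<bar>z - y\<bar>"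
    using quotient_bound[of "x / 2" "2 * x"] x by auto
  have "\<forall>\<^sub>F h in at 0. h \<in> {- x / 2<..<x} - {0}"
    using x by (intro eventually_at_in_open) auto
  then have "\<forall>\<^sub>F h in at 0. \<bar>(F (x + h) - F x) / h\<bar> \<le> K"
    by (rule eventually_mono) (use x K(2)[of x "x + _"] in \<open>auto simp: abs_divide divide_simps mult.commute\<close>)
  with * show "F differentiable (at x)" by blast
qed

text \<open>\<open>deriv F\<close> is an unspecified value wherever \<open>F\<close> is not
  differentiable, so its measurability is unclear. The limit along the fixed steps
  \<open>1 / real (Suc n)\<close> is Borel measurable and agrees with \<open>deriv F\<close> almost
  everywhere on the positive half-line.\<close>

definition slope :: "real \<Rightarrow> real" where
  "slope x = lim (\<lambda>n. (F (x + 1 / real (Suc n)) - F x) / (1 / real (Suc n)))"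

lemma borel_measurable_F [measurable]: "F \<in> borel_measurable borel"
  by (rule borel_measurable_continuous_onI[OF continuous])

lemma borel_measurable_slope [measurable]: "slope \<in> borel_measurable borel"
  unfolding slope_def by measurable

lemma slope_eq:
  assumes "F differentiable (at x)"
  shows "(\<lambda>n. (F (x + 1 / real (Suc n)) - F x) / (1 / real (Suc n))) \<longlonglongrightarrow> slope x" "slope x = deriv F x"
proof -
  have "(F has_real_derivative deriv F x) (at x)"
    using assms DERIV_deriv_iff_real_differentiable by blast
  from DERIV_shift_quotient[OF this] show "slope x = deriv F x"
    unfolding slope_def by (rule limI)
  with DERIV_shift_quotient[OF \<open>(F has_real_derivative deriv F x) (at x)\<close>]
  show "(\<lambda>n. (F (x + 1 / real (Suc n)) - F x) / (1 / real (Suc n))) \<longlonglongrightarrow> slope x" by simp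
qed

lemma slope_AE: "AE x in lborel. 0 < x \<longrightarrow> deriv F x = slope x \<and> 0 \<le> slope x"
  using differentiable_AE
proof (rule eventually_mono, intro impI)
  fix x :: real assume "0 < x \<longrightarrow> F differentiable (at x)" "0 < x"
  then have d: "F differentiable (at x)" by simp
  have "0 \<le> slope x"
    using monoD[OF mono] by (intro LIMSEQ_le_const[OF slope_eq(1)[OF d]]) (auto simp: zero_le_mult_iff)
  with slope_eq[OF d] show "deriv F x = slope x \<and> 0 \<le> slope x" by simp
qed

text \<open>The integral over [a,b] of the difference quotient with step d is the mean of
  \<open>F\<close> over [b,b+d] minus its mean over [a,a+d], which tends to
  \<open>F b - F a\<close>. The Lipschitz constant dominates the quotients, so the limit may be
  taken under the integral.\<close>

lemma nn_integral_slope_Icc: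
  assumes ab: "0 < a" "a \<le> b"
  shows "(\<integral>\<^sup>+x\<in>{a..b}. ennreal (slope x) \<partial>lborel) = ennreal (F b - F a)"
proof -
  \<comment> \<open>Steps are at most 1, so arguments up to \<open>b + 1\<close> occur; the extra
    margins make [a,b+1] interior, where the derivative within the interval is two-sided.\<close>
  obtain \<Phi>' where \<Phi>': "\<And>x. x \<in> {a - 1..b + 2} \<Longrightarrow> (\<Phi>' has_vector_derivative F x) (at x within {a - 1..b + 2})"
    using antiderivative_continuous[OF continuous] by blast
  have \<Phi>: "(\<Phi>' has_real_derivative F x) (at x)" if "a \<le> x" "x \<le> b + 1" for x
    using \<Phi>'[of x] that at_within_Icc_at[of "a - 1" x "b + 2"]
    by (simp add: has_real_derivative_iff_has_vector_derivative)
  define Q where "Q n x = (F (x + 1 / real (Suc n)) - F x) / (1 / real (Suc n))" for n x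
  have Qint: "has_bochner_integral lborel (\<lambda>x. Q n x * indicator {a..b} x)
      ((\<Phi>' (b + 1 / real (Suc n)) - \<Phi>' b) / (1 / real (Suc n)) - (\<Phi>' (a + 1 / real (Suc n)) - \<Phi>' a) / (1 / real (Suc n)))" for n
  proof -
    define d where "d = 1 / real (Suc n)"
    have d: "0 < d" "d \<le> 1" by (auto simp: d_def)
    have "has_bochner_integral lborel (\<lambda>x. Q n x * indicator {a..b} x)
      ((\<Phi>' (b + d) - \<Phi>' b) / d - (\<Phi>' (a + d) - \<Phi>' a) / d)"
    proof (rule has_bochner_integral_FTC_Icc_real)
      fix x assume x: "a \<le> x" "x \<le> b"
      have "((\<lambda>x. \<Phi>' (x + d)) has_real_derivative F (x + d)) (at x)"
        using \<Phi>[of "x + d"] x d by (simp add: DERIV_shift)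
      moreover have "(\<Phi>' has_real_derivative F x) (at x)"
        using \<Phi>[of x] x by simp
      ultimately have "((\<lambda>x. (\<Phi>' (x + d) - \<Phi>' x) / d) has_real_derivative (F (x + d) - F x) / d) (at x)"
        by (intro DERIV_cdivide DERIV_diff)
      then show "((\<lambda>x. (\<Phi>' (x + d) - \<Phi>' x) / d) has_real_derivative Q n x) (at x)"
        by (simp add: Q_def d_def)
      show "isCont (Q n) x"
        unfolding Q_def using isCont
        by (intro isCont_divide isCont_diff isCont_o2[of x "\<lambda>x. x + 1 / real (Suc n)" F]) auto
    qed fact
    then show ?thesis by (simp add: d_def)
  qed
  obtain K where K: "0 \<le> K" "\<And>x y. a \<le> x \<Longrightarrow> x \<le> b + 1 \<Longrightarrow> a \<le> y \<Longrightarrow> y \<le> b + 1 \<Longrightarrow> \<bar>F y - F x\<bar> \<le> K * \<bar>y - x\<bar>"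
    using quotient_bound[OF ab(1), of "b + 1"] by blast
  have Qm [measurable]: "Q n \<in> borel_measurable borel" for n unfolding Q_def by measurable
  have bound: "norm (Q n x * indicator {a..b} x) \<le> K * indicator {a..b} x" for n x
  proof (cases "x \<in> {a..b}")
    case True
    have "0 \<le> 1 / real (Suc n)" "1 / real (Suc n) \<le> 1" by simp_all
    then have "a \<le> x + 1 / real (Suc n)" "x + 1 / real (Suc n) \<le> b + 1"
      using True unfolding atLeastAtMost_iff by linarith+
    then have "\<bar>F (x + 1 / real (Suc n)) - F x\<bar> \<le> K * \<bar>x + 1 / real (Suc n) - x\<bar>"
      using True by (intro K(2)) auto
    then have "\<bar>Q n x\<bar> \<le> K"
      unfolding Q_def abs_divide by (subst pos_divide_le_eq) simp_all
    then show ?thesis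
      using True by simp
  qed simp
  have "AE x in lborel. x \<in> {a..b} \<longrightarrow> F differentiable (at x)"
    using differentiable_AE by (rule eventually_mono) (use ab in auto)
  then have lim: "AE x in lborel. (\<lambda>n. Q n x * indicator {a..b} x) \<longlonglongrightarrow> slope x * indicator {a..b} x"
    by (rule eventually_mono) (auto simp: Q_def indicator_def dest: slope_eq(1))
  have I: "integrable lborel (\<lambda>x. K * indicator {a..b} x)"
    by (intro integrable_mult_right integrable_real_indicator) (auto simp: emeasure_lborel_Icc_eq)
  have int: "integrable lborel (\<lambda>x. slope x * indicator {a..b} x)"
    and conv: "(\<lambda>n. integral\<^sup>L lborel (\<lambda>x. Q n x * indicator {a..b} x)) \<longlonglongrightarrow> integral\<^sup>L lborel (\<lambda>x. slope x * indicator {a..b} x)"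
    using lim bound
    by (auto intro!: integrable_dominated_convergence[OF _ _ I] integral_dominated_convergence[OF _ _ I])
  have "(\<lambda>n. (\<Phi>' (b + 1 / real (Suc n)) - \<Phi>' b) / (1 / real (Suc n)) - (\<Phi>' (a + 1 / real (Suc n)) - \<Phi>' a) / (1 / real (Suc n)))
     \<longlonglongrightarrow> F b - F a"
    using ab by (intro tendsto_diff DERIV_shift_quotient \<Phi>) auto
  then have "(\<lambda>n. integral\<^sup>L lborel (\<lambda>x. Q n x * indicator {a..b} x)) \<longlonglongrightarrow> F b - F a"
    by (simp only: has_bochner_integral_integral_eq[OF Qint])
  then have "integral\<^sup>L lborel (\<lambda>x. slope x * indicator {a..b} x) = F b - F a"
    using conv LIMSEQ_unique by blast
  moreover have "(\<integral>\<^sup>+x\<in>{a..b}. ennreal (slope x) \<partial>lborel) = (\<integral>\<^sup>+x. ennreal (slope x * indicator {a..b} x) \<partial>lborel)"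
    by (intro nn_integral_cong) (auto simp: indicator_def)
  moreover have "AE x in lborel. 0 \<le> slope x * indicator {a..b} x"
    using slope_AE by (rule eventually_mono) (use ab in \<open>auto simp: indicator_def\<close>)
  ultimately show ?thesis using nn_integral_eq_integral[OF int] by simp
qed

text \<open>The intervals from \<open>b / Suc n\<close> to \<open>b\<close> exhaust (0,b], and the
  boundary term at the left end vanishes by \<open>lim0\<close>.\<close>

lemma nn_integral_slope:
  assumes "0 \<le> b"
  shows "(\<integral>\<^sup>+x\<in>{0<..<b}. ennreal (slope x) \<partial>lborel) = ennreal (F b)"
proof (cases "b = 0")
  case False
  with assms have b: "0 < b" by simp
  define A where "A n = {b * (1 / real (Suc n))..b}" for n
  define \<mu> where "\<mu> = density lborel (\<lambda>x. ennreal (slope x))"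
  have lb: "0 < b * (1 / real (Suc n))" "b * (1 / real (Suc n)) \<le> b" for n using b by (auto simp: field_simps)
  have A: "emeasure \<mu> (A n) = ennreal (F b - F (b * (1 / real (Suc n))))" for n
    unfolding \<mu>_def A_def using nn_integral_slope_Icc[OF lb] by (simp add: emeasure_density)
  have inv: "(\<lambda>n. b * (1 / real (Suc n))) \<longlonglongrightarrow> b * 0"
    using LIMSEQ_inverse_real_of_nat by (intro tendsto_intros) (simp add: inverse_eq_divide)
  then have "filterlim (\<lambda>n. b * (1 / real (Suc n))) (at_right 0) sequentially"
    by (intro tendsto_imp_filterlim_at_right) (use lb in simp_all)
  then have "(\<lambda>n. F (b * (1 / real (Suc n)))) \<longlonglongrightarrow> 0"
    by (rule filterlim_compose[OF lim0])
  then have "(\<lambda>n. emeasure \<mu> (A n)) \<longlonglongrightarrow> ennreal (F b - 0)"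
    unfolding A by (intro tendsto_ennrealI tendsto_intros)
  moreover have "(\<lambda>n. emeasure \<mu> (A n)) \<longlonglongrightarrow> emeasure \<mu> (\<Union>n. A n)"
    using b by (intro Lim_emeasure_incseq) (auto simp: \<mu>_def A_def incseq_def frac_le divide_simps intro: order_trans)
  ultimately have "emeasure \<mu> (\<Union>n. A n) = ennreal (F b)"
    using LIMSEQ_unique by fastforce
  moreover have "(\<Union>n. A n) = {0<..b}"
  proof (intro equalityI subsetI)
    fix x assume x: "x \<in> {0<..b}"
    then have "\<forall>\<^sub>F n in sequentially. b * (1 / real (Suc n)) < x"
      using order_tendstoD(2)[OF inv, of x] by simp
    then obtain n where "b * (1 / real (Suc n)) < x" by (auto simp: eventually_sequentially)
    then show "x \<in> (\<Union>n. A n)" using x by (auto simp: A_def intro!: exI[of _ n])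
  qed (use lb in \<open>auto simp: A_def intro: less_le_trans\<close>)
  moreover have "emeasure \<mu> {0<..b} = (\<integral>\<^sup>+x\<in>{0<..<b}. ennreal (slope x) \<partial>lborel)"
    unfolding \<mu>_def using AE_lborel_singleton[of b]
    by (subst emeasure_density) (auto intro!: nn_integral_cong_AE elim!: eventually_mono simp: indicator_def)
  ultimately show ?thesis by simp
qed (simp add: nonpos)

end

section \<open>Distribution functions and rearrangements\<close>

lemma distr_fun_mono:
  assumes "f \<in> borel_measurable M" "g \<in> borel_measurable M" "AE x in M. f x \<le> g x"
  shows "distr_fun M f l \<le> distr_fun M g l"
  unfolding distr_fun_def using assms
  by (intro emeasure_mono_AE) (auto elim!: eventually_mono)

lemma distr_fun_antimono:
  assumes [measurable]: "f \<in> borel_measurable M" and "k \<le> l"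
  shows "distr_fun M f l \<le> distr_fun M f k"
  unfolding distr_fun_def using ennreal_leI[OF \<open>k \<le> l\<close>] by (intro emeasure_mono) auto

lemma distr_fun_le_total: "distr_fun M f l \<le> total_mass M"
  unfolding distr_fun_def by (rule emeasure_space)

lemma borel_measurable_distr_fun [measurable]:
  assumes "sigma_finite_measure M" and [measurable]: "f \<in> borel_measurable M"
  shows "distr_fun M f \<in> borel_measurable borel"
proof -
  interpret sigma_finite_measure M by fact
  have "distr_fun M f = (\<lambda>l. \<integral>\<^sup>+x. indicator {x \<in> space M. ennreal l < f x} x \<partial>M)"
    by (auto simp: distr_fun_def fun_eq_iff)
  also have "\<dots> \<in> borel_measurable borel"
    by measurable
  finally show ?thesis .
qed

lemma distr_fun_right_continuous:
  assumes [measurable]: "f \<in> borel_measurable M" and c: "c < distr_fun M f l" and "0 \<le> l"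
  obtains k where "l < k" "c < distr_fun M f k"
proof -
  define k where "k n = l + 1 / real (Suc n)" for n
  have k: "l < k n" for n by (simp add: k_def)
  have klim: "k \<longlonglongrightarrow> l"
    unfolding k_def using tendsto_add[OF tendsto_const LIMSEQ_inverse_real_of_nat, of l]
    by (simp add: inverse_eq_divide)
  have dec: "k m \<le> k n" if "n \<le> m" for n m using that by (auto simp: k_def frac_le)
  have "{x \<in> space M. ennreal l < f x} = (\<Union>n. {x \<in> space M. ennreal (k n) < f x})"
  proof safe
    fix x assume x: "x \<in> space M" "ennreal l < f x"
    have "(\<lambda>n. ennreal (k n)) \<longlonglongrightarrow> ennreal l" by (intro tendsto_ennrealI klim)
    then have "eventually (\<lambda>n. ennreal (k n) < f x) sequentially"
      using x(2) by (rule order_tendstoD)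
    then obtain n where "ennreal (k n) < f x" by (auto simp: eventually_sequentially)
    then show "x \<in> (\<Union>n. {x \<in> space M. ennreal (k n) < f x})" using x by auto
  next
    fix x n assume "ennreal (k n) < f x"
    then show "ennreal l < f x"
      using k[of n] by (meson ennreal_leI less_eq_real_def order_le_less_trans)
  qed
  moreover have inc: "incseq (\<lambda>n. {x \<in> space M. ennreal (k n) < f x})"
    by (auto simp: incseq_def intro: order_le_less_trans[OF ennreal_leI[OF dec]])
  ultimately have "distr_fun M f l = (SUP n. distr_fun M f (k n))"
    unfolding distr_fun_def
    by (subst SUP_emeasure_incseq) (auto intro!: inc)
  then obtain n where "c < distr_fun M f (k n)"
    using c by (auto simp: less_SUP_iff)
  with k that show ?thesis by blast
qed

text \<open>The duality between a rearrangement and its distribution function, which rests on right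
  continuity of the latter. It reduces later facts about \<open>rearr\<close> to facts about
  super-level sets.\<close>

lemma rearr_gt_iff:
  assumes f [measurable]: "f \<in> borel_measurable M" and l: "0 \<le> l"
  shows "ennreal l < rearr M f s \<longleftrightarrow> ennreal s < distr_fun M f l"
proof
  assume "ennreal s < distr_fun M f l"
  then obtain k where k: "l < k" "ennreal s < distr_fun M f k"
    using distr_fun_right_continuous[OF f] l by blast
  have "ennreal k \<le> rearr M f s"
    unfolding rearr_def
  proof (rule Inf_greatest, safe)
    fix m assume m: "0 < m" "distr_fun M f m \<le> ennreal s"
    have "k \<le> m"
    proof (rule ccontr)
      assume "\<not> k \<le> m"
      then have "distr_fun M f k \<le> distr_fun M f m" by (intro distr_fun_antimono) auto
      with m k show False by auto
    qed
    then show "ennreal k \<le> ennreal m" by (rule ennreal_leI)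
  qed
  then show "ennreal l < rearr M f s"
    using k l by (metis ennreal_less_iff order_less_le_trans)
next
  assume less: "ennreal l < rearr M f s"
  show "ennreal s < distr_fun M f l"
  proof (rule ccontr)
    assume "\<not> ?thesis"
    then have le: "distr_fun M f l \<le> ennreal s" by simp
    have "rearr M f s \<le> ennreal m" if "l < m" for m
      unfolding rearr_def using that l le distr_fun_antimono[OF f, of l m]
      by (intro Inf_lower) (auto intro: exI[of _ m])
    moreover obtain m where "ennreal l < ennreal m" "ennreal m < rearr M f s"
      using less by (metis dense ennreal_cases order_less_imp_not_less top.not_eq_extremum infinity_ennreal_def)
    ultimately show False
      using l by (metis ennreal_less_iff leD)
  qed
qed

lemma borel_measurable_rearr [measurable]:
  assumes [measurable]: "f \<in> borel_measurable M"
  shows "rearr M f \<in> borel_measurable borel"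
proof (rule borel_measurableI_greater)
  fix c :: ennreal
  show "{x \<in> space borel. c < rearr M f x} \<in> sets borel"
  proof (cases c)
    case (real r)
    then have "{x \<in> space borel. c < rearr M f x} = {x. ennreal x < distr_fun M f r}"
      by (simp add: rearr_gt_iff)
    also have "\<dots> \<in> sets borel" by measurable
    finally show ?thesis .
  qed auto
qed

lemma emeasure_lborel_interval: "emeasure lborel (interval L) = L"
proof (cases L)
  case (real r)
  then have "interval L = {0<..<r}"
    by (auto simp: interval_def ennreal_less_iff)
  with real show ?thesis by simp
next
  case top
  then have eq: "interval L = {0<..}" by (auto simp: interval_def)
  have "emeasure lborel {0<..real n} \<le> emeasure lborel (interval L)" for n
    unfolding eq by (rule emeasure_mono) auto
  then have "ennreal (real n) \<le> emeasure lborel (interval L)" for n by simp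
  then have "\<not> emeasure lborel (interval L) < top"
    using ennreal_Ex_less_of_nat[of "emeasure lborel (interval L)"]
    by (metis ennreal_of_nat_eq_real_of_nat leD)
  with top show ?thesis by (simp add: less_top[symmetric])
qed

lemma interval_borel [measurable]: "interval L \<in> sets borel"
  unfolding interval_def by measurable

lemma interval_mono: "K \<le> L \<Longrightarrow> interval K \<subseteq> interval L"
  by (auto simp: interval_def)

lemma in_interval_iff: "s \<in> interval L \<longleftrightarrow> 0 < s \<and> ennreal s < L"
  by (simp add: interval_def)

text \<open>Fubini on the region under the graph of \<open>rearr M f\<close>, which by
  \<open>rearr_gt_iff\<close> is also the region under the graph of \<open>distr_fun M f\<close>
  with the axes exchanged.\<close>

lemma nn_integral_rearr:
  assumes M: "sigma_finite_measure M" and f [measurable]: "f \<in> borel_measurable M"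
    and w [measurable]: "w \<in> borel_measurable borel"
  shows "(\<integral>\<^sup>+s\<in>{0<..}. rearr M f s * w s \<partial>lborel) =
         (\<integral>\<^sup>+l\<in>{0<..}. (\<integral>\<^sup>+s\<in>interval (distr_fun M f l). w s \<partial>lborel) \<partial>lborel)"
proof -
  have "(\<integral>\<^sup>+s\<in>{0<..}. rearr M f s * w s \<partial>lborel) =
    (\<integral>\<^sup>+s. (\<integral>\<^sup>+l. indicator (interval (rearr M f s)) l * (w s * indicator {0<..} s) \<partial>lborel) \<partial>lborel)"
    by (simp add: nn_integral_multc emeasure_lborel_interval mult.assoc)
  also have "\<dots> = (\<integral>\<^sup>+l. (\<integral>\<^sup>+s. indicator (interval (rearr M f s)) l * (w s * indicator {0<..} s) \<partial>lborel) \<partial>lborel)"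
    unfolding interval_def by (rule lborel_pair.Fubini') measurable
  also have "\<dots> = (\<integral>\<^sup>+l. (\<integral>\<^sup>+s. (w s * indicator (interval (distr_fun M f l)) s) * indicator {0<..} l \<partial>lborel) \<partial>lborel)"
    by (intro nn_integral_cong)
       (auto simp: indicator_def in_interval_iff rearr_gt_iff)
  also have "\<dots> = (\<integral>\<^sup>+l\<in>{0<..}. (\<integral>\<^sup>+s\<in>interval (distr_fun M f l). w s \<partial>lborel) \<partial>lborel)"
    by (subst nn_integral_multc) auto
  finally show ?thesis .
qed

lemma nn_integral_distr_fun:
  assumes M: "sigma_finite_measure M" and f [measurable]: "f \<in> borel_measurable M"
  shows "(\<integral>\<^sup>+x. f x \<partial>M) = (\<integral>\<^sup>+l\<in>{0<..}. distr_fun M f l \<partial>lborel)"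
proof -
  interpret sigma_finite_measure M by fact
  interpret P: pair_sigma_finite M lborel ..
  have "(\<integral>\<^sup>+x. f x \<partial>M) = (\<integral>\<^sup>+x. (\<integral>\<^sup>+l. indicator (interval (f x)) l \<partial>lborel) \<partial>M)"
    by (simp add: emeasure_lborel_interval)
  also have "\<dots> = (\<integral>\<^sup>+l. (\<integral>\<^sup>+x. indicator (interval (f x)) l \<partial>M) \<partial>lborel)"
    unfolding interval_def by (rule P.Fubini'[symmetric]) measurable
  also have "\<dots> = (\<integral>\<^sup>+l. (\<integral>\<^sup>+x. indicator {x\<in>space M. ennreal l < f x} x * indicator {0<..} l \<partial>M) \<partial>lborel)"
    by (intro nn_integral_cong) (auto simp: indicator_def in_interval_iff)
  also have "\<dots> = (\<integral>\<^sup>+l\<in>{0<..}. distr_fun M f l \<partial>lborel)"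
    by (subst nn_integral_multc) (auto simp: distr_fun_def)
  finally show ?thesis .
qed

text \<open>
  The integral of the rearrangement over \<open>(0,t)\<close>, written through the distribution function, for
  which monotone convergence is immediate.
\<close>

definition rearr_int :: "'a measure \<Rightarrow> ('a \<Rightarrow> ennreal) \<Rightarrow> real \<Rightarrow> ennreal" where
  "rearr_int M f t = (\<integral>\<^sup>+l\<in>{0<..}. min (ennreal t) (distr_fun M f l) \<partial>lborel)"

lemma nn_integral_rearr_eq_rearr_int:
  assumes M: "sigma_finite_measure M" and f [measurable]: "f \<in> borel_measurable M"
  shows "(\<integral>\<^sup>+s\<in>{0<..<t}. rearr M f s \<partial>lborel) = rearr_int M f t"
proof -
  have "(\<integral>\<^sup>+s\<in>{0<..<t}. rearr M f s \<partial>lborel) = (\<integral>\<^sup>+s\<in>{0<..}. rearr M f s * indicator {0<..<t} s \<partial>lborel)"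
    by (intro nn_integral_cong) (auto simp: indicator_def)
  also have "\<dots> = (\<integral>\<^sup>+l\<in>{0<..}. (\<integral>\<^sup>+s\<in>interval (distr_fun M f l). indicator {0<..<t} s \<partial>lborel) \<partial>lborel)"
    by (rule nn_integral_rearr) (use assms in auto)
  also have "\<dots> = (\<integral>\<^sup>+l\<in>{0<..}. (\<integral>\<^sup>+s. indicator (interval (min (ennreal t) (distr_fun M f l))) s \<partial>lborel) \<partial>lborel)"
    by (intro nn_integral_cong arg_cong2[where f="(*)"] refl) 
       (auto simp: indicator_def in_interval_iff ennreal_less_iff)
  also have "\<dots> = rearr_int M f t"
    by (simp add: emeasure_lborel_interval rearr_int_def)
  finally show ?thesis .
qed

lemma rearr_avg_eq:
  assumes "sigma_finite_measure M" "f \<in> borel_measurable M"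
  shows "rearr_avg M f t = rearr_int M f t / ennreal t"
  using assms by (simp add: rearr_avg_def nn_integral_rearr_eq_rearr_int)

lemma nn_integral_truncate_eq:
  assumes M: "sigma_finite_measure M" and f [measurable]: "f \<in> borel_measurable M" and a: "0 \<le> a"
  shows "(\<integral>\<^sup>+x. f x - ennreal a \<partial>M) = (\<integral>\<^sup>+l\<in>{a<..}. distr_fun M f l \<partial>lborel)"
proof -
  have [measurable]: "distr_fun M f \<in> borel_measurable borel" using M f by simp
  have "(\<integral>\<^sup>+x. f x - ennreal a \<partial>M) = (\<integral>\<^sup>+l\<in>{0<..}. distr_fun M (\<lambda>x. f x - ennreal a) l \<partial>lborel)"
    by (rule nn_integral_distr_fun[OF M]) measurable
  also have "\<dots> = (\<integral>\<^sup>+l. distr_fun M f (a + 1 * l) * indicator {a<..} (a + 1 * l) \<partial>lborel)"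
  proof (intro nn_integral_cong)
    fix l :: real
    have "ennreal l < f x - ennreal a \<longleftrightarrow> ennreal (a + l) < f x" if "l > 0" for x
      using that a by (cases "f x") (auto simp: ennreal_minus ennreal_less_iff simp flip: ennreal_plus)
    then show "distr_fun M (\<lambda>x. f x - ennreal a) l * indicator {0<..} l
         = distr_fun M f (a + 1 * l) * indicator {a<..} (a + 1 * l)"
      by (auto simp: distr_fun_def indicator_def)
  qed
  also have "\<dots> = (\<integral>\<^sup>+l\<in>{a<..}. distr_fun M f l \<partial>lborel)"
    by (subst nn_integral_real_affine[of _ 1 a]) (auto simp flip: one_ennreal_def)
  finally show ?thesis .
qed

text \<open>
  \<open>rearr_int\<close> is the minimum over \<open>a\<close> of the right-hand side below (the \<open>K\<close>-functional of
  \<open>L\<^sup>1\<close> and \<open>L\<^sup>\<infinity>\<close>), which is why it is subadditive.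
\<close>

lemma rearr_int_le:
  assumes M: "sigma_finite_measure M" and f [measurable]: "f \<in> borel_measurable M" and a: "0 \<le> a"
  shows "rearr_int M f t \<le> ennreal t * ennreal a + (\<integral>\<^sup>+x. f x - ennreal a \<partial>M)"
proof -
  have [measurable]: "distr_fun M f \<in> borel_measurable borel" using M f by simp
  have "rearr_int M f t \<le> (\<integral>\<^sup>+l. ennreal t * indicator {0<..a} l + distr_fun M f l * indicator {a<..} l \<partial>lborel)"
    unfolding rearr_int_def using a by (intro nn_integral_mono) (auto simp: indicator_def min_def)
  also have "\<dots> = ennreal t * ennreal a + (\<integral>\<^sup>+x. f x - ennreal a \<partial>M)"
    using a by (subst nn_integral_add) (auto simp: nn_integral_cmult nn_integral_truncate_eq[OF M f])
  finally show ?thesis .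
qed

text \<open>The optimal height is the value of the rearrangement at \<open>t\<close>: below it the
  distribution function exceeds \<open>t\<close>, above it the distribution function is at most
  \<open>t\<close>. If this value is infinite, so is the integral.\<close>

lemma rearr_int_attained:
  assumes M: "sigma_finite_measure M" and f [measurable]: "f \<in> borel_measurable M"
    and t: "0 < t" and fin: "rearr_int M f t < \<infinity>"
  obtains a where "0 \<le> a" "rearr_int M f t = ennreal t * ennreal a + (\<integral>\<^sup>+x. f x - ennreal a \<partial>M)"
proof (cases "rearr M f t")
  case top
  then have "ennreal t < distr_fun M f l" if "0 < l" for l
    using that rearr_gt_iff[OF f, of l t] by auto
  then have "min (ennreal t) (distr_fun M f l) * indicator {0<..} l = ennreal t * indicator (interval \<infinity>) l" for l
    by (auto simp: indicator_def min_def in_interval_iff dest: less_le_not_le[THEN iffD1])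
  then have "rearr_int M f t = (\<integral>\<^sup>+l. ennreal t * indicator (interval \<infinity>) l \<partial>lborel)"
    by (simp add: rearr_int_def)
  also have "\<dots> = \<infinity>"
    using t by (subst nn_integral_cmult_indicator) (auto simp: emeasure_lborel_interval ennreal_mult_top)
  finally show ?thesis using fin by simp
next
  case (real a)
  have [measurable]: "distr_fun M f \<in> borel_measurable borel" using M f by simp
  have less: "min (ennreal t) (distr_fun M f l) = ennreal t" if "0 < l" "l < a" for l
    using that rearr_gt_iff[OF f, of l t] real
    by (intro min_absorb1) (auto simp: ennreal_less_iff)
  have ge: "min (ennreal t) (distr_fun M f l) = distr_fun M f l" if "a < l" for l
    using that rearr_gt_iff[OF f, of l t] real
    by (intro min_absorb2) (auto simp: ennreal_less_iff)
  have "rearr_int M f t = (\<integral>\<^sup>+l. ennreal t * indicator {0<..a} l + distr_fun M f l * indicator {a<..} l \<partial>lborel)"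
    unfolding rearr_int_def 
    by (intro nn_integral_cong_AE eventually_mono[OF AE_lborel_singleton[of a]])
       (use less ge real in \<open>auto simp: indicator_def\<close>)
  also have "\<dots> = ennreal t * ennreal a + (\<integral>\<^sup>+x. f x - ennreal a \<partial>M)"
    using real by (subst nn_integral_add) (auto simp: nn_integral_cmult nn_integral_truncate_eq[OF M f])
  finally show ?thesis using that real by blast
qed

lemma rearr_int_nonpos [simp]: "t \<le> 0 \<Longrightarrow> rearr_int M f t = 0"
  by (simp add: rearr_int_def ennreal_neg)

lemma ennreal_add_le: "ennreal (x + y) \<le> ennreal x + ennreal y"
proof (cases "0 \<le> x \<and> 0 \<le> y")
  case False
  then have "ennreal (x + y) \<le> ennreal x \<or> ennreal (x + y) \<le> ennreal y"
    by (auto intro: ennreal_leI)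
  then show ?thesis
    by (auto elim!: order_trans)
qed simp

text \<open>The sum of the heights optimal for \<open>f\<close> and for \<open>g\<close> is
  admissible for the sum, and truncated subtraction satisfies
  \<open>(u + v) - (a + b) \<le> (u - a) + (v - b)\<close>. The other cases have an infinite
  right-hand side or \<open>t \<le> 0\<close>.\<close>

lemma rearr_int_add_le:
  assumes M: "sigma_finite_measure M"
    and f [measurable]: "f \<in> borel_measurable M" and g [measurable]: "g \<in> borel_measurable M"
  shows "rearr_int M (\<lambda>x. f x + g x) t \<le> rearr_int M f t + rearr_int M g t"
proof (cases "0 < t \<and> rearr_int M f t < \<infinity> \<and> rearr_int M g t < \<infinity>")
  case True
  from True obtain a where a: "0 \<le> a" "rearr_int M f t = ennreal t * ennreal a + (\<integral>\<^sup>+x. f x - ennreal a \<partial>M)"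
    using rearr_int_attained[OF M f] by blast
  from True obtain b where b: "0 \<le> b" "rearr_int M g t = ennreal t * ennreal b + (\<integral>\<^sup>+x. g x - ennreal b \<partial>M)"
    using rearr_int_attained[OF M g] by blast
  have le: "u + v - ennreal (a + b) \<le> (u - ennreal a) + (v - ennreal b)" for u v :: ennreal
  proof (cases u; cases v)
    fix r s assume "0 \<le> r" "u = ennreal r" "0 \<le> s" "v = ennreal s"
    moreover have "ennreal (r + s - (a + b)) = ennreal ((r - a) + (s - b))"
      by (rule arg_cong[where f=ennreal]) simp
    ultimately show ?thesis
      using a(1) b(1) ennreal_add_le[of "r - a" "s - b"]
      by (simp only: ennreal_minus ennreal_plus[symmetric])
  qed (auto simp: ennreal_minus)
  have "rearr_int M (\<lambda>x. f x + g x) t \<le> ennreal t * ennreal (a + b) + (\<integral>\<^sup>+x. f x + g x - ennreal (a + b) \<partial>M)"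
    using a(1) b(1) by (intro rearr_int_le[OF M]) auto
  also have "\<dots> \<le> ennreal t * ennreal (a + b) + (\<integral>\<^sup>+x. (f x - ennreal a) + (g x - ennreal b) \<partial>M)"
    by (intro add_left_mono nn_integral_mono le)
  also have "\<dots> = rearr_int M f t + rearr_int M g t"
    unfolding a(2) b(2) using a(1) b(1)
    by (subst nn_integral_add) (auto simp: distrib_left ac_simps)
  finally show ?thesis .
next
  case False
  then show ?thesis by (cases "0 < t") (auto simp: less_top[symmetric])
qed

lemma rearr_int_mono:
  assumes "f \<in> borel_measurable M" "g \<in> borel_measurable M" "AE x in M. f x \<le> g x"
  shows "rearr_int M f t \<le> rearr_int M g t"
  unfolding rearr_int_def
  by (intro nn_integral_mono mult_right_mono min.mono order_refl distr_fun_mono[OF assms]) auto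

lemma nn_integral_Ioi_scale:
  assumes [measurable]: "h \<in> borel_measurable borel" and c: "0 < (c::real)"
  shows "(\<integral>\<^sup>+l\<in>{0<..}. h l \<partial>lborel) = ennreal c * (\<integral>\<^sup>+l\<in>{0<..}. h (c * l) \<partial>lborel)"
proof -
  have "(\<integral>\<^sup>+l\<in>{0<..}. h l \<partial>lborel) = ennreal \<bar>c\<bar> * (\<integral>\<^sup>+l. h (0 + c * l) * indicator {0<..} (0 + c * l) \<partial>lborel)"
    using c by (intro nn_integral_real_affine) auto
  moreover have "indicator {0<..} (0 + c * l) = (indicator {0<..} l :: ennreal)" for l
    using c by (simp add: indicator_def zero_less_mult_iff)
  ultimately show ?thesis using c by simp
qed

text \<open>A general \<open>\<phi>\<close> lets one substitution serve both
  \<open>rearr_int\<close>, where \<open>\<phi>\<close> is the minimum with \<open>t\<close>, and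
  the Lorentz functional, where it is the extended fundamental function; \<open>\<phi> 0 = 0\<close>
  settles \<open>c = 0\<close>.\<close>

lemma nn_integral_distr_fun_cmult:
  assumes M: "sigma_finite_measure M" and f [measurable]: "f \<in> borel_measurable M" and c: "0 \<le> c"
    and \<phi>: "(\<lambda>l. \<phi> (distr_fun M (\<lambda>x. ennreal c * f x) l)) \<in> borel_measurable borel" "\<phi> 0 = (0 :: ennreal)"
  shows "(\<integral>\<^sup>+l\<in>{0<..}. \<phi> (distr_fun M (\<lambda>x. ennreal c * f x) l) \<partial>lborel) =
    ennreal c * (\<integral>\<^sup>+l\<in>{0<..}. \<phi> (distr_fun M f l) \<partial>lborel)"
proof (cases "c = 0")
  case True
  then show ?thesis using \<phi>(2) by (simp add: distr_fun_def)
next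
  case False
  with c have c: "0 < c" by simp
  have "distr_fun M (\<lambda>x. ennreal c * f x) (c * l) = distr_fun M f l" if "0 < l" for l
  proof -
    have "ennreal (c * l) < ennreal c * u \<longleftrightarrow> ennreal l < u" for u
      using c that by (cases u) (auto simp: ennreal_mult_top ennreal_less_iff simp flip: ennreal_mult)
    then show ?thesis by (simp add: distr_fun_def)
  qed
  then have "\<phi> (distr_fun M (\<lambda>x. ennreal c * f x) (c * l)) * indicator {0<..} l = \<phi> (distr_fun M f l) * indicator {0<..} l" for l
    by (simp add: indicator_def)
  then show ?thesis
    by (subst nn_integral_Ioi_scale[OF \<phi>(1) c]) simp
qed

lemma rearr_int_cmult:
  assumes M: "sigma_finite_measure M" and f [measurable]: "f \<in> borel_measurable M" and c: "0 \<le> c"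
  shows "rearr_int M (\<lambda>x. ennreal c * f x) t = ennreal c * rearr_int M f t"
proof -
  have [measurable]: "distr_fun M (\<lambda>x. ennreal c * f x) \<in> borel_measurable borel"
    by (rule borel_measurable_distr_fun[OF M]) measurable
  show ?thesis
    unfolding rearr_int_def by (rule nn_integral_distr_fun_cmult[OF M f c]) auto
qed

lemma distr_fun_SUP:
  assumes [measurable]: "\<And>n. F n \<in> borel_measurable M" and inc: "\<And>x. incseq (\<lambda>n. F n x)"
  shows "distr_fun M (\<lambda>x. SUP n. F n x) l = (SUP n. distr_fun M (F n) l)"
proof -
  have "{x \<in> space M. ennreal l < (SUP n. F n x)} = (\<Union>n. {x \<in> space M. ennreal l < F n x})"
    by (auto simp: less_SUP_iff)
  then show ?thesis
    unfolding distr_fun_def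
    by (subst SUP_emeasure_incseq)
       (auto simp: incseq_def intro: order_less_le_trans[OF _ incseqD[OF inc]])
qed

lemma incseq_distr_fun:
  assumes [measurable]: "\<And>n. F n \<in> borel_measurable M" and inc: "\<And>x. incseq (\<lambda>n. F n x)"
  shows "incseq (\<lambda>n. distr_fun M (F n) l)"
  using inc by (auto intro!: incseq_SucI distr_fun_mono AE_I2 simp: incseq_Suc_iff)

lemma rearr_int_SUP:
  assumes M: "sigma_finite_measure M"
    and F [measurable]: "\<And>n. F n \<in> borel_measurable M" and inc: "\<And>x. incseq (\<lambda>n. F n x)"
  shows "rearr_int M (\<lambda>x. SUP n. F n x) t = (SUP n. rearr_int M (F n) t)"
proof -
  have [measurable]: "distr_fun M (F n) \<in> borel_measurable borel" for n using M F by simp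
  have minsup: "min (ennreal t) (SUP n. distr_fun M (F n) l) = (SUP n. min (ennreal t) (distr_fun M (F n) l))" for l
    by (simp add: inf_min[symmetric] inf_SUP)
  have "rearr_int M (\<lambda>x. SUP n. F n x) t =
     (\<integral>\<^sup>+l. (SUP n. min (ennreal t) (distr_fun M (F n) l) * indicator {0<..} l) \<partial>lborel)"
    unfolding rearr_int_def distr_fun_SUP[OF F inc] minsup
    by (simp add: SUP_mult_right_ennreal)
  also have "\<dots> = (SUP n. rearr_int M (F n) t)"
    unfolding rearr_int_def using incseq_distr_fun[OF F inc]
    by (intro nn_integral_monotone_convergence_SUP)
       (auto simp: incseq_Suc_iff le_fun_def intro!: mult_right_mono min.mono)
  finally show ?thesis .
qed

lemma rearr_int_mono_t: "s \<le> t \<Longrightarrow> rearr_int M f s \<le> rearr_int M f t"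
  unfolding rearr_int_def by (intro nn_integral_mono mult_right_mono min.mono ennreal_leI) auto

lemma borel_measurable_rearr_int [measurable]: "rearr_int M f \<in> borel_measurable borel"
proof (rule borel_measurableI_greater)
  fix c :: ennreal
  have "is_interval {t. c < rearr_int M f t}"
    unfolding is_interval_1 by (auto intro: order_less_le_trans rearr_int_mono_t)
  then have "{t. c < rearr_int M f t} \<in> sets borel"
    by (rule real_interval_borel_measurable)
  then show "{x \<in> space borel. c < rearr_int M f x} \<in> sets borel" by simp
qed

section \<open>Powers on [0,\<infinity>] and Minkowski's inequality for averaged powers\<close>

lemma epowr_top [simp]: "epowr top a = top"
  by (simp add: epowr_def)

lemma epowr_ennreal: "0 \<le> x \<Longrightarrow> epowr (ennreal x) a = ennreal (x powr a)"
  by (simp add: epowr_def)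

lemma epowr_0 [simp]: "epowr 0 a = 0"
  by (simp add: epowr_def)

lemma epowr_eq_top_iff [simp]: "epowr x a = top \<longleftrightarrow> x = top"
  by (simp add: epowr_def)

lemma epowr_eq_0_iff [simp]: "epowr x a = 0 \<longleftrightarrow> x = 0"
  by (cases x) (auto simp: epowr_ennreal)

lemma epowr_mono: "0 \<le> a \<Longrightarrow> x \<le> y \<Longrightarrow> epowr x a \<le> epowr y a"
  by (cases x; cases y) (auto simp: epowr_ennreal top_unique intro!: ennreal_leI powr_mono2)

lemma epowr_epowr: "epowr (epowr x a) b = epowr x (a * b)"
  by (cases x) (auto simp: epowr_ennreal powr_powr)

lemma epowr_1 [simp]: "epowr x 1 = x"
  by (cases x) (auto simp: epowr_ennreal)

lemma epowr_inverse_le_iff: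
  assumes "0 < a" shows "epowr x (1 / a) \<le> y \<longleftrightarrow> x \<le> epowr y a"
  using epowr_mono[of a "epowr x (1 / a)" y] epowr_mono[of "1 / a" x "epowr y a"] assms
  by (auto simp: epowr_epowr)

lemma epowr_SUP:
  assumes "0 < a" shows "epowr (SUP i\<in>I. f i) a = (SUP i\<in>I. epowr (f i) a)"
proof (rule antisym)
  have iff: "epowr x a \<le> y \<longleftrightarrow> x \<le> epowr y (1 / a)" for x y
    using epowr_inverse_le_iff[of "1 / a"] assms by simp
  show "epowr (SUP i\<in>I. f i) a \<le> (SUP i\<in>I. epowr (f i) a)"
    unfolding iff by (rule SUP_least, subst iff[symmetric]) (rule SUP_upper)
  show "(SUP i\<in>I. epowr (f i) a) \<le> epowr (SUP i\<in>I. f i) a"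
    using assms by (intro SUP_least epowr_mono SUP_upper) auto
qed

lemma epowr_cmult: "0 \<le> c \<Longrightarrow> epowr (ennreal c * x) a = ennreal (c powr a) * epowr x a"
  by (cases x; cases "c = 0")
     (auto simp: epowr_ennreal powr_mult ennreal_mult_top simp flip: ennreal_mult)

lemma borel_measurable_epowr [measurable]:
  assumes [measurable]: "f \<in> borel_measurable M"
  shows "(\<lambda>x. epowr (f x) a) \<in> borel_measurable M"
  unfolding epowr_def by measurable

text \<open>Convexity of the power at the combination
  \<open>th * (x / th) + (1 - th) * (y / (1 - th))\<close>. The weight stays free because the fixed
  choice 1/2 would lead only to a quasi-norm.\<close>

lemma epowr_add_le:
  assumes p: "1 \<le> p" and th: "0 < th" "th < 1"
  shows "epowr (x + y) p \<le> ennreal (th powr (1 - p)) * epowr x p + ennreal ((1 - th) powr (1 - p)) * epowr y p"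
proof (cases "x = top \<or> y = top")
  case True
  then show ?thesis using th by (auto simp: ennreal_mult_top)
next
  case False
  then obtain u v where uv: "x = ennreal u" "0 \<le> u" "y = ennreal v" "0 \<le> v"
    by (metis ennreal_cases)
  have ge1: "1 \<le> r powr (1 - p)" if "0 < r" "r < 1" for r :: real
    using powr_mono2'[of "1 - p" r 1] that p by simp
  have "(u + v) powr p \<le> th powr (1 - p) * u powr p + (1 - th) powr (1 - p) * v powr p"
  proof (cases "u = 0 \<or> v = 0")
    case True
    then show ?thesis
      using ge1[of th] ge1[of "1 - th"] th mult_right_mono[of 1 _ "u powr p"] mult_right_mono[of 1 _ "v powr p"] by auto
  next
    case False
    have "(u + v) powr p = ((1 - (1 - th)) *\<^sub>R (u / th) + (1 - th) *\<^sub>R (v / (1 - th))) powr p"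
      using th by simp
    also have "\<dots> \<le> (1 - (1 - th)) * (u / th) powr p + (1 - th) * (v / (1 - th)) powr p"
      using th uv False by (intro convex_onD[OF powr_convex[OF p]]) auto
    also have "\<dots> = th powr (1 - p) * u powr p + (1 - th) powr (1 - p) * v powr p"
      using th uv by (simp add: powr_divide powr_diff)
    finally show ?thesis .
  qed
  then have "ennreal ((u + v) powr p) \<le> ennreal (th powr (1 - p) * u powr p + (1 - th) powr (1 - p) * v powr p)"
    by (rule ennreal_leI)
  then show ?thesis
    using uv by (simp add: epowr_ennreal flip: ennreal_mult ennreal_plus)
qed

text \<open>With \<open>s\<close> the sum and \<open>a\<close> one summand, the weight
  \<open>a / s\<close> makes each convexity term proportional to its summand, so that the terms add
  up to \<open>s powr p\<close>.\<close>

lemma powr_optimal_weight: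
  assumes "0 < a" "0 < (s::real)"
  shows "(a / s) powr (1 - p) * a powr p = s powr (p - 1) * a"
  using assms by (simp add: powr_divide powr_diff field_simps)

text \<open>
  Convexity of the \<open>p\<close>-th power with the optimal weight \<open>\<alpha> / (\<alpha> + \<beta>)\<close> reduces Minkowski's
  inequality to the subadditivity of \<open>rearr_int\<close>.
\<close>

lemma rearr_int_Minkowski:
  assumes M: "sigma_finite_measure M" and p: "1 \<le> p"
    and f [measurable]: "f \<in> borel_measurable M" and g [measurable]: "g \<in> borel_measurable M"
  shows "epowr (rearr_int M (\<lambda>x. epowr (f x + g x) p) t) (1 / p) \<le>
    epowr (rearr_int M (\<lambda>x. epowr (f x) p) t) (1 / p) + epowr (rearr_int M (\<lambda>x. epowr (g x) p) t) (1 / p)"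
    (is "?l \<le> epowr ?F _ + epowr ?G _")
proof (cases "epowr ?F (1 / p) = top \<or> epowr ?G (1 / p) = top")
  case True
  then show ?thesis by auto
next
  case False
  then obtain a b where ab: "epowr ?F (1 / p) = ennreal a" "0 \<le> a" "epowr ?G (1 / p) = ennreal b" "0 \<le> b"
    by (metis ennreal_cases)
  have FG: "?F = ennreal (a powr p)" "?G = ennreal (b powr p)"
    using p ab(2,4) epowr_epowr[of ?F "1 / p" p] epowr_epowr[of ?G "1 / p" p]
    unfolding ab by (simp_all add: epowr_ennreal)
  have "?l \<le> ennreal (a + b) + ennreal e" if e: "0 < e" for e
  proof -
    \<comment> \<open>The shift keeps both numbers positive, hence the weight strictly between 0 and
      1, even if \<open>a\<close> or \<open>b\<close> is 0.\<close>
    define \<alpha> \<beta> where "\<alpha> = a + e / 2" and "\<beta> = b + e / 2"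
    define th where "th = \<alpha> / (\<alpha> + \<beta>)"
    have pos: "0 < \<alpha>" "0 < \<beta>" using ab e by (auto simp: \<alpha>_def \<beta>_def)
    then have th: "0 < th" "th < 1" "1 - th = \<beta> / (\<alpha> + \<beta>)" by (auto simp: th_def field_simps)
    have "rearr_int M (\<lambda>x. epowr (f x + g x) p) t \<le>
      rearr_int M (\<lambda>x. ennreal (th powr (1 - p)) * epowr (f x) p + ennreal ((1 - th) powr (1 - p)) * epowr (g x) p) t"
      by (intro rearr_int_mono AE_I2 epowr_add_le p th) measurable
    also have "\<dots> \<le> ennreal (th powr (1 - p)) * ?F + ennreal ((1 - th) powr (1 - p)) * ?G"
      by (rule order_trans[OF rearr_int_add_le[OF M]]) (simp_all add: rearr_int_cmult[OF M])
    also have "\<dots> \<le> ennreal (th powr (1 - p) * \<alpha> powr p + (1 - th) powr (1 - p) * \<beta> powr p)"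
      unfolding FG using ab e p
      by (auto simp: \<alpha>_def \<beta>_def simp flip: ennreal_mult ennreal_plus intro!: ennreal_leI add_mono mult_left_mono powr_mono2)
    also have "th powr (1 - p) * \<alpha> powr p = (\<alpha> + \<beta>) powr (p - 1) * \<alpha>"
      using pos unfolding th_def by (intro powr_optimal_weight) auto
    also have "(1 - th) powr (1 - p) * \<beta> powr p = (\<alpha> + \<beta>) powr (p - 1) * \<beta>"
      using pos unfolding th by (intro powr_optimal_weight) auto
    also have "(\<alpha> + \<beta>) powr (p - 1) * \<alpha> + (\<alpha> + \<beta>) powr (p - 1) * \<beta> = (\<alpha> + \<beta>) powr p"
      using pos powr_mult_base[of "\<alpha> + \<beta>" "p - 1"] by (simp add: algebra_simps)
    finally have "?l \<le> epowr (ennreal ((\<alpha> + \<beta>) powr p)) (1 / p)"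
      using p by (intro epowr_mono) auto
    also have "\<dots> = ennreal (a + b + e)"
      using pos p by (simp add: epowr_ennreal powr_powr del: ennreal_plus) (simp add: \<alpha>_def \<beta>_def del: ennreal_plus)
    finally show ?thesis using ab e by simp
  qed
  then have "?l \<le> ennreal (a + b)"
    by (rule ennreal_le_epsilon)
  then show ?thesis using ab by simp
qed

text \<open>
  The function under \<open>\<rho>bar\<close> in \<open>power_avg_norm\<close> on \<open>t > 0\<close>; the factor \<open>1 / t\<close> is pulled out to make
  it visibly measurable.
\<close>

definition pavg :: "'a measure \<Rightarrow> real \<Rightarrow> ('a \<Rightarrow> ennreal) \<Rightarrow> real \<Rightarrow> ennreal" where
  "pavg M p f t = ennreal ((1 / t) powr (1 / p)) * epowr (rearr_int M (\<lambda>y. epowr (f y) p) t) (1 / p)"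

lemma borel_measurable_pavg [measurable]: "pavg M p f \<in> borel_measurable borel"
  unfolding pavg_def by measurable

lemma epowr_rearr_avg_eq:
  assumes "sigma_finite_measure M" and [measurable]: "f \<in> borel_measurable M" and "0 < t"
  shows "epowr (rearr_avg M (\<lambda>y. epowr (f y) p) t) (1 / p) = pavg M p f t"
proof -
  have "x / ennreal t = ennreal (1 / t) * x" for x
    using \<open>0 < t\<close> by (simp add: divide_ennreal_def inverse_ennreal inverse_eq_divide mult.commute)
  with assms show ?thesis by (simp add: rearr_avg_eq pavg_def epowr_cmult)
qed

lemma pavg_add_le:
  assumes "sigma_finite_measure M" "1 \<le> p" "f \<in> borel_measurable M" "g \<in> borel_measurable M"
  shows "pavg M p (\<lambda>x. f x + g x) t \<le> pavg M p f t + pavg M p g t"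
  unfolding pavg_def distrib_left[symmetric]
  by (intro mult_left_mono rearr_int_Minkowski assms) auto

lemma pavg_mono:
  assumes "1 \<le> p" and [measurable]: "f \<in> borel_measurable M" "g \<in> borel_measurable M" and "AE x in M. f x \<le> g x"
  shows "pavg M p f t \<le> pavg M p g t"
  unfolding pavg_def using assms
  by (intro mult_left_mono epowr_mono rearr_int_mono) (auto elim!: eventually_mono intro: epowr_mono)

lemma pavg_cmult:
  assumes "sigma_finite_measure M" "1 \<le> p" and [measurable]: "f \<in> borel_measurable M" and "0 \<le> c"
  shows "pavg M p (\<lambda>x. ennreal c * f x) t = ennreal c * pavg M p f t"
  unfolding pavg_def using assms
  by (simp add: epowr_cmult rearr_int_cmult powr_powr mult.left_commute)

lemma pavg_SUP:
  assumes M: "sigma_finite_measure M" "1 \<le> p" and F [measurable]: "\<And>n. F n \<in> borel_measurable M"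
    and inc: "\<And>x. incseq (\<lambda>n. F n x)"
  shows "pavg M p (\<lambda>x. SUP n. F n x) t = (SUP n. pavg M p (F n) t)"
proof -
  have "incseq (\<lambda>n. epowr (F n x) p)" for x
    using inc[of x] M(2) by (auto simp: incseq_def intro!: epowr_mono)
  then show ?thesis
    unfolding pavg_def using M(2)
    by (simp add: epowr_SUP rearr_int_SUP[OF M(1)] SUP_mult_left_ennreal)
qed

text \<open>\<open>rearr_int_le\<close> at height \<open>c powr p\<close>, above which nothing of
  the power remains; the companion \<open>pavg_le_Lp_bound\<close> takes height 0. They are the two
  ends of the interpolation.\<close>

lemma pavg_le_ess_bound:
  assumes M: "sigma_finite_measure M" "1 \<le> p" and f [measurable]: "f \<in> borel_measurable M"
    and "0 < t" "0 \<le> c" and "AE x in M. f x \<le> ennreal c"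
  shows "pavg M p f t \<le> ennreal c"
proof -
  have *: "AE x in M. epowr (f x) p - ennreal (c powr p) = 0"
    using assms(6) epowr_mono[of p _ "ennreal c"] assms(2,5)
    by (auto elim!: eventually_mono simp: epowr_ennreal intro!: diff_eq_0_ennreal intro: order_le_less_trans[OF _ ennreal_less_top])
  have "rearr_int M (\<lambda>x. epowr (f x) p) t \<le> ennreal t * ennreal (c powr p) + (\<integral>\<^sup>+x. epowr (f x) p - ennreal (c powr p) \<partial>M)"
    by (rule rearr_int_le[OF M(1)]) auto
  also have "(\<integral>\<^sup>+x. epowr (f x) p - ennreal (c powr p) \<partial>M) = 0"
    using * by (simp add: nn_integral_0_iff_AE)
  finally have "epowr (rearr_int M (\<lambda>x. epowr (f x) p) t) (1 / p) \<le> epowr (ennreal (t * c powr p)) (1 / p)"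
    using assms by (intro epowr_mono) (auto simp: ennreal_mult)
  also have "\<dots> = ennreal (t powr (1 / p) * c)"
    using assms by (simp add: epowr_ennreal powr_mult powr_powr)
  finally have "pavg M p f t \<le> ennreal ((1 / t) powr (1 / p)) * ennreal (t powr (1 / p) * c)"
    unfolding pavg_def by (rule mult_left_mono) simp
  also have "\<dots> = ennreal c"
    using assms by (simp add: powr_divide flip: ennreal_mult)
  finally show ?thesis .
qed

lemma pavg_le_Lp_bound:
  assumes M: "sigma_finite_measure M" "1 \<le> p" and f [measurable]: "f \<in> borel_measurable M"
    and "0 < t" "0 \<le> c" and "(\<integral>\<^sup>+x. epowr (f x) p \<partial>M) \<le> ennreal c"
  shows "pavg M p f t \<le> ennreal ((c / t) powr (1 / p))"
proof -
  have "rearr_int M (\<lambda>x. epowr (f x) p) t \<le> ennreal t * ennreal 0 + (\<integral>\<^sup>+x. epowr (f x) p - ennreal 0 \<partial>M)"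
    by (rule rearr_int_le[OF M(1)]) auto
  also have "\<dots> \<le> ennreal c" using assms by simp
  finally have "epowr (rearr_int M (\<lambda>x. epowr (f x) p) t) (1 / p) \<le> ennreal (c powr (1 / p))"
    using assms epowr_mono[of "1 / p" _ "ennreal c"] by (auto simp: epowr_ennreal)
  then have "pavg M p f t \<le> ennreal ((1 / t) powr (1 / p)) * ennreal (c powr (1 / p))"
    unfolding pavg_def by (rule mult_left_mono) simp
  also have "\<dots> = ennreal ((c / t) powr (1 / p))"
    using assms by (simp add: powr_divide flip: ennreal_mult)
  finally show ?thesis .
qed

lemma rearr_int_eq_0D:
  assumes M: "sigma_finite_measure M" and f [measurable]: "f \<in> borel_measurable M"
    and "0 < t" "rearr_int M f t = 0"
  shows "AE x in M. f x = 0"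
proof -
  have "rearr_int M f t < \<infinity>" using assms by simp
  then obtain a where a: "0 \<le> a" "rearr_int M f t = ennreal t * ennreal a + (\<integral>\<^sup>+x. f x - ennreal a \<partial>M)"
    using rearr_int_attained[OF M f \<open>0 < t\<close>] by blast
  with assms have "a = 0" "(\<integral>\<^sup>+x. f x \<partial>M) = 0" by auto
  then show ?thesis by (simp add: nn_integral_0_iff_AE)
qed

lemma rearr_int_finD:
  assumes M: "sigma_finite_measure M" and f [measurable]: "f \<in> borel_measurable M"
    and "0 < t" "rearr_int M f t < \<infinity>"
  shows "AE x in M. f x < \<infinity>"
proof -
  obtain a where a: "0 \<le> a" "rearr_int M f t = ennreal t * ennreal a + (\<integral>\<^sup>+x. f x - ennreal a \<partial>M)"
    using rearr_int_attained[OF M f] assms by blast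
  with assms have "(\<integral>\<^sup>+x. f x - ennreal a \<partial>M) \<noteq> \<infinity>" by auto
  then have "AE x in M. f x - ennreal a \<noteq> \<infinity>" by (intro nn_integral_PInf_AE) auto
  then show ?thesis by (auto elim!: eventually_mono simp: less_top[symmetric])
qed

section \<open>Rearrangement-invariant norms\<close>

lemma ri_norm_eq_0_iff:
  "ri_norm M \<rho> \<Longrightarrow> f \<in> borel_measurable M \<Longrightarrow> \<rho> f = 0 \<longleftrightarrow> (AE x in M. f x = 0)"
  unfolding ri_norm_def by blast

lemma ri_norm_cmult:
  "ri_norm M \<rho> \<Longrightarrow> f \<in> borel_measurable M \<Longrightarrow> 0 \<le> c \<Longrightarrow> \<rho> (\<lambda>x. ennreal c * f x) = ennreal c * \<rho> f"
  unfolding ri_norm_def by blast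

lemma ri_norm_add:
  "ri_norm M \<rho> \<Longrightarrow> f \<in> borel_measurable M \<Longrightarrow> g \<in> borel_measurable M \<Longrightarrow> \<rho> (\<lambda>x. f x + g x) \<le> \<rho> f + \<rho> g"
  unfolding ri_norm_def by blast

lemma ri_norm_mono:
  "ri_norm M \<rho> \<Longrightarrow> f \<in> borel_measurable M \<Longrightarrow> g \<in> borel_measurable M \<Longrightarrow> AE x in M. f x \<le> g x \<Longrightarrow> \<rho> f \<le> \<rho> g"
  unfolding ri_norm_def by blast

lemma ri_norm_cong:
  assumes "ri_norm M \<rho>" "f \<in> borel_measurable M" "g \<in> borel_measurable M" "AE x in M. f x = g x"
  shows "\<rho> f = \<rho> g"
  using assms by (intro antisym ri_norm_mono[OF assms(1)]) (auto elim: eventually_mono)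

lemma ri_norm_Fatou:
  assumes "ri_norm M \<rho>" "\<And>n. F n \<in> borel_measurable M" and inc: "\<And>x. incseq (\<lambda>n. F n x)"
  shows "\<rho> (\<lambda>x. SUP n. F n x) = (SUP n. \<rho> (F n))"
proof -
  have [measurable]: "\<And>n. F n \<in> borel_measurable M" by fact
  have "AE x in M. incseq (\<lambda>j. F j x) \<and> (\<lambda>j. F j x) \<longlonglongrightarrow> (SUP n. F n x)"
    using inc by (auto intro: LIMSEQ_SUP)
  moreover have "(\<lambda>x. SUP n. F n x) \<in> borel_measurable M" by measurable
  moreover have Q: "\<forall>F f. (\<forall>j::nat. F j \<in> borel_measurable M) \<and> f \<in> borel_measurable M \<and>
        (AE x in M. incseq (\<lambda>j. F j x) \<and> (\<lambda>j. F j x) \<longlonglongrightarrow> f x) \<longrightarrow>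
        incseq (\<lambda>j. \<rho> (F j)) \<and> (\<lambda>j. \<rho> (F j)) \<longlonglongrightarrow> \<rho> f"
    using assms(1) unfolding ri_norm_def by (elim conjE) assumption
  ultimately have "incseq (\<lambda>j. \<rho> (F j))" "(\<lambda>j. \<rho> (F j)) \<longlonglongrightarrow> \<rho> (\<lambda>x. SUP n. F n x)"
    using Q[rule_format, of F "\<lambda>x. SUP n. F n x"] assms(2) by blast+
  then show ?thesis
    using LIMSEQ_SUP LIMSEQ_unique by blast
qed

lemma ri_norm_indicator_finite:
  "ri_norm M \<rho> \<Longrightarrow> E \<in> sets M \<Longrightarrow> emeasure M E < \<infinity> \<Longrightarrow> \<rho> (indicator E) < \<infinity>"
  unfolding ri_norm_def by blast

lemma ri_norm_integral_le:
  assumes "ri_norm M \<rho>" "E \<in> sets M" "emeasure M E < \<infinity>"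
  obtains C :: real where "\<And>f. f \<in> borel_measurable M \<Longrightarrow> (\<integral>\<^sup>+x\<in>E. f x \<partial>M) \<le> ennreal C * \<rho> f"
proof -
  have "\<forall>E\<in>sets M. emeasure M E < \<infinity> \<longrightarrow> \<rho> (indicator E) < \<infinity> \<and>
        (\<exists>C::real. \<forall>f\<in>borel_measurable M. (\<integral>\<^sup>+x\<in>E. f x \<partial>M) \<le> ennreal C * \<rho> f)"
    using assms(1) unfolding ri_norm_def by (elim conjE) assumption
  with assms(2,3) have "\<exists>C::real. \<forall>f\<in>borel_measurable M. (\<integral>\<^sup>+x\<in>E. f x \<partial>M) \<le> ennreal C * \<rho> f"
    by simp
  then show ?thesis using that by fast
qed

lemma ri_norm_equimeasurable:
  "ri_norm M \<rho> \<Longrightarrow> f \<in> borel_measurable M \<Longrightarrow> g \<in> borel_measurable M \<Longrightarrow>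
   (\<And>l. 0 \<le> l \<Longrightarrow> distr_fun M f l = distr_fun M g l) \<Longrightarrow> \<rho> f = \<rho> g"
  unfolding ri_norm_def by blast

lemma ri_norm_indicator_cong:
  assumes \<rho>: "ri_norm M \<rho>" and [measurable]: "A \<in> sets M" "B \<in> sets M" and eq: "emeasure M A = emeasure M B"
  shows "\<rho> (indicator A) = \<rho> (indicator B)"
proof (rule ri_norm_equimeasurable[OF \<rho>])
  have *: "{x \<in> space M. ennreal l < indicator D x} = (if l < 1 then D else {})"
    if "D \<in> sets M" "0 \<le> l" for D l
  proof -
    have "ennreal l < 1 \<longleftrightarrow> l < 1" using that(2) by (simp add: ennreal_less_one_iff)
    then show ?thesis
      using sets.sets_into_space[OF that(1)] by (auto simp: indicator_def split: if_splits)
  qed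
  show "distr_fun M (indicator A) l = distr_fun M (indicator B) l" if "0 \<le> l" for l
    using that by (simp add: distr_fun_def * eq)
qed auto

section \<open>Norms on an interval and the averaged-power functional\<close>

lemma space_leb_interval [simp]: "space (leb_interval L) = interval L"
  by (simp add: space_restrict_space)

lemma borel_measurable_leb_interval [measurable (raw)]:
  "f \<in> borel_measurable borel \<Longrightarrow> f \<in> borel_measurable (leb_interval L)"
  by (intro measurable_restrict_space1 measurable_completion) simp

lemma sets_leb_intervalI:
  "A \<in> sets borel \<Longrightarrow> A \<subseteq> interval L \<Longrightarrow> A \<in> sets (leb_interval L)"
  by (subst sets_restrict_space_iff) auto

lemma emeasure_leb_interval:
  "A \<in> sets borel \<Longrightarrow> A \<subseteq> interval L \<Longrightarrow> emeasure (leb_interval L) A = emeasure lborel A"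
  by (subst emeasure_restrict_space) auto

lemma AE_leb_intervalI:
  "(\<And>t. t \<in> interval L \<Longrightarrow> P t) \<Longrightarrow> AE t in leb_interval L. P t"
  by (rule AE_I2) simp

lemma AE_obtain:
  assumes "AE x in M. P x" "A \<in> sets M" "emeasure M A \<noteq> 0"
  obtains x where "x \<in> A" "P x"
proof (rule ccontr)
  assume "\<not> thesis"
  with that have *: "x \<notin> A" if "P x" for x using \<open>P x\<close> by blast
  have "AE x in M. x \<notin> A"
    using assms(1) by (rule eventually_mono) (rule *)
  then have "A \<in> null_sets M"
    using assms(2) by (subst AE_iff_null_sets)
  then show False using assms(3) by (simp add: null_sets_def)
qed

lemma AE_leb_interval_ex:
  assumes "AE t in leb_interval L. P t" "0 < L"
  obtains t where "t \<in> interval L" "P t"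
proof -
  have "interval L \<in> sets (leb_interval L)" "emeasure (leb_interval L) (interval L) \<noteq> 0"
    using assms(2) by (simp_all add: sets_leb_intervalI emeasure_leb_interval emeasure_lborel_interval)
  from AE_obtain[OF assms(1) this] that show ?thesis by blast
qed

lemma power_avg_norm_eq:
  assumes "sigma_finite_measure N" "ri_norm (leb_interval L) \<rho>" and [measurable]: "f \<in> borel_measurable N"
  shows "power_avg_norm N \<rho> p f = \<rho> (pavg N p f)"
  unfolding power_avg_norm_def
proof (rule ri_norm_cong[OF assms(2)])
  have [measurable]: "rearr_avg N (\<lambda>y. epowr (f y) p) \<in> borel_measurable borel"
    by (subst fun_eq_iff[THEN iffD2, OF allI, OF rearr_avg_eq[OF assms(1)]]) measurable
  show "(\<lambda>t. epowr (rearr_avg N (\<lambda>y. epowr (f y) p) t) (1 / p)) \<in> borel_measurable (leb_interval L)"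
    by measurable
  show "AE t in leb_interval L. epowr (rearr_avg N (\<lambda>y. epowr (f y) p) t) (1 / p) = pavg N p f t"
    using assms by (intro AE_leb_intervalI) (auto simp: epowr_rearr_avg_eq in_interval_iff)
qed measurable

text \<open>\<open>L\<close> is not tied to \<open>N\<close> here. On an empty interval
  \<open>\<rho>\<close> vanishes identically; \<open>0 < L\<close> is what lets
  \<open>\<sigma>_eq_0D\<close> and \<open>\<sigma>_finD\<close> pick a point \<open>t\<close> at
  which the average is 0 or finite.\<close>

locale power_avg =
  fixes N :: "'b measure" and L :: ennreal and \<rho> :: "(real \<Rightarrow> ennreal) \<Rightarrow> ennreal" and p :: real
  assumes sf: "sigma_finite_measure N" and ri: "ri_norm (leb_interval L) \<rho>" and p: "1 < p" and L: "0 < L"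
begin

abbreviation \<sigma> :: "('b \<Rightarrow> ennreal) \<Rightarrow> ennreal" where "\<sigma> \<equiv> power_avg_norm N \<rho> p"

lemmas \<sigma>_eq = power_avg_norm_eq[OF sf ri]

lemma \<sigma>_mono:
  assumes [measurable]: "f \<in> borel_measurable N" "g \<in> borel_measurable N" and "AE x in N. f x \<le> g x"
  shows "\<sigma> f \<le> \<sigma> g"
  using p assms by (auto simp: \<sigma>_eq intro!: ri_norm_mono[OF ri] AE_leb_intervalI pavg_mono)

lemma \<sigma>_cong:
  assumes [measurable]: "f \<in> borel_measurable N" "g \<in> borel_measurable N" and "AE x in N. f x = g x"
  shows "\<sigma> f = \<sigma> g"
  using assms by (intro antisym \<sigma>_mono) (auto elim: eventually_mono)

lemma \<sigma>_cmult:
  assumes [measurable]: "f \<in> borel_measurable N" and "0 \<le> c"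
  shows "\<sigma> (\<lambda>x. ennreal c * f x) = ennreal c * \<sigma> f"
proof -
  have "pavg N p (\<lambda>x. ennreal c * f x) = (\<lambda>t. ennreal c * pavg N p f t)"
    using p assms sf by (auto simp: pavg_cmult)
  then show ?thesis using assms by (simp add: \<sigma>_eq ri_norm_cmult[OF ri])
qed

lemma \<sigma>_add:
  assumes [measurable]: "f \<in> borel_measurable N" "g \<in> borel_measurable N"
  shows "\<sigma> (\<lambda>x. f x + g x) \<le> \<sigma> f + \<sigma> g"
proof -
  have "\<sigma> (\<lambda>x. f x + g x) \<le> \<rho> (\<lambda>t. pavg N p f t + pavg N p g t)"
    using p by (auto simp: \<sigma>_eq intro!: ri_norm_mono[OF ri] AE_leb_intervalI pavg_add_le sf)
  also have "\<dots> \<le> \<sigma> f + \<sigma> g"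
    by (simp add: \<sigma>_eq ri_norm_add[OF ri])
  finally show ?thesis .
qed

lemma \<sigma>_0 [simp]: "\<sigma> (\<lambda>x. 0) = 0"
  using \<sigma>_cmult[of "\<lambda>x. 0" 0] by simp

lemma \<sigma>_sum:
  assumes "\<And>i. i \<in> I \<Longrightarrow> f i \<in> borel_measurable N"
  shows "\<sigma> (\<lambda>x. \<Sum>i\<in>I. f i x) \<le> (\<Sum>i\<in>I. \<sigma> (f i))"
  using assms
proof (induction I rule: infinite_finite_induct)
  case (insert j I)
  then have "\<sigma> (\<lambda>x. f j x + (\<Sum>i\<in>I. f i x)) \<le> \<sigma> (f j) + \<sigma> (\<lambda>x. \<Sum>i\<in>I. f i x)"
    by (intro \<sigma>_add) auto
  with insert show ?case by (force intro: order_trans add_left_mono)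
qed auto

text \<open>\<open>pavg\<close> commutes with increasing suprema, so the Fatou property of
  \<open>\<rho>\<close> carries finite subadditivity over to series; completeness rests on
  this.\<close>

lemma \<sigma>_suminf:
  assumes [measurable]: "\<And>i. f i \<in> borel_measurable N"
  shows "\<sigma> (\<lambda>x. \<Sum>i. f i x) \<le> (\<Sum>i. \<sigma> (f i))"
proof -
  have inc: "incseq (\<lambda>n. \<Sum>i<n. f i x)" for x
    by (auto intro!: incseq_SucI)
  have "pavg N p (\<lambda>x. \<Sum>i. f i x) = (\<lambda>t. SUP n. pavg N p (\<lambda>x. \<Sum>i<n. f i x) t)"
    using p by (auto simp: suminf_eq_SUP intro!: pavg_SUP sf inc)
  moreover have "incseq (\<lambda>n. pavg N p (\<lambda>x. \<Sum>i<n. f i x) t)" for t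
    using p by (intro incseq_SucI pavg_mono) auto
  ultimately have "\<sigma> (\<lambda>x. \<Sum>i. f i x) = (SUP n. \<sigma> (\<lambda>x. \<Sum>i<n. f i x))"
    by (simp add: \<sigma>_eq ri_norm_Fatou[OF ri])
  also have "\<dots> \<le> (SUP n. \<Sum>i<n. \<sigma> (f i))"
    by (intro SUP_mono' \<sigma>_sum) auto
  finally show ?thesis by (simp add: suminf_eq_SUP)
qed

lemma \<sigma>_eq_0D:
  assumes [measurable]: "f \<in> borel_measurable N" and "\<sigma> f = 0"
  shows "AE x in N. f x = 0"
proof -
  have "AE t in leb_interval L. pavg N p f t = 0"
    using assms by (simp add: \<sigma>_eq ri_norm_eq_0_iff[OF ri])
  then obtain t where "t \<in> interval L" "pavg N p f t = 0" using AE_leb_interval_ex L by blast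
  then have "0 < t" "rearr_int N (\<lambda>y. epowr (f y) p) t = 0"
    using p by (auto simp: in_interval_iff pavg_def)
  then have "AE x in N. epowr (f x) p = 0" by (intro rearr_int_eq_0D[OF sf]) auto
  then show ?thesis by simp
qed

text \<open>\<open>L\<close> may be infinite, so the local integrability axiom is applied on a
  subinterval (0,u) of finite length. It yields some \<open>t\<close> with a finite average, and a
  single finite average already forces finiteness almost everywhere.\<close>

lemma \<sigma>_finD:
  assumes [measurable]: "f \<in> borel_measurable N" and "\<sigma> f < \<infinity>"
  shows "AE x in N. f x < \<infinity>"
proof -
  obtain u where u: "0 < u" "ennreal u < L" using L
    using dense[OF L] by (metis ennreal_cases ennreal_less_zero_iff not_top_less)
  then have E: "interval (ennreal u) \<subseteq> interval L" by (intro interval_mono) auto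
  have *: "interval (ennreal u) \<in> sets (leb_interval L)" "emeasure (leb_interval L) (interval (ennreal u)) = ennreal u"
    using E by (auto intro!: sets_leb_intervalI simp: emeasure_leb_interval emeasure_lborel_interval)
  obtain C :: real where C: "\<And>f. f \<in> borel_measurable (leb_interval L) \<Longrightarrow>
     (\<integral>\<^sup>+x\<in>interval (ennreal u). f x \<partial>leb_interval L) \<le> ennreal C * \<rho> f"
    using ri_norm_integral_le[OF ri *(1)] *(2) by auto
  have "(\<integral>\<^sup>+t\<in>interval (ennreal u). pavg N p f t \<partial>leb_interval L) \<le> ennreal C * \<rho> (pavg N p f)"
    by (rule C) measurable
  also have "\<dots> < \<infinity>"
    using assms by (simp add: \<sigma>_eq ennreal_mult_less_top)
  finally have fin: "(\<integral>\<^sup>+t\<in>interval (ennreal u). pavg N p f t \<partial>leb_interval L) \<noteq> \<infinity>" by simp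
  have "AE t in leb_interval L. pavg N p f t * indicator (interval (ennreal u)) t \<noteq> \<infinity>" (is ?ae)
    by (rule nn_integral_PInf_AE[OF _ fin]) measurable
  moreover have "emeasure (leb_interval L) (interval (ennreal u)) \<noteq> 0"
    using *(2) u by simp
  ultimately obtain t where "t \<in> interval (ennreal u)" "pavg N p f t * indicator (interval (ennreal u)) t \<noteq> \<infinity>"
    using AE_obtain[OF _ *(1)] by blast
  then have "0 < t" "rearr_int N (\<lambda>y. epowr (f y) p) t < \<infinity>"
    using p by (auto simp: indicator_def in_interval_iff pavg_def ennreal_mult_eq_top_iff less_top split: if_splits)
  then have "AE x in N. epowr (f x) p < \<infinity>" by (intro rearr_int_finD[OF sf]) auto
  then show ?thesis by (simp add: less_top[symmetric])
qed

end

lemma ri_norm_sum: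
  assumes "ri_norm M \<rho>" "\<And>i. i \<in> I \<Longrightarrow> f i \<in> borel_measurable M"
  shows "\<rho> (\<lambda>x. \<Sum>i\<in>I. f i x) \<le> (\<Sum>i\<in>I. \<rho> (f i))"
  using assms(2)
proof (induction I rule: infinite_finite_induct)
  case (insert j I)
  then have "\<rho> (\<lambda>x. f j x + (\<Sum>i\<in>I. f i x)) \<le> \<rho> (f j) + \<rho> (\<lambda>x. \<Sum>i\<in>I. f i x)"
    by (intro ri_norm_add[OF assms(1)]) auto
  with insert show ?case by (force intro: order_trans add_left_mono)
qed (use ri_norm_eq_0_iff[OF assms(1), of "\<lambda>x. 0"] in auto)

section \<open>Growth and local Lipschitz bounds of the fundamental function\<close>

locale fundamental_function =
  fixes L :: ennreal and \<rho> :: "(real \<Rightarrow> ennreal) \<Rightarrow> ennreal"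
  assumes ri: "ri_norm (leb_interval L) \<rho>"
begin

text \<open>The fundamental function is evaluated at every real \<open>t\<close>; only the part of
  (0,t) inside the space counts, so beyond \<open>L\<close> it is constant.\<close>

lemma fundamental_eq: "fundamental \<rho> t = \<rho> (indicator (interval (min (ennreal t) L)))"
  unfolding fundamental_def
  by (rule ri_norm_cong[OF ri])
     (auto intro!: AE_leb_intervalI simp: indicator_def in_interval_iff ennreal_less_iff)

lemma interval_min_subset: "interval (min (ennreal t) L) \<subseteq> interval L"
  by (rule interval_mono) simp

lemma indicator_le_fundamental:
  assumes A: "A \<in> sets borel" "A \<subseteq> interval L" and le: "emeasure lborel A \<le> ennreal t"
  shows "\<rho> (indicator A) \<le> fundamental \<rho> t"
proof -
  define m where "m = emeasure lborel A"
  have "m \<le> emeasure lborel (interval L)"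
    unfolding m_def using A by (intro emeasure_mono) auto
  then have m: "m \<le> min (ennreal t) L"
    using le by (simp add: m_def emeasure_lborel_interval)
  then have sub: "interval m \<subseteq> interval L" by (intro interval_mono) simp
  have "\<rho> (indicator A) = \<rho> (indicator (interval m))"
    using A sub by (intro ri_norm_indicator_cong[OF ri] sets_leb_intervalI)
      (auto simp: emeasure_leb_interval emeasure_lborel_interval m_def)
  also have "\<dots> \<le> fundamental \<rho> t"
    unfolding fundamental_eq using interval_mono[OF m]
    by (intro ri_norm_mono[OF ri] AE_leb_intervalI) (auto simp: indicator_def)
  finally show ?thesis .
qed

lemma fundamental_less_top: "fundamental \<rho> t < top"
proof -
  have "emeasure (leb_interval L) (interval (min (ennreal t) L)) < \<infinity>"
    using interval_min_subset by (simp add: emeasure_leb_interval emeasure_lborel_interval min_less_iff_disj)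
  then show ?thesis
    unfolding fundamental_eq using interval_min_subset
    by (metis ri_norm_indicator_finite[OF ri] infinity_ennreal_def interval_borel sets_leb_intervalI)
qed

definition F :: "real \<Rightarrow> real" where "F t = enn2real (fundamental \<rho> t)"

lemma ennreal_F: "ennreal (F t) = fundamental \<rho> t"
  using fundamental_less_top by (simp add: F_def)

lemma F_nonneg [simp]: "0 \<le> F t"
  by (simp add: F_def)

lemma F_mono: "s \<le> t \<Longrightarrow> F s \<le> F t"
proof -
  assume "s \<le> t"
  then have "fundamental \<rho> s \<le> fundamental \<rho> t"
    unfolding fundamental_eq[of s] using interval_min_subset
    by (intro indicator_le_fundamental) (auto simp: emeasure_lborel_interval min.coboundedI1 ennreal_leI)
  then show "F s \<le> F t"
    unfolding F_def by (intro enn2real_mono fundamental_less_top)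
qed

lemma F_nonpos: "t \<le> 0 \<Longrightarrow> F t = 0"
proof -
  assume "t \<le> 0"
  then have "fundamental \<rho> t = 0"
    unfolding fundamental_eq by (subst ri_norm_eq_0_iff[OF ri]) (auto simp: ennreal_neg interval_def)
  then show "F t = 0" by (simp add: F_def)
qed

lemma F_pos:
  assumes "0 < t" "0 < L" shows "0 < F t"
proof -
  have "fundamental \<rho> t \<noteq> 0"
  proof
    assume "fundamental \<rho> t = 0"
    then have *: "AE x in leb_interval L. indicator (interval (min (ennreal t) L)) x = (0::ennreal)"
      unfolding fundamental_eq by (subst (asm) ri_norm_eq_0_iff[OF ri]) auto
    have "emeasure (leb_interval L) (interval (min (ennreal t) L)) \<noteq> 0"
      using assms interval_min_subset by (auto simp: emeasure_leb_interval emeasure_lborel_interval min_def)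
    from AE_obtain[OF * sets_leb_intervalI[OF interval_borel interval_min_subset] this]
    show False by auto
  qed
  then show ?thesis using ennreal_F[of t] F_nonneg[of t] by (metis ennreal_0 order_le_less)
qed

lemma F_add: assumes "0 \<le> u" "0 \<le> v" shows "F (u + v) \<le> F u + F v"
proof -
  define A where "A = {u..<u + v} \<inter> interval L"
  have "emeasure lborel A \<le> emeasure lborel {u..<u + v}"
    unfolding A_def by (intro emeasure_mono) auto
  then have A: "\<rho> (indicator A) \<le> fundamental \<rho> v"
    using assms by (intro indicator_le_fundamental) (auto simp: A_def)
  have [measurable]: "A \<in> sets borel" by (simp add: A_def)
  have "fundamental \<rho> (u + v) \<le> \<rho> (\<lambda>x. indicator (interval (min (ennreal u) L)) x + indicator A x)"
    unfolding fundamental_eq using assms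
    by (intro ri_norm_mono[OF ri] AE_leb_intervalI borel_measurable_leb_interval borel_measurable_add borel_measurable_indicator)
       (auto simp: indicator_def in_interval_iff A_def ennreal_less_iff simp del: ennreal_plus)
  also have "\<dots> \<le> fundamental \<rho> u + \<rho> (indicator A)"
    unfolding fundamental_eq by (intro ri_norm_add[OF ri]) auto
  also have "\<dots> \<le> fundamental \<rho> u + fundamental \<rho> v"
    by (intro add_left_mono A)
  finally have "ennreal (F (u + v)) \<le> ennreal (F u + F v)"
    by (simp add: ennreal_F)
  then show ?thesis by (subst (asm) ennreal_le_iff) auto
qed

text \<open>Averaging the indicators of \<open>(0,s+h)\<close> with one of about \<open>s/h\<close> disjoint pieces of length \<open>h\<close> removed.\<close>

lemma F_increment:
  assumes s: "0 < s" and h: "0 < h" "h \<le> s"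
  shows "F (s + h) - F s \<le> 2 * F s / s * h"
proof -
  \<comment> \<open>The pieces \<open>P 0\<close> to \<open>P k\<close>, of length \<open>h\<close>,
    fit into (0,s+h]. Removing one leaves measure at most \<open>s\<close>, and each point survives
    at least \<open>k\<close> of the \<open>k + 1\<close> removals, whence
    \<open>k * F (s + h) \<le> (k + 1) * F s\<close>.\<close>
  define k where "k = nat \<lfloor>s / h\<rfloor>"
  have k1: "1 \<le> s / h" using assms by simp
  have k: "real k \<le> s / h" "s / h < real k + 1" "1 \<le> k"
    unfolding k_def using k1 by (auto simp: le_nat_iff le_floor_iff)
  define I where "I = interval (min (ennreal (s + h)) L)"
  define P where "P j = {real j * h<..real (Suc j) * h}" for j
  have [measurable]: "I \<in> sets borel" "P j \<in> sets borel" for j by (simp_all add: I_def P_def)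
  have P: "P j \<subseteq> {0<..s + h}" if "j \<le> k" for j
  proof -
    have "real (Suc j) * h \<le> (s / h + 1) * h" using that k h by (intro mult_right_mono) auto
    also have "\<dots> = s + h" using h by (simp add: field_simps)
    finally have "real (Suc j) * h \<le> s + h" .
    moreover have "0 \<le> real j * h" using h by simp
    ultimately show ?thesis unfolding P_def greaterThanAtMost_iff subset_iff by (meson le_less_trans order_trans)
  qed
  have meas: "\<rho> (indicator (I - P j)) \<le> fundamental \<rho> s" if j: "j \<le> k" for j
  proof (rule indicator_le_fundamental)
    have "emeasure lborel (I - P j) \<le> emeasure lborel ({0<..s + h} - P j)"
      by (intro emeasure_mono) (auto simp: I_def in_interval_iff ennreal_less_iff simp del: ennreal_plus)
    also have "\<dots> = emeasure lborel {0<..s + h} - emeasure lborel (P j)"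
      using P[OF j] h by (intro emeasure_Diff) (auto simp: P_def)
    also have "\<dots> = ennreal s"
      using s h by (simp add: P_def ennreal_minus algebra_simps del: ennreal_plus)
    finally show "emeasure lborel (I - P j) \<le> ennreal s" .
  qed (use interval_min_subset in \<open>auto simp: I_def\<close>)
  have pt: "of_nat k * indicator I x \<le> (\<Sum>j\<le>k. indicator (I - P j) x :: ennreal)" for x
  proof (cases "x \<in> I")
    case True
    have uniq: "i = j" if "x \<in> P i" "x \<in> P j" for i j
    proof -
      have "real i * h < real (Suc j) * h" "real j * h < real (Suc i) * h"
        using that by (auto simp: P_def)
      then have "i < Suc j" "j < Suc i" using h by (simp_all only: mult_less_cancel_right_pos of_nat_less_iff)
      then show ?thesis by simp
    qed
    have "card ({..k} \<inter> {j. x \<in> P j}) \<le> 1"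
      by (rule card_le_Suc0_iff_eq[THEN iffD2, simplified One_nat_def[symmetric]]) (use uniq in auto)
    moreover have "card {..k} = card ({..k} \<inter> {j. x \<in> P j}) + card ({..k} \<inter> {j. x \<notin> P j})"
    proof -
      have "{..k} = ({..k} \<inter> {j. x \<in> P j}) \<union> ({..k} \<inter> {j. x \<notin> P j})" by auto
      then show ?thesis by (metis (no_types, lifting) card_Un_disjoint disjoint_iff finite_Int finite_atMost IntD2 mem_Collect_eq)
    qed
    ultimately have "k \<le> card ({..k} \<inter> {j. x \<notin> P j})" by simp
    moreover have "(\<Sum>j\<le>k. indicator (I - P j) x :: ennreal) = (\<Sum>j\<le>k. if x \<notin> P j then 1 else 0)"
      using True by (intro sum.cong) (auto simp: indicator_def)
    then have "(\<Sum>j\<le>k. indicator (I - P j) x :: ennreal) = of_nat (card ({..k} \<inter> {j. x \<notin> P j}))"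
      by (subst (asm) sum.If_cases) simp_all
    ultimately show ?thesis using True by (simp add: of_nat_mono)
  qed simp
  have "of_nat k * fundamental \<rho> (s + h) = \<rho> (\<lambda>x. ennreal (real k) * indicator I x)"
    unfolding fundamental_eq I_def
    by (subst ri_norm_cmult[OF ri]) (auto simp: ennreal_of_nat_eq_real_of_nat)
  also have "\<dots> \<le> \<rho> (\<lambda>x. \<Sum>j\<le>k. indicator (I - P j) x)"
    using pt by (intro ri_norm_mono[OF ri] AE_leb_intervalI) (auto simp: ennreal_of_nat_eq_real_of_nat)
  also have "\<dots> \<le> (\<Sum>j\<le>k. \<rho> (indicator (I - P j)))"
    by (intro ri_norm_sum[OF ri]) auto
  also have "\<dots> \<le> (\<Sum>j\<le>k. fundamental \<rho> s)"
    by (intro sum_mono meas) auto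
  finally have "ennreal (real k * F (s + h)) \<le> ennreal (real (Suc k) * F s)"
    by (simp add: ennreal_F[symmetric] ennreal_mult ennreal_of_nat_eq_real_of_nat)
  then have "real k * F (s + h) \<le> real (Suc k) * F s"
    by (subst (asm) ennreal_le_iff) auto
  then have *: "real k * (F (s + h) - F s) \<le> F s" by (simp add: algebra_simps)
  \<comment> \<open>Since \<open>1 \<le> k\<close>, also \<open>s / h < k + 1 \<le> 2 * k\<close>:
    this rounding is the origin of the factor 2.\<close>
  have "s / h \<le> 2 * real k" using k by linarith
  then have "s / h * (F (s + h) - F s) \<le> 2 * real k * (F (s + h) - F s)"
    using F_mono[of s "s + h"] h by (intro mult_right_mono) auto
  also have "\<dots> \<le> 2 * F s" using * by simp
  finally show ?thesis using s h by (simp add: field_simps)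
qed

lemma mono_locally_LipschitzI:
  assumes "(fundamental \<rho> \<longlongrightarrow> 0) (at_right 0)"
  shows "mono_locally_Lipschitz F"
proof
  show "mono F" by (simp add: mono_def F_mono)
  have "((\<lambda>t. ennreal (F t)) \<longlongrightarrow> ennreal 0) (at_right 0)"
    using assms by (simp add: ennreal_F)
  then show "(F \<longlongrightarrow> 0) (at_right 0)"
    by (rule tendsto_ennrealD) auto
  fix a b :: real assume a: "0 < a"
  have "F t - F s \<le> (2 * F b / a) * (t - s)" if st: "a \<le> s" "s \<le> t" "t \<le> b" for s t
  proof (cases "t - s \<le> s")
    case True
    have "F t - F s \<le> 2 * F s / s * (t - s)"
      using F_increment[of s "t - s"] True a st by (cases "s = t") auto
    also have "\<dots> \<le> 2 * F b / a * (t - s)"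
      using st a F_mono[of s b] by (intro mult_right_mono frac_le) auto
    finally show ?thesis .
  next
    \<comment> \<open>A step longer than \<open>s\<close> is longer than \<open>a\<close>, so
      \<open>(t - s) / a\<close> exceeds 1 and the trivial bound \<open>F t - F s \<le> F b\<close>
      suffices.\<close>
    case False
    then have "1 \<le> (t - s) / a" using st a by simp
    then have "1 \<le> 2 * ((t - s) / a)" by linarith
    then have "F b * 1 \<le> F b * (2 * ((t - s) / a))"
      by (rule mult_left_mono) simp
    then have "F b \<le> 2 * F b / a * (t - s)"
      by (simp only: times_divide_eq_right times_divide_eq_left mult_ac mult_1)
    then show ?thesis using F_mono[of t b] st F_nonneg[of s] by linarith
  qed
  then show "\<exists>K. \<forall>s t. a \<le> s \<longrightarrow> s \<le> t \<longrightarrow> t \<le> b \<longrightarrow> F t - F s \<le> K * (t - s)" by blast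
qed (rule F_nonpos)

end

section \<open>The functional of the Lorentz space\<close>

locale Lambda_space = fundamental_function "total_mass M" \<rho> + F: mono_locally_Lipschitz F
  for M :: "'a measure" and \<rho> +
  assumes sf: "sigma_finite_measure M" and fund0: "(fundamental \<rho> \<longlongrightarrow> 0) (at_right 0)"
begin

text \<open>Distribution functions may be infinite, where \<open>F\<close> has no value. The
  integral extends \<open>F\<close> to [0,\<infinity>], with the limit of \<open>F\<close> at
  infinity as its last value.\<close>

definition \<Phi> :: "ennreal \<Rightarrow> ennreal" where
  "\<Phi> u = (\<integral>\<^sup>+s\<in>interval u. ennreal (F.slope s) \<partial>lborel)"

definition \<Lambda> :: "('a \<Rightarrow> ennreal) \<Rightarrow> ennreal" where
  "\<Lambda> f = (\<integral>\<^sup>+l\<in>{0<..}. \<Phi> (distr_fun M f l) \<partial>lborel)"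

abbreviation qnorm :: "('a \<Rightarrow> 'k::real_normed_vector) \<Rightarrow> ennreal" where
  "qnorm f \<equiv> \<Lambda> (modulus f)"

lemma \<Phi>_ennreal: "0 \<le> b \<Longrightarrow> \<Phi> (ennreal b) = ennreal (F b)"
proof -
  assume b: "0 \<le> b"
  then have "interval (ennreal b) = {0<..<b}" by (auto simp: in_interval_iff ennreal_less_iff)
  then show ?thesis using F.nn_integral_slope[OF b] by (simp add: \<Phi>_def)
qed

lemma \<Phi>_0 [simp]: "\<Phi> 0 = 0"
  using \<Phi>_ennreal[of 0] by (simp add: F_nonpos)

lemma \<Phi>_mono: "u \<le> v \<Longrightarrow> \<Phi> u \<le> \<Phi> v"
  unfolding \<Phi>_def by (intro nn_integral_mono) (auto simp: indicator_def in_interval_iff)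

lemma \<Phi>_add: "\<Phi> (u + v) \<le> \<Phi> u + \<Phi> v"
proof (cases "u = top \<or> v = top")
  case False
  then obtain a b where "u = ennreal a" "0 \<le> a" "v = ennreal b" "0 \<le> b" by (metis ennreal_cases)
  then show ?thesis
    using F_add[of a b] by (simp add: \<Phi>_ennreal ennreal_leI flip: ennreal_plus)
qed auto

lemma \<Phi>_less_top: "u < top \<Longrightarrow> \<Phi> u < top"
  by (cases u) (auto simp: \<Phi>_ennreal)

lemma \<Phi>_tendsto_0:
  assumes "(u \<longlongrightarrow> 0) G"
  shows "((\<lambda>n. \<Phi> (u n)) \<longlongrightarrow> 0) G"
proof (rule order_tendstoI)
  fix e :: ennreal assume e: "0 < e"
  have "\<forall>\<^sub>F t in at_right 0. fundamental \<rho> t < e"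
    using fund0 e by (rule order_tendstoD)
  moreover have "\<forall>\<^sub>F t in at_right 0. (0::real) < t" by (rule eventually_at_right_less)
  ultimately have "\<forall>\<^sub>F t in at_right 0. fundamental \<rho> t < e \<and> 0 < t" by (rule eventually_conj)
  then obtain t where t: "fundamental \<rho> t < e" "0 < t"
    using eventually_happens'[OF trivial_limit_at_right_real] by blast
  have "\<forall>\<^sub>F n in G. u n < ennreal t" using assms t(2) by (intro order_tendstoD) auto
  then show "\<forall>\<^sub>F n in G. \<Phi> (u n) < e"
  proof (rule eventually_mono)
    fix n assume "u n < ennreal t"
    then have "\<Phi> (u n) \<le> \<Phi> (ennreal t)" by (intro \<Phi>_mono) simp
    also have "\<dots> < e" using t by (simp add: \<Phi>_ennreal ennreal_F)
    finally show "\<Phi> (u n) < e" .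
  qed
qed simp

lemma borel_measurable_\<Phi> [measurable]:
  assumes [measurable]: "u \<in> borel_measurable borel"
  shows "(\<lambda>l. \<Phi> (u l)) \<in> borel_measurable borel"
  unfolding \<Phi>_def interval_def by measurable

text \<open>The limit \<open>fund0\<close> removes the essential supremum, even an infinite one;
  \<open>slope\<close> replaces \<open>deriv\<close> off a null set; and the rearrangement vanishes
  beyond the total mass, so the integral may run over the whole half-line.\<close>

lemma Lambda_norm_eq:
  assumes [measurable]: "f \<in> borel_measurable M"
  shows "Lambda_norm M \<rho> f = \<Lambda> f"
proof -
  have "Lim (at_right 0) (fundamental \<rho>) = 0"
    using fund0 by (intro tendsto_Lim) auto
  then have "Lambda_norm M \<rho> f =
     (\<integral>\<^sup>+s\<in>interval (total_mass M). rearr M f s * ennreal (deriv F s) \<partial>lborel)"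
    by (simp add: Lambda_norm_def F_def[abs_def])
  also have "\<dots> = (\<integral>\<^sup>+s\<in>{0<..}. rearr M f s * ennreal (F.slope s) \<partial>lborel)"
  proof (rule nn_integral_cong_AE, use F.slope_AE in \<open>rule eventually_mono\<close>)
    fix s assume s: "0 < s \<longrightarrow> deriv F s = F.slope s \<and> 0 \<le> F.slope s"
    have "rearr M f s = 0" if "\<not> ennreal s < total_mass M"
      using rearr_gt_iff[OF assms, of 0 s] distr_fun_le_total[of M f 0] that by (auto dest: order_less_le_trans)
    then show "rearr M f s * ennreal (deriv F s) * indicator (interval (total_mass M)) s =
      rearr M f s * ennreal (F.slope s) * indicator {0<..} s"
      using s by (cases "ennreal s < total_mass M") (auto simp: indicator_def in_interval_iff)
  qed
  also have "\<dots> = \<Lambda> f"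
    unfolding \<Lambda>_def \<Phi>_def by (rule nn_integral_rearr[OF sf]) measurable
  finally show ?thesis .
qed

lemma \<Lambda>_mono:
  assumes "f \<in> borel_measurable M" "g \<in> borel_measurable M" "AE x in M. f x \<le> g x"
  shows "\<Lambda> f \<le> \<Lambda> g"
  unfolding \<Lambda>_def using distr_fun_mono[OF assms]
  by (intro nn_integral_mono mult_right_mono \<Phi>_mono) auto

lemma distr_fun_measurable [measurable]: "f \<in> borel_measurable M \<Longrightarrow> distr_fun M f \<in> borel_measurable borel"
  by (rule borel_measurable_distr_fun[OF sf])

lemma \<Lambda>_cmult:
  assumes [measurable]: "f \<in> borel_measurable M" and c: "0 \<le> c"
  shows "\<Lambda> (\<lambda>x. ennreal c * f x) = ennreal c * \<Lambda> f"
  unfolding \<Lambda>_def using c by (intro nn_integral_distr_fun_cmult[OF sf]) auto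

text \<open>Where the sum exceeds \<open>2 * l\<close>, one of the summands exceeds
  \<open>l\<close>; the factor 2 comes from substituting \<open>2 * l\<close> for the
  height.\<close>

lemma \<Lambda>_add:
  assumes [measurable]: "f \<in> borel_measurable M" "g \<in> borel_measurable M"
  shows "\<Lambda> (\<lambda>x. f x + g x) \<le> 2 * (\<Lambda> f + \<Lambda> g)"
proof -
  have le: "distr_fun M (\<lambda>x. f x + g x) (2 * l) \<le> distr_fun M f l + distr_fun M g l" if "0 < l" for l
  proof -
    have "{x \<in> space M. ennreal (2 * l) < f x + g x} \<subseteq> {x \<in> space M. ennreal l < f x} \<union> {x \<in> space M. ennreal l < g x}"
    proof safe
      fix x assume x: "ennreal (2 * l) < f x + g x" "\<not> ennreal l < g x"
      show "ennreal l < f x"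
      proof (rule ccontr)
        assume "\<not> ennreal l < f x"
        then have "f x + g x \<le> ennreal l + ennreal l" using x(2) by (intro add_mono) auto
        also have "\<dots> = ennreal (2 * l)" using that by (simp flip: ennreal_plus)
        finally show False using x(1) by simp
      qed
    qed
    then show ?thesis
      unfolding distr_fun_def by (intro order_trans[OF emeasure_mono emeasure_subadditive]) auto
  qed
  have "\<Lambda> (\<lambda>x. f x + g x) = ennreal 2 * (\<integral>\<^sup>+l\<in>{0<..}. \<Phi> (distr_fun M (\<lambda>x. f x + g x) (2 * l)) \<partial>lborel)"
    unfolding \<Lambda>_def by (rule nn_integral_Ioi_scale) auto
  also have "\<dots> \<le> ennreal 2 * (\<integral>\<^sup>+l. \<Phi> (distr_fun M f l) * indicator {0<..} l + \<Phi> (distr_fun M g l) * indicator {0<..} l \<partial>lborel)"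
    by (intro mult_left_mono nn_integral_mono) 
       (auto simp: indicator_def intro: order_trans[OF \<Phi>_mono[OF le] \<Phi>_add])
  also have "\<dots> = 2 * (\<Lambda> f + \<Lambda> g)"
    unfolding \<Lambda>_def by (subst nn_integral_add) auto
  finally show ?thesis .
qed

text \<open>Levels below \<open>c\<close> see all of \<open>E\<close>, levels above \<open>c\<close>
  see the level sets of \<open>g\<close> on \<open>E\<close> shifted by \<open>c\<close>. This
  nesting is why equality holds where \<open>\<Lambda>_add\<close> gives only an estimate.\<close>

lemma \<Lambda>_split_layer:
  assumes [measurable]: "g \<in> borel_measurable M" "E \<in> sets M" and c: "0 \<le> c"
  shows "\<Lambda> (\<lambda>x. (ennreal c + g x) * indicator E x) = ennreal c * \<Phi> (emeasure M E) + \<Lambda> (\<lambda>x. g x * indicator E x)"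
proof -
  let ?f = "\<lambda>x. (ennreal c + g x) * indicator E x" and ?g = "\<lambda>x. g x * indicator E x"
  have 1: "distr_fun M ?f l = emeasure M E" if "0 \<le> l" "l < c" for l
  proof -
    have "{x \<in> space M. ennreal l < ?f x} = E"
      using that sets.sets_into_space[of E M] ennreal_less_iff[of l c]
      by (auto simp: indicator_def intro: order_less_le_trans)
    then show ?thesis by (simp add: distr_fun_def)
  qed
  have 2: "distr_fun M ?f (c + l) = distr_fun M ?g l" if "0 < l" for l
  proof -
    have "ennreal (c + l) < ennreal c + u \<longleftrightarrow> ennreal l < u" for u
      using that c by (cases u) (auto simp: ennreal_less_iff simp flip: ennreal_plus)
    moreover have "\<not> ennreal (c + l) < 0" by simp
    ultimately show ?thesis by (auto simp: distr_fun_def indicator_def intro!: arg_cong[where f="emeasure M"])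
  qed
  have "\<Lambda> ?f = (\<integral>\<^sup>+l. \<Phi> (distr_fun M ?f l) * indicator {0<..<c} l + \<Phi> (distr_fun M ?f l) * indicator {c<..} l \<partial>lborel)"
    unfolding \<Lambda>_def using AE_lborel_singleton[of c] c
    by (intro nn_integral_cong_AE) (auto elim!: eventually_mono simp: indicator_def)
  also have "\<dots> = (\<integral>\<^sup>+l. \<Phi> (distr_fun M ?f l) * indicator {0<..<c} l \<partial>lborel) + (\<integral>\<^sup>+l. \<Phi> (distr_fun M ?f l) * indicator {c<..} l \<partial>lborel)"
    by (rule nn_integral_add) auto
  also have "(\<integral>\<^sup>+l. \<Phi> (distr_fun M ?f l) * indicator {0<..<c} l \<partial>lborel) = (\<integral>\<^sup>+l. \<Phi> (emeasure M E) * indicator {0<..<c} l \<partial>lborel)"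
    using 1 by (intro nn_integral_cong) (auto simp: indicator_def)
  also have "\<dots> = ennreal c * \<Phi> (emeasure M E)"
    using c by (subst nn_integral_cmult_indicator) (auto simp: mult.commute)
  also have "(\<integral>\<^sup>+l. \<Phi> (distr_fun M ?f l) * indicator {c<..} l \<partial>lborel) =
      ennreal \<bar>1\<bar> * (\<integral>\<^sup>+l. \<Phi> (distr_fun M ?f (c + 1 * l)) * indicator {c<..} (c + 1 * l) \<partial>lborel)"
    by (rule nn_integral_real_affine) auto
  also have "\<dots> = \<Lambda> ?g"
    unfolding \<Lambda>_def using 2 by (auto simp: indicator_def intro!: nn_integral_cong)
  finally show ?thesis .
qed

lemma \<Lambda>_indicator:
  assumes [measurable]: "E \<in> sets M"
  shows "\<Lambda> (indicator E) = \<Phi> (emeasure M E)"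
  using \<Lambda>_split_layer[of "\<lambda>x. 0" E 1] by (simp add: \<Lambda>_def distr_fun_def)

text \<open>Dominated convergence twice: first for the measure of each super-level set, where
  \<open>fin\<close> provides the integrable majorant, then over the heights, where continuity of
  \<open>\<Phi>\<close> at 0 transfers the first limit.\<close>

lemma \<Lambda>_tendsto_0:
  assumes [measurable]: "\<And>n. d n \<in> borel_measurable M" "g \<in> borel_measurable M"
    and le: "\<And>n x. x \<in> space M \<Longrightarrow> d n x \<le> g x" and lim: "\<And>x. x \<in> space M \<Longrightarrow> (\<lambda>n. d n x) \<longlonglongrightarrow> 0"
    and g: "\<Lambda> g < \<infinity>" and fin: "\<And>l. 0 < l \<Longrightarrow> distr_fun M g l < \<infinity>"
  shows "(\<lambda>n. \<Lambda> (d n)) \<longlonglongrightarrow> 0"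
proof -
  have distr: "(\<lambda>n. distr_fun M (d n) l) \<longlonglongrightarrow> 0" if l: "0 < l" for l
  proof -
    have "(\<lambda>n. \<integral>\<^sup>+x. indicator {x\<in>space M. ennreal l < d n x} x \<partial>M) \<longlonglongrightarrow> (\<integral>\<^sup>+x. 0 \<partial>M)"
    proof (rule nn_integral_dominated_convergence[where w="indicator {x\<in>space M. ennreal l < g x}"])
      show "AE x in M. indicator {x \<in> space M. ennreal l < d n x} x \<le> (indicator {x \<in> space M. ennreal l < g x} x :: ennreal)" for n
        using le by (intro AE_I2) (auto simp: indicator_def intro: order_less_le_trans)
      show "AE x in M. (\<lambda>n. indicator {x \<in> space M. ennreal l < d n x} x :: ennreal) \<longlonglongrightarrow> 0"
      proof (rule AE_I2)
        fix x assume x: "x \<in> space M"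
        have "\<forall>\<^sub>F n in sequentially. d n x < ennreal l"
          using lim[OF x] l by (intro order_tendstoD) auto
        then show "(\<lambda>n. indicator {x \<in> space M. ennreal l < d n x} x :: ennreal) \<longlonglongrightarrow> 0"
          by (intro tendsto_eventually) (auto elim!: eventually_mono simp: indicator_def)
      qed
    qed (use fin[OF l] in \<open>auto simp: distr_fun_def\<close>)
    then show ?thesis by (simp add: distr_fun_def)
  qed
  have "(\<lambda>n. \<integral>\<^sup>+l\<in>{0<..}. \<Phi> (distr_fun M (d n) l) \<partial>lborel) \<longlonglongrightarrow> (\<integral>\<^sup>+l. 0 \<partial>(lborel :: real measure))"
  proof (rule nn_integral_dominated_convergence[where w="\<lambda>l. \<Phi> (distr_fun M g l) * indicator {0<..} l"])
    show "AE l in lborel. \<Phi> (distr_fun M (d n) l) * indicator {0<..} l \<le> \<Phi> (distr_fun M g l) * indicator {0<..} l" for n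
      using le by (intro AE_I2 mult_right_mono \<Phi>_mono distr_fun_mono) auto
    show "AE l in lborel. (\<lambda>n. \<Phi> (distr_fun M (d n) l) * indicator {0<..} l) \<longlonglongrightarrow> 0"
      using \<Phi>_tendsto_0[OF distr] by (intro AE_I2) (auto simp: indicator_def)
  qed (use g in \<open>auto simp: \<Lambda>_def\<close>)
  then show ?thesis by (simp add: \<Lambda>_def)
qed

text \<open>A super-level set of infinite measure makes all lower ones infinite as well; as
  \<open>\<Phi> \<infinity> = \<infinity>\<close> in that case, the integral over (0,l) would
  diverge.\<close>

lemma distr_fun_finite:
  assumes [measurable]: "f \<in> borel_measurable M" and fin: "\<Lambda> f < \<infinity>" and top: "total_mass M = \<infinity> \<Longrightarrow> \<Phi> \<infinity> = \<infinity>" and l: "0 < l"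
  shows "distr_fun M f l < \<infinity>"
proof (rule ccontr)
  assume "\<not> ?thesis"
  then have inf: "distr_fun M f l = \<infinity>" by (simp add: less_top[symmetric])
  then have "total_mass M = \<infinity>" using distr_fun_le_total[of M f l] by (simp add: top_unique)
  then have P: "\<Phi> \<infinity> = \<infinity>" by (rule top)
  have "distr_fun M f k = \<infinity>" if "k \<le> l" for k
    using distr_fun_antimono[OF assms(1) that] inf by (simp add: top_unique)
  then have "(\<integral>\<^sup>+k. \<infinity> * indicator {0<..l} k \<partial>lborel) \<le> \<Lambda> f"
    unfolding \<Lambda>_def using P by (intro nn_integral_mono) (auto simp: indicator_def)
  moreover have "(\<integral>\<^sup>+k. \<infinity> * indicator {0<..l} k \<partial>lborel) = \<infinity>"
    using l by (subst nn_integral_cmult_indicator) (auto simp: ennreal_top_mult)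
  ultimately show False using fin by (simp add: top_unique)
qed

end

section \<open>The bound on characteristic functions\<close>

lemma ennreal_eqI_cuts:
  assumes "\<And>l. 0 \<le> l \<Longrightarrow> ennreal l < x \<longleftrightarrow> ennreal l < y"
  shows "x = y"
proof (rule ccontr)
  have *: False if xy: "x < y" and eq: "\<And>l. 0 \<le> l \<Longrightarrow> ennreal l < x \<longleftrightarrow> ennreal l < y" for x y
  proof -
    obtain l where l: "x = ennreal l" "0 \<le> l" using xy by (cases x) auto
    with xy eq[of l] show False by simp
  qed
  assume "x \<noteq> y"
  then have "x < y \<or> y < x" by auto
  then show False using *[of x y] *[of y x] assms by blast
qed

lemma rearr_indicator:
  assumes [measurable]: "E \<in> sets M" and u: "emeasure M E = ennreal u" and s: "0 \<le> s"
  shows "rearr M (indicator E) s = indicator {..<u} s"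
proof (rule ennreal_eqI_cuts)
  fix l :: real assume l: "0 \<le> l"
  have "ennreal l < rearr M (indicator E) s \<longleftrightarrow> ennreal s < distr_fun M (indicator E) l"
    by (rule rearr_gt_iff) (use l in auto)
  also have "{x \<in> space M. ennreal l < indicator E x} = (if l < 1 then E else {})"
    using sets.sets_into_space[OF assms(1)] l
    by (auto simp: indicator_def ennreal_less_one_iff split: if_splits)
  then have "distr_fun M (indicator E) l = (if l < 1 then ennreal u else 0)"
    by (simp add: distr_fun_def u)
  also have "ennreal s < (if l < 1 then ennreal u else 0) \<longleftrightarrow> ennreal l < indicator {..<u} s"
    using l s by (auto simp: indicator_def ennreal_less_iff ennreal_less_one_iff)
  finally show "ennreal l < rearr M (indicator E) s \<longleftrightarrow> ennreal l < indicator {..<u} s" .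
qed

lemma R_op_indicator:
  assumes u: "0 \<le> u" "ennreal u \<le> L" and t: "0 < t" and p: "1 < p" "p < q"
  shows "R_op L p q (indicator {0<..<u}) t = ennreal ((min (t powr (q / (q - p))) u / t) powr (1 / p))"
proof -
  have sub: "{0<..<u} \<subseteq> interval L"
  proof
    fix x assume "x \<in> {0<..<u}"
    then have "0 < x" "ennreal x < ennreal u" by (auto intro: ennreal_lessI)
    then show "x \<in> interval L" using u(2) by (simp add: in_interval_iff)
  qed
  have *: "rearr (leb_interval L) (indicator {0<..<u}) s = indicator {..<u} s" if "0 \<le> s" for s
    using sub that u by (intro rearr_indicator) (auto intro!: sets_leb_intervalI simp: emeasure_leb_interval)
  define w where "w = t powr (q / (q - p))"
  have "(\<integral>\<^sup>+s\<in>{0<..<w}. epowr (rearr (leb_interval L) (indicator {0<..<u}) s) p \<partial>lborel)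
      = (\<integral>\<^sup>+s. indicator {0<..<min w u} s \<partial>lborel)"
    by (intro nn_integral_cong) (auto simp: indicator_def * epowr_ennreal[of 1, simplified])
  also have "\<dots> = ennreal (min w u)"
    using u by (simp add: w_def)
  finally have "R_op L p q (indicator {0<..<u}) t = epowr (ennreal (min w u) / ennreal t) (1 / p)"
    by (simp only: R_op_def w_def)
  also have "\<dots> = ennreal ((min w u / t) powr (1 / p))"
    using t u by (subst divide_ennreal) (auto simp: w_def epowr_ennreal)
  finally show ?thesis by (simp only: w_def)
qed

text \<open>The rate in \<open>growth\<close> is dictated by the plateau
  \<open>u powr (1 / q)\<close> of \<open>bump u\<close>: if the target has finite measure and
  \<open>u\<close> is large, \<open>bump u\<close> equals this constant on the whole target
  interval, and its norm can be bounded by the fundamental function of X only if the latter grows at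
  least at that rate.\<close>

locale interpolation =
  X: Lambda_space M Xbar + Y: power_avg N "total_mass N" Ybar p + FY: fundamental_function "total_mass N" Ybar
  for M :: "'a measure" and Xbar and N :: "'b measure" and Ybar p +
  fixes q :: real
  assumes pq: "p < q"
    and R: "R_bounded (total_mass M) p q Xbar Ybar"
    and growth: "total_mass M = \<infinity> \<Longrightarrow> total_mass N < \<infinity> \<Longrightarrow>
      \<exists>c>0. \<forall>t\<ge>1. ennreal (c * t powr (1 / q)) \<le> fundamental Xbar t"
begin

text \<open>
  \<open>Rind u\<close> is \<open>R\<^sub>p\<^sub>,\<^sub>q\<close> applied to the indicator of \<open>(0,u)\<close>. It is increasing up to \<open>knee u\<close>, where
  \<open>t\<^sup>r = u\<close>, and coincides with \<open>bump u\<close> from there on, while \<open>bump u\<close> is constant before.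
\<close>

definition knee :: "real \<Rightarrow> real" where "knee u = u powr ((q - p) / q)"

definition bump :: "real \<Rightarrow> real \<Rightarrow> ennreal" where
  "bump u t = ennreal (min (u powr (1 / q)) ((u / t) powr (1 / p)))"

definition Rind :: "real \<Rightarrow> real \<Rightarrow> ennreal" where
  "Rind u t = ennreal ((min (t powr (q / (q - p))) u / t) powr (1 / p))"

lemma borel_measurable_bump [measurable]: "bump u \<in> borel_measurable borel"
  unfolding bump_def by measurable

lemma borel_measurable_Rind [measurable]: "Rind u \<in> borel_measurable borel"
  unfolding Rind_def by measurable

lemma p_pos: "0 < p" and q_pos: "0 < q"
  using Y.p pq by auto

lemma Rind_bound:
  obtains C where "0 \<le> C" "\<And>u. 0 < u \<Longrightarrow> ennreal u \<le> total_mass M \<Longrightarrow> Ybar (Rind u) \<le> ennreal (C * X.F u)"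
proof -
  obtain C where C: "\<And>g. g \<in> borel_measurable (leb_interval (total_mass M)) \<Longrightarrow>
        Xbar g < \<infinity> \<Longrightarrow> Ybar (R_op (total_mass M) p q g) \<le> ennreal C * Xbar g"
    using R unfolding R_bounded_def by blast
  have "Ybar (Rind u) \<le> ennreal (max 0 C * X.F u)" if u: "0 < u" "ennreal u \<le> total_mass M" for u
  proof -
    let ?R = "R_op (total_mass M) p q (indicator {0<..<u})"
    have eq: "?R t = Rind u t" if "0 < t" for t
      using R_op_indicator[of u "total_mass M" t p q] u that Y.p pq by (simp add: Rind_def)
    have Rm: "?R \<in> borel_measurable (leb_interval (total_mass N))"
      using eq by (subst measurable_cong[of _ _ "Rind u"]) (auto simp: in_interval_iff)
    have "Ybar (Rind u) = Ybar ?R"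
      by (intro ri_norm_cong[OF Y.ri] AE_leb_intervalI borel_measurable_leb_interval[of "Rind u"] Rm) (auto simp: in_interval_iff eq)
    also have "\<dots> \<le> ennreal C * Xbar (indicator {0<..<u})"
      using X.fundamental_less_top[of u] by (intro C) (auto simp: fundamental_def)
    also have "\<dots> = ennreal C * ennreal (X.F u)"
      by (simp add: X.ennreal_F fundamental_def)
    also have "\<dots> \<le> ennreal (max 0 C * X.F u)"
      by (simp add: ennreal_mult mult_right_mono ennreal_leI)
    finally show ?thesis .
  qed
  then show ?thesis using that[of "max 0 C"] by simp
qed


text \<open>Below the knee \<open>Rind u\<close> is the power with exponent
  \<open>1 / (q - p)\<close>; this is the factor it gains from \<open>knee u / 2\<close> to
  \<open>knee u\<close>.\<close>

definition ratio :: real where "ratio = 2 powr (1 / (q - p))"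

lemma ratio_ge_1: "1 \<le> ratio"
  using pq by (simp add: ratio_def ge_one_powr_ge_zero)

lemma powr_knee: "0 < u \<Longrightarrow> knee u powr (1 / (q - p)) = u powr (1 / q)"
  using pq q_pos by (simp add: knee_def powr_powr)

lemma knee_pos: "0 < u \<Longrightarrow> 0 < knee u"
  by (simp add: knee_def)

lemma powr_exponent: "0 < t \<Longrightarrow> (t powr (q / (q - p)) / t) powr (1 / p) = t powr (1 / (q - p))"
proof -
  assume t: "0 < t"
  have "q / (q - p) = 1 + p / (q - p)" using pq by (simp add: field_simps)
  then have "t powr (q / (q - p)) / t = t powr (p / (q - p))"
    using t by (simp add: powr_add)
  then show ?thesis using pq Y.p by (simp add: powr_powr)
qed

lemma knee_powr: "0 < u \<Longrightarrow> knee u powr (q / (q - p)) = u"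
  using pq q_pos by (simp add: knee_def powr_powr)

lemma powr_le_iff: assumes "0 < u" "0 < t" shows "t powr (q / (q - p)) \<le> u \<longleftrightarrow> t \<le> knee u"
proof (cases "t \<le> knee u")
  case True
  then have "t powr (q / (q - p)) \<le> knee u powr (q / (q - p))"
    using assms pq q_pos by (intro powr_mono2) auto
  with True assms show ?thesis by (simp add: knee_powr)
next
  case False
  then have "knee u powr (q / (q - p)) < t powr (q / (q - p))"
    using assms pq q_pos knee_pos[of u] by (intro powr_less_mono2) auto
  with False assms show ?thesis by (simp add: knee_powr)
qed

lemma Rind_below: "0 < u \<Longrightarrow> 0 < t \<Longrightarrow> t \<le> knee u \<Longrightarrow> Rind u t = ennreal (t powr (1 / (q - p)))"
  using powr_le_iff[of u t] powr_exponent[of t] by (simp add: Rind_def)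

lemma Rind_above: "0 < u \<Longrightarrow> knee u \<le> t \<Longrightarrow> Rind u t = ennreal ((u / t) powr (1 / p))"
  using powr_le_iff[of u t] knee_pos[of u]
  by (cases "t = knee u") (auto simp: Rind_def min_def knee_powr)

lemma Rind_lower:
  assumes "0 < u" "knee u / 2 \<le> t" "t \<le> knee u"
  shows "ennreal (u powr (1 / q)) \<le> ennreal ratio * Rind u t"
proof -
  have t: "0 < t" using assms knee_pos[of u] by linarith
  have "u powr (1 / q) = ratio * (knee u / 2) powr (1 / (q - p))"
    using assms knee_pos[of u] by (simp add: ratio_def powr_divide powr_knee)
  also have "\<dots> \<le> ratio * t powr (1 / (q - p))"
    using assms knee_pos[of u] pq by (intro mult_left_mono powr_mono2) (auto simp: ratio_def)
  finally have "ennreal (u powr (1 / q)) \<le> ennreal (ratio * t powr (1 / (q - p)))"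
    by (rule ennreal_leI)
  then show ?thesis
    using Rind_below[of u t] assms t ratio_ge_1 by (simp add: ennreal_mult)
qed

text \<open>The increasing part of \<open>Rind u\<close>, translated to the origin, dominates the plateau of \<open>bump u\<close>.\<close>

lemma plateau_bound:
  assumes u: "0 < u" "ennreal (knee u) \<le> total_mass N"
  shows "ennreal (u powr (1 / q)) * fundamental Ybar (knee u / 2) \<le> ennreal ratio * Ybar (Rind u)"
proof -
  let ?h = "knee u / 2"
  have h: "0 < ?h" using knee_pos[OF u(1)] by simp
  have lt: "ennreal x < total_mass N" if "0 < x" "x < knee u" for x
  proof -
    have "ennreal x < ennreal (knee u)" using that by (simp add: ennreal_less_iff)
    with u(2) show ?thesis by simp
  qed
  have sub: "{0<..<?h} \<subseteq> interval (total_mass N)" "{?h<..<knee u} \<subseteq> interval (total_mass N)"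
    using lt h by (auto simp: in_interval_iff)
  have "fundamental Ybar ?h = Ybar (indicator {?h<..<knee u})"
    unfolding fundamental_def using sub h
    by (intro ri_norm_indicator_cong[OF Y.ri] sets_leb_intervalI) (auto simp: emeasure_leb_interval)
  then have "ennreal (u powr (1 / q)) * fundamental Ybar ?h = Ybar (\<lambda>t. ennreal (u powr (1 / q)) * indicator {?h<..<knee u} t)"
    by (subst ri_norm_cmult[OF Y.ri]) auto
  also have "\<dots> \<le> Ybar (\<lambda>t. ennreal ratio * Rind u t)"
    using Rind_lower[OF u(1)]
    by (intro ri_norm_mono[OF Y.ri] AE_leb_intervalI) (auto simp: indicator_def)
  also have "\<dots> = ennreal ratio * Ybar (Rind u)"
    using ratio_ge_1 by (intro ri_norm_cmult[OF Y.ri]) auto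
  finally show ?thesis .
qed

text \<open>Three ranges of \<open>t\<close>: below half the knee the plateau is left to
  \<open>plateau_bound\<close>; from there to the knee \<open>Rind u\<close> has reached the plateau
  height up to \<open>ratio\<close>; beyond it \<open>Rind u\<close> dominates. The bound on
  \<open>knee u\<close> gives the translated piece room inside the interval.\<close>

lemma bump_bound_small:
  assumes u: "0 < u" "ennreal (knee u) \<le> total_mass N"
  shows "Ybar (bump u) \<le> ennreal (2 * ratio) * Ybar (Rind u)"
proof -
  let ?h = "knee u / 2"
  have h: "0 < ?h" using knee_pos[OF u(1)] by simp
  have pt: "bump u t \<le> ennreal (u powr (1 / q)) * indicator {0<..<?h} t + ennreal ratio * Rind u t" if t: "0 < t" for t
  proof -
    consider "t < ?h" | "?h \<le> t" "t \<le> knee u" | "knee u \<le> t" by linarith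
    then show ?thesis
    proof cases
      case 1
      have "bump u t \<le> ennreal (u powr (1 / q))" by (simp add: bump_def ennreal_leI)
      with 1 t show ?thesis by (simp add: add_increasing2)
    next
      case 2
      have "bump u t \<le> ennreal (u powr (1 / q))" by (simp add: bump_def ennreal_leI)
      also have "\<dots> \<le> ennreal ratio * Rind u t" using Rind_lower[OF u(1) 2] .
      finally show ?thesis by (simp add: add_increasing)
    next
      case 3
      have "bump u t \<le> 1 * Rind u t" using Rind_above[OF u(1) 3] by (simp add: bump_def ennreal_leI)
      also have "\<dots> \<le> ennreal ratio * Rind u t"
        using ratio_ge_1 by (intro mult_right_mono) auto
      finally show ?thesis by (simp add: add_increasing)
    qed
  qed
  have "Ybar (bump u) \<le> Ybar (\<lambda>t. ennreal (u powr (1 / q)) * indicator {0<..<?h} t + ennreal ratio * Rind u t)"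
    using pt by (intro ri_norm_mono[OF Y.ri] AE_leb_intervalI) (auto simp: in_interval_iff)
  also have "\<dots> \<le> Ybar (\<lambda>t. ennreal (u powr (1 / q)) * indicator {0<..<?h} t) + Ybar (\<lambda>t. ennreal ratio * Rind u t)"
    by (intro ri_norm_add[OF Y.ri]) auto
  also have "\<dots> = ennreal (u powr (1 / q)) * fundamental Ybar ?h + ennreal ratio * Ybar (Rind u)"
    using ratio_ge_1 by (simp add: ri_norm_cmult[OF Y.ri] fundamental_def)
  also have "\<dots> \<le> ennreal ratio * Ybar (Rind u) + ennreal ratio * Ybar (Rind u)"
    by (intro add_right_mono plateau_bound u)
  also have "\<dots> = ennreal (2 * ratio) * Ybar (Rind u)"
    using ratio_ge_1 by (simp add: ennreal_mult mult_2[symmetric] mult.assoc)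
  finally show ?thesis .
qed

text \<open>In a target of infinite measure every knee fits, so \<open>plateau_bound\<close>
  compares \<open>t powr (1 / q)\<close>, times a fixed positive value of the fundamental function
  of Y, with the fundamental function of X at \<open>t\<close>.\<close>

lemma power_growth:
  assumes inf: "total_mass M = \<infinity>"
  obtains c where "0 < c" "\<And>t. 1 \<le> t \<Longrightarrow> c * t powr (1 / q) \<le> X.F t"
proof (cases "total_mass N < \<infinity>")
  case True
  obtain c where c: "0 < c" "\<And>t. 1 \<le> t \<Longrightarrow> ennreal (c * t powr (1 / q)) \<le> fundamental Xbar t"
    using growth[OF inf True] by blast
  then have "c * t powr (1 / q) \<le> X.F t" if "1 \<le> t" for t
    using c(2)[OF that] by (simp add: X.ennreal_F[symmetric])
  with c(1) that show ?thesis by blast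
next
  case False
  then have infN: "total_mass N = \<infinity>" by (simp add: less_top[symmetric])
  obtain C where C: "0 \<le> C" "\<And>u. 0 < u \<Longrightarrow> ennreal u \<le> total_mass M \<Longrightarrow> Ybar (Rind u) \<le> ennreal (C * X.F u)"
    using Rind_bound by blast
  \<comment> \<open>For \<open>t \<ge> 1\<close> also \<open>knee t \<ge> 1\<close>, so half of it
    is at least 1/2.\<close>
  define a where "a = FY.F (1 / 2)"
  have a: "0 < a" unfolding a_def by (rule FY.F_pos) (auto simp: infN)
  \<comment> \<open>The summand 1 keeps the later divisor positive, since \<open>C\<close> may be
    0.\<close>
  have le: "t powr (1 / q) * a \<le> (ratio * C + 1) * X.F t" if t: "1 \<le> t" for t
  proof -
    have "1 \<le> knee t" unfolding knee_def using t pq q_pos by (simp add: ge_one_powr_ge_zero)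
    then have "a \<le> FY.F (knee t / 2)" unfolding a_def by (intro FY.F_mono) auto
    then have "ennreal (t powr (1 / q)) * ennreal a \<le> ennreal (t powr (1 / q)) * fundamental Ybar (knee t / 2)"
      unfolding FY.ennreal_F[symmetric] by (intro mult_left_mono ennreal_leI) auto
    then have "ennreal (t powr (1 / q) * a) \<le> ennreal (t powr (1 / q)) * fundamental Ybar (knee t / 2)"
      using a by (simp add: ennreal_mult)
    also have "\<dots> \<le> ennreal ratio * Ybar (Rind t)"
      using t by (intro plateau_bound) (auto simp: infN)
    also have "\<dots> \<le> ennreal ratio * ennreal (C * X.F t)"
      using t by (intro mult_left_mono C) (auto simp: inf)
    also have "\<dots> = ennreal (ratio * C * X.F t)"
      using ratio_ge_1 C(1) by (simp add: mult.assoc flip: ennreal_mult)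
    finally have "t powr (1 / q) * a \<le> ratio * C * X.F t"
      using ratio_ge_1 C(1) by (subst (asm) ennreal_le_iff) auto
    then show ?thesis by (simp add: algebra_simps add_increasing)
  qed
  have pos: "0 < ratio * C + 1" using ratio_ge_1 C(1) by (intro add_nonneg_pos) auto
  show ?thesis
  proof (rule that)
    show "0 < a / (ratio * C + 1)" using a pos by simp
    show "a / (ratio * C + 1) * t powr (1 / q) \<le> X.F t" if "1 \<le> t" for t
      using le[OF that] pos by (simp add: field_simps)
  qed
qed

text \<open>This is the premise of \<open>X.distr_fun_finite\<close>, through which functions of
  finite Lorentz functional become approximable by sets of finite measure. The \<open>t\<close> in
  the proof is chosen so that \<open>c * t powr (1 / q) = n + c\<close>.\<close>

lemma \<Phi>_top: "total_mass M = \<infinity> \<Longrightarrow> X.\<Phi> \<infinity> = \<infinity>"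
proof -
  assume "total_mass M = \<infinity>"
  then obtain c where c: "0 < c" "\<And>t. 1 \<le> t \<Longrightarrow> c * t powr (1 / q) \<le> X.F t"
    using power_growth by blast
  have "ennreal (real n) \<le> X.\<Phi> \<infinity>" for n
  proof -
    define t where "t = (real n / c + 1) powr q"
    have n1: "1 \<le> real n / c + 1" using c by simp
    then have t: "1 \<le> t" unfolding t_def using q_pos by (intro ge_one_powr_ge_zero) auto
    have "real n \<le> c * (real n / c + 1)" using c(1) by (simp add: distrib_left)
    also have "real n / c + 1 = t powr (1 / q)" using n1 q_pos by (simp add: t_def powr_powr)
    also have "c * t powr (1 / q) \<le> X.F t" by (rule c(2)[OF t])
    finally have "ennreal (real n) \<le> ennreal (X.F t)" by (rule ennreal_leI)
    also have "\<dots> \<le> X.\<Phi> \<infinity>" using t by (subst X.\<Phi>_ennreal[symmetric]) (auto intro: X.\<Phi>_mono)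
    finally show ?thesis .
  qed
  then have "\<not> X.\<Phi> \<infinity> < top"
    using ennreal_Ex_less_of_nat[of "X.\<Phi> \<infinity>"] by (metis ennreal_of_nat_eq_real_of_nat leD)
  then show ?thesis by (simp add: less_top[symmetric])
qed

text \<open>While the knee lies inside the target, \<open>bump_bound_small\<close> applies. Past it
  \<open>bump u\<close> is constant, and \<open>u powr (1 / q)\<close> has to be bounded by
  \<open>X.F u\<close>: by monotonicity if the domain has finite measure, by
  \<open>power_growth\<close> otherwise.\<close>

lemma bump_bound:
  obtains K where "0 \<le> K" "\<And>u. 0 < u \<Longrightarrow> ennreal u \<le> total_mass M \<Longrightarrow> Ybar (bump u) \<le> ennreal (K * X.F u)"
proof -
  obtain C where C: "0 \<le> C" "\<And>u. 0 < u \<Longrightarrow> ennreal u \<le> total_mass M \<Longrightarrow> Ybar (Rind u) \<le> ennreal (C * X.F u)"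
    using Rind_bound by blast
  have small: "Ybar (bump u) \<le> ennreal (2 * ratio * C * X.F u)"
    if u: "0 < u" "ennreal u \<le> total_mass M" "ennreal (knee u) \<le> total_mass N" for u
  proof -
    have "Ybar (bump u) \<le> ennreal (2 * ratio) * ennreal (C * X.F u)"
      using u by (intro order_trans[OF bump_bound_small] mult_left_mono C) auto
    also have "\<dots> = ennreal (2 * ratio * C * X.F u)"
      using ratio_ge_1 C(1) by (simp add: mult.assoc flip: ennreal_mult)
    finally show ?thesis .
  qed
  have C2: "0 \<le> 2 * ratio * C" using ratio_ge_1 C(1) by simp
  show ?thesis
  proof (cases "total_mass N")
    case top
    then show ?thesis using that[OF C2] small by auto
  next
    case (real n)
    then have n: "0 < n" using Y.L by simp
    \<comment> \<open>The value of \<open>u\<close> whose knee is exactly \<open>n\<close>, the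
      length of the target interval.\<close>
    define w where "w = n powr (q / (q - p))"
    have w: "0 < w" using n by (simp add: w_def)
    have "\<exists>D. 0 \<le> D \<and> (\<forall>u. w \<le> u \<longrightarrow> ennreal u \<le> total_mass M \<longrightarrow> u powr (1 / q) \<le> D * X.F u)"
    proof (cases "0 < total_mass M")
      case False
      then show ?thesis using w by (intro exI[of _ 0]) auto
    next
      case posM: True
      have Fw: "0 < X.F w" by (rule X.F_pos[OF w posM])
      have D: "u powr (1 / q) \<le> b powr (1 / q) / X.F w * X.F u" if "w \<le> u" "u \<le> b" for u b
      proof -
        have "u powr (1 / q) * X.F w \<le> b powr (1 / q) * X.F u"
          using that w q_pos by (intro mult_mono powr_mono2 X.F_mono) auto
        then show ?thesis using Fw by (simp add: field_simps)
      qed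
      show ?thesis
      proof (cases "total_mass M")
        case (real m)
        then show ?thesis using D[of _ m] Fw w
          by (intro exI[of _ "m powr (1 / q) / X.F w"]) auto
      next
        case top
        then obtain c where c: "0 < c" "\<And>t. 1 \<le> t \<Longrightarrow> c * t powr (1 / q) \<le> X.F t"
          using power_growth by auto
        \<comment> \<open>\<open>power_growth\<close> starts at 1; on the range from
          \<open>w\<close> to 1 monotonicity serves instead.\<close>
        let ?D = "max (1 / X.F w) (1 / c)"
        have "u powr (1 / q) \<le> ?D * X.F u" if u: "w \<le> u" for u
        proof (cases "1 \<le> u")
          case True
          then have "u powr (1 / q) \<le> 1 / c * X.F u" using c(2)[of u] c(1) by (simp add: field_simps)
          also have "\<dots> \<le> ?D * X.F u" by (intro mult_right_mono) auto
          finally show ?thesis .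
        next
          case False
          then have "u powr (1 / q) \<le> 1 / X.F w * X.F u" using D[of u 1] u by simp
          also have "\<dots> \<le> ?D * X.F u" by (intro mult_right_mono) auto
          finally show ?thesis .
        qed
        moreover have "0 \<le> ?D" using Fw by (simp add: le_max_iff_disj)
        ultimately show ?thesis by blast
      qed
    qed
    then obtain D where D: "0 \<le> D" "\<And>u. w \<le> u \<Longrightarrow> ennreal u \<le> total_mass M \<Longrightarrow> u powr (1 / q) \<le> D * X.F u"
      by blast
    let ?K = "max (2 * ratio * C) (D * FY.F n)"
    have "Ybar (bump u) \<le> ennreal (?K * X.F u)" if u: "0 < u" "ennreal u \<le> total_mass M" for u
    proof (cases "knee u \<le> n")
      case True
      then have "Ybar (bump u) \<le> ennreal (2 * ratio * C * X.F u)"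
        using u real by (intro small) (auto simp: ennreal_leI)
      also have "\<dots> \<le> ennreal (?K * X.F u)" by (intro ennreal_leI mult_right_mono) auto
      finally show ?thesis .
    next
      case False
      then have "w \<le> u" using powr_le_iff[of u n] u n by (simp add: w_def)
      have "Ybar (bump u) \<le> Ybar (\<lambda>t. ennreal (u powr (1 / q)) * indicator {0<..<n} t)"
        using real by (intro ri_norm_mono[OF Y.ri] AE_leb_intervalI)
          (auto simp: in_interval_iff ennreal_less_iff bump_def ennreal_leI)
      also have "\<dots> = ennreal (u powr (1 / q) * FY.F n)"
        by (simp add: ri_norm_cmult[OF Y.ri] ennreal_mult FY.ennreal_F fundamental_def)
      also have "\<dots> \<le> ennreal ((D * X.F u) * FY.F n)"
        using D(2)[OF \<open>w \<le> u\<close> u(2)] by (intro ennreal_leI mult_right_mono) auto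
      also have "\<dots> = ennreal (D * FY.F n * X.F u)" by (simp add: mult_ac)
      also have "\<dots> \<le> ennreal (?K * X.F u)" by (intro ennreal_leI mult_right_mono) auto
      finally show ?thesis .
    qed
    moreover have "0 \<le> ?K" using C2 by (rule max.coboundedI1)
    ultimately show ?thesis using that by blast
  qed
qed

end

section \<open>Endpoint estimates of the sawyerable operator on characteristic functions\<close>

lemma modulus_indicator: "modulus (indicator E :: 'a \<Rightarrow> 'k::real_normed_field) = indicator E"
  by (auto simp: modulus_def indicator_def fun_eq_iff)

lemma borel_measurable_modulus [measurable]:
  "f \<in> borel_measurable M \<Longrightarrow> modulus f \<in> borel_measurable M"
  unfolding modulus_def by measurable

lemma Lp_norm_indicator:
  assumes "E \<in> sets M" "emeasure M E = ennreal u" "0 \<le> u"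
  shows "Lp_norm M a (indicator E) = ennreal (u powr (1 / a))"
proof -
  have "(\<integral>\<^sup>+x. epowr (indicator E x) a \<partial>M) = (\<integral>\<^sup>+x. indicator E x \<partial>M)"
    using epowr_ennreal[of 1 a] by (intro nn_integral_cong) (auto simp: indicator_def)
  with assms show ?thesis by (simp add: Lp_norm_def epowr_ennreal)
qed

lemma weak_norm_indicator_le:
  assumes "E \<in> sets M" "emeasure M E = ennreal u" "0 \<le> u" "0 < b"
  shows "weak_norm M b (indicator E) \<le> ennreal (u powr (1 / b))"
  unfolding weak_norm_def
proof (rule SUP_least)
  fix t :: real assume t: "t \<in> {0<..}"
  show "ennreal (t powr (1 / b)) * rearr M (indicator E) t \<le> ennreal (u powr (1 / b))"
    using t rearr_indicator[OF assms(1,2), of t] assms(3,4)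
    by (cases "t < u") (auto intro!: ennreal_leI powr_mono2)
qed

lemma indicator_in_fn_spaces:
  fixes E :: "'a set"
  assumes [measurable]: "E \<in> sets M" and "emeasure M E < \<infinity>" "0 < b"
  shows "(indicator E :: 'a \<Rightarrow> 'k::{real_normed_field, euclidean_space}) \<in> fn_space M (Lp_norm M a)"
    "(indicator E :: 'a \<Rightarrow> 'k) \<in> fn_space M (weak_norm M b)"
    "(indicator E :: 'a \<Rightarrow> 'k) \<in> sawyerable_domain M a b"
proof -
  obtain u where u: "emeasure M E = ennreal u" "0 \<le> u" using assms(2) by (cases "emeasure M E") auto
  show Lp: "(indicator E :: 'a \<Rightarrow> 'k) \<in> fn_space M (Lp_norm M a)"
    using Lp_norm_indicator[OF assms(1) u] by (auto simp: fn_space_def modulus_indicator)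
  show weak: "(indicator E :: 'a \<Rightarrow> 'k) \<in> fn_space M (weak_norm M b)"
    using weak_norm_indicator_le[OF assms(1) u \<open>0 < b\<close>]
    by (auto simp: fn_space_def modulus_indicator intro: order_le_less_trans)
  have "Lp_norm M a (modulus (\<lambda>x. 0 :: 'k)) = 0"
    by (simp add: Lp_norm_def modulus_def)
  then have "(\<lambda>x. 0 :: 'k) \<in> fn_space M (Lp_norm M a)" by (auto simp: fn_space_def)
  with weak show "(indicator E :: 'a \<Rightarrow> 'k) \<in> sawyerable_domain M a b"
    unfolding sawyerable_domain_def sum_space_def mem_Collect_eq
    by (intro exI[of _ "\<lambda>x. 0"] exI[of _ "indicator E"]) (simp add: fun_eq_iff)
qed

context interpolation
begin

lemma bump_0: "Ybar (bump 0) = 0"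
  by (subst ri_norm_eq_0_iff[OF Y.ri]) (auto simp: bump_def[abs_def])

text \<open>The majorant \<open>k\<close> of \<open>b\<close> inherits both endpoint bounds of
  \<open>G\<close> with the same constant \<open>c = C * D powr lam\<close>: its p-th power
  integrates to at most \<open>c powr p * u\<close>, and it is essentially bounded by
  \<open>c * u powr (1 / q)\<close>. Together they say that \<open>pavg\<close> of \<open>k\<close>
  is at most \<open>c\<close> times \<open>bump u\<close>.\<close>

lemma sawyerable_bound:
  fixes G :: "('a \<Rightarrow> 'k::{real_normed_field, euclidean_space}) \<Rightarrow> 'b \<Rightarrow> 'k"
  assumes lam: "0 < lam" and G: "sawyerable (lam * p) (lam * q) M N G" and C: "0 < C"
  obtains K where "0 \<le> K"
    "\<And>E b :: 'b \<Rightarrow> 'k. E \<in> sets M \<Longrightarrow> emeasure M E < \<infinity> \<Longrightarrow> b \<in> borel_measurable N \<Longrightarrow>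
       AE y in N. norm (b y) \<le> C * norm (G (indicator E) y) powr lam \<Longrightarrow>
       Y.\<sigma> (modulus b) \<le> ennreal K * X.\<Phi> (emeasure M E)"
proof -
  obtain C1 where C1: "\<And>f. f \<in> fn_space M (Lp_norm M (lam * p)) \<Longrightarrow>
      Lp_norm N (lam * p) (modulus (G f)) \<le> ennreal C1 * Lp_norm M (lam * p) (modulus f)"
    using G unfolding sawyerable_def bounded_op_def by blast
  obtain C2 where C2: "\<And>f. f \<in> fn_space M (weak_norm M (lam * q)) \<Longrightarrow>
      esssup N (modulus (G f)) \<le> ennreal C2 * weak_norm M (lam * q) (modulus f)"
    using G unfolding sawyerable_def bounded_op_def by blast
  define D where "D = max 0 (max C1 C2)"
  have D: "0 \<le> D" "C1 \<le> D" "C2 \<le> D" by (auto simp: D_def)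
  obtain K where K: "0 \<le> K" "\<And>u. 0 < u \<Longrightarrow> ennreal u \<le> total_mass M \<Longrightarrow> Ybar (bump u) \<le> ennreal (K * X.F u)"
    using bump_bound by blast
  define c where "c = C * D powr lam"
  have c: "0 \<le> c" using C by (simp add: c_def)
  have lp: "0 < lam * p" "0 < lam * q" using lam p_pos q_pos by auto
  show ?thesis
  proof (rule that)
    show "0 \<le> c * K" using c K by simp
    fix E and b :: "'b \<Rightarrow> 'k"
    assume E [measurable]: "E \<in> sets M" and fin: "emeasure M E < \<infinity>"
      and b [measurable]: "b \<in> borel_measurable N"
      and le: "AE y in N. norm (b y) \<le> C * norm (G (indicator E) y) powr lam"
    obtain u where u: "emeasure M E = ennreal u" "0 \<le> u" using fin by (cases "emeasure M E") auto
    note dom = indicator_in_fn_spaces[OF E fin lp(2), where 'k='k]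
    have "G (indicator E) \<in> borel_measurable N"
      using G dom(3) unfolding sawyerable_def by blast
    define g where "g = modulus (G (indicator E))"
    have g [measurable]: "g \<in> borel_measurable N"
      unfolding g_def using \<open>G (indicator E) \<in> borel_measurable N\<close> by measurable
    define k where "k y = ennreal C * epowr (g y) lam" for y
    have k [measurable]: "k \<in> borel_measurable N" unfolding k_def by measurable
    have "modulus b y \<le> k y" if "norm (b y) \<le> C * norm (G (indicator E) y) powr lam" for y
      using ennreal_leI[OF that] C by (simp add: modulus_def k_def g_def epowr_ennreal ennreal_mult)
    with le have bk: "AE y in N. modulus b y \<le> k y" by (auto elim: eventually_mono)
    have "Lp_norm N (lam * p) g \<le> ennreal C1 * ennreal (u powr (1 / (lam * p)))"
      using C1[OF dom(1)] Lp_norm_indicator[OF E u] by (simp add: modulus_indicator g_def)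
    also have "\<dots> \<le> ennreal D * ennreal (u powr (1 / (lam * p)))"
      using D by (intro mult_right_mono ennreal_leI) auto
    also have "\<dots> = ennreal (D * u powr (1 / (lam * p)))" using D by (simp add: ennreal_mult)
    finally have "(\<integral>\<^sup>+y. epowr (g y) (lam * p) \<partial>N) \<le> epowr (ennreal (D * u powr (1 / (lam * p)))) (lam * p)"
      unfolding Lp_norm_def using epowr_inverse_le_iff[OF lp(1)] by blast
    also have "\<dots> = ennreal (D powr (lam * p) * u)"
      using D u lp p_pos lam by (simp add: epowr_ennreal powr_mult powr_powr)
    finally have gLp: "(\<integral>\<^sup>+y. epowr (g y) (lam * p) \<partial>N) \<le> ennreal (D powr (lam * p) * u)" .
    have "(\<integral>\<^sup>+y. epowr (k y) p \<partial>N) = ennreal (C powr p) * (\<integral>\<^sup>+y. epowr (g y) (lam * p) \<partial>N)"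
      unfolding k_def using C by (simp add: epowr_cmult epowr_epowr nn_integral_cmult)
    also have "\<dots> \<le> ennreal (C powr p) * ennreal (D powr (lam * p) * u)"
      by (intro mult_left_mono gLp) auto
    also have "\<dots> = ennreal (c powr p * u)"
      using C D u by (simp add: c_def powr_mult powr_powr mult.assoc flip: ennreal_mult)
    finally have kLp: "(\<integral>\<^sup>+y. epowr (k y) p \<partial>N) \<le> ennreal (c powr p * u)" .
    have "esssup N g \<le> ennreal C2 * weak_norm M (lam * q) (indicator E)"
      using C2[OF dom(2)] by (simp add: modulus_indicator g_def)
    also have "\<dots> \<le> ennreal D * ennreal (u powr (1 / (lam * q)))"
      using D by (intro mult_mono ennreal_leI weak_norm_indicator_le E u lp) auto
    also have "\<dots> = ennreal (D * u powr (1 / (lam * q)))" using D by (simp add: ennreal_mult)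
    finally have gsup: "esssup N g \<le> ennreal (D * u powr (1 / (lam * q)))" .
    have ksup: "AE y in N. k y \<le> ennreal (c * u powr (1 / q))"
      using esssup_AE[of g N]
    proof (rule eventually_mono)
      fix y assume "g y \<le> esssup N g"
      with gsup have "epowr (g y) lam \<le> epowr (ennreal (D * u powr (1 / (lam * q)))) lam"
        using lam by (intro epowr_mono) auto
      then have "k y \<le> ennreal C * epowr (ennreal (D * u powr (1 / (lam * q)))) lam"
        unfolding k_def by (rule mult_left_mono) simp
      also have "\<dots> = ennreal (c * u powr (1 / q))"
        using C D lam by (simp add: epowr_ennreal powr_mult powr_powr c_def mult.assoc flip: ennreal_mult)
      finally show "k y \<le> ennreal (c * u powr (1 / q))" .
    qed
    have pt: "pavg N p k t \<le> ennreal c * bump u t" if t: "0 < t" for t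
    proof -
      have "pavg N p k t \<le> ennreal (c * u powr (1 / q))"
        using c Y.p by (intro pavg_le_ess_bound[OF Y.sf _ k t _ ksup]) auto
      moreover have "pavg N p k t \<le> ennreal ((c powr p * u / t) powr (1 / p))"
        using u Y.p by (intro pavg_le_Lp_bound[OF Y.sf _ k t _ kLp]) auto
      moreover have "p * (1 / p) = 1" using p_pos by simp
      then have "(c powr p * u / t) powr (1 / p) = c * (u / t) powr (1 / p)"
        using c u t p_pos by (simp add: powr_mult powr_powr times_divide_eq_right[symmetric] del: times_divide_eq_right)
      ultimately have "pavg N p k t \<le> min (ennreal (c * u powr (1 / q))) (ennreal (c * (u / t) powr (1 / p)))"
        by simp
      also have "\<dots> = ennreal (c * min (u powr (1 / q)) ((u / t) powr (1 / p)))"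
        using c by (simp add: min_ennreal min_mult_distrib_left)
      finally show ?thesis using c by (simp add: bump_def ennreal_mult)
    qed
    have "Y.\<sigma> (modulus b) \<le> Y.\<sigma> k" by (rule Y.\<sigma>_mono[OF _ k bk]) measurable
    also have "\<dots> \<le> Ybar (\<lambda>t. ennreal c * bump u t)"
      unfolding Y.\<sigma>_eq[OF k] using pt
      by (intro ri_norm_mono[OF Y.ri] AE_leb_intervalI) (auto simp: in_interval_iff)
    also have "\<dots> = ennreal c * Ybar (bump u)"
      using c by (intro ri_norm_cmult[OF Y.ri]) auto
    also have "\<dots> \<le> ennreal c * ennreal (K * X.F u)"
    \<comment> \<open>\<open>bump_bound\<close> speaks of positive \<open>u\<close> only; for null
      sets \<open>bump 0\<close> is the zero function.\<close>
    proof (cases "u = 0")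
      case False
      have "ennreal u \<le> total_mass M" using u(1) emeasure_space[of M E] by simp
      with False u show ?thesis by (intro mult_left_mono K) auto
    qed (simp add: bump_0)
    also have "\<dots> = ennreal (c * K) * X.\<Phi> (emeasure M E)"
      using c K u by (simp add: X.\<Phi>_ennreal ennreal_mult mult.assoc)
    finally show "Y.\<sigma> (modulus b) \<le> ennreal (c * K) * X.\<Phi> (emeasure M E)" .
  qed
qed

end

section \<open>Simple functions and the extension\<close>

text \<open>A spanning representation is rewritten over the finitely many distinct nonzero values.
  In this form closure under pointwise operations that fix 0 can be read off, which the span alone
  gives only for linear ones.\<close>

lemma simple_space_iff:
  fixes f :: "'a \<Rightarrow> 'k::{real_normed_field, euclidean_space}"
  shows "f \<in> simple_space M \<longleftrightarrow>
    simple_function M f \<and> (\<forall>x. x \<notin> space M \<longrightarrow> f x = 0) \<and> emeasure M {x \<in> space M. f x \<noteq> 0} < \<infinity>"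
proof safe
  assume "f \<in> simple_space M"
  then obtain n :: nat and c E where f: "f = (\<lambda>x. \<Sum>i<n. c i * indicator (E i) x)"
    and E: "\<And>i. i < n \<Longrightarrow> E i \<in> sets M" "\<And>i. i < n \<Longrightarrow> emeasure M (E i) < \<infinity>"
    unfolding simple_space_def by blast
  show "simple_function M f"
    unfolding f using E(1) by (intro simple_function_sum simple_function_mult) auto
  then have [measurable]: "f \<in> borel_measurable M" by (rule borel_measurable_simple_function)
  show "f x = 0" if "x \<notin> space M" for x
    unfolding f using that sets.sets_into_space[OF E(1)] by (intro sum.neutral) (auto simp: indicator_def)
  have "emeasure M {x \<in> space M. f x \<noteq> 0} \<le> emeasure M (\<Union>i<n. E i)"
  proof (rule emeasure_mono)
    show "{x \<in> space M. f x \<noteq> 0} \<subseteq> (\<Union>i<n. E i)"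
    proof (intro subsetI, rule ccontr)
      fix x assume x: "x \<in> {x \<in> space M. f x \<noteq> 0}" "x \<notin> (\<Union>i<n. E i)"
      then have "f x = 0" unfolding f by (intro sum.neutral) auto
      with x show False by simp
    qed
  qed (use E in auto)
  also have "\<dots> \<le> (\<Sum>i<n. emeasure M (E i))" using E by (intro emeasure_subadditive_finite) auto
  also have "\<dots> < \<infinity>" using E by simp
  finally show "emeasure M {x \<in> space M. f x \<noteq> 0} < \<infinity>" .
next
  assume f: "simple_function M f" and off: "\<forall>x. x \<notin> space M \<longrightarrow> f x = 0"
    and fin: "emeasure M {x \<in> space M. f x \<noteq> 0} < \<infinity>"
  have [measurable]: "f \<in> borel_measurable M" using f by (rule borel_measurable_simple_function)
  define V where "V = f ` space M - {0}"
  have "finite V" unfolding V_def using simple_functionD(1)[OF f] by simp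
  then obtain h where h: "bij_betw h {0..<card V} V" using ex_bij_betw_nat_finite by blast
  define E where "E v = f -` {v} \<inter> space M" for v
  have Em [measurable]: "E v \<in> sets M" for v
    unfolding E_def using simple_functionD(2)[OF f] .
  have Efin: "emeasure M (E v) < \<infinity>" if "v \<noteq> 0" for v
  proof -
    have "emeasure M (E v) \<le> emeasure M {x \<in> space M. f x \<noteq> 0}"
      using that by (intro emeasure_mono) (auto simp: E_def)
    with fin show ?thesis by simp
  qed
  have "f x = (\<Sum>i<card V. h i * indicator (E (h i)) x)" for x
  proof -
    have "(\<Sum>i<card V. h i * indicator (E (h i)) x) = (\<Sum>v\<in>V. v * indicator (E v) x)"
      using h by (intro sum.reindex_bij_betw[of h]) (simp add: atLeast0LessThan)
    also have "\<dots> = f x"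
    proof (cases "x \<in> space M \<and> f x \<noteq> 0")
      case True
      then have "(\<Sum>v\<in>V. v * indicator (E v) x) = (\<Sum>v\<in>V. if v = f x then f x else 0)"
        by (intro sum.cong) (auto simp: E_def indicator_def)
      also have "\<dots> = f x" using True \<open>finite V\<close> by (auto simp: V_def)
      finally show ?thesis .
    next
      case False
      with off show ?thesis by (auto intro!: sum.neutral simp: E_def indicator_def V_def)
    qed
    finally show ?thesis by simp
  qed
  moreover have "h i \<noteq> 0" if "i < card V" for i
    using bij_betwE[OF h] that by (auto simp: V_def)
  ultimately show "f \<in> simple_space M"
    unfolding simple_space_def mem_Collect_eq using Em Efin
    by (intro exI[of _ "card V"] exI[of _ h] exI[of _ "\<lambda>i. E (h i)"]) auto
qed

lemma simple_space_compose2: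
  fixes f :: "'a \<Rightarrow> 'k::{real_normed_field, euclidean_space}"
    and g :: "'a \<Rightarrow> 'l::{real_normed_field, euclidean_space}"
    and h :: "'a \<Rightarrow> 'm::{real_normed_field, euclidean_space}"
  assumes f: "f \<in> simple_space M" and g: "g \<in> simple_space M" and "\<And>x. h x = H (f x) (g x)" "H 0 0 = 0"
  shows "h \<in> simple_space M"
proof -
  have sf: "simple_function M f" "simple_function M g" using f g by (auto simp: simple_space_iff)
  have h: "h = (\<lambda>x. H (f x) (g x))" using assms(3) by auto
  have sh: "simple_function M h" unfolding h by (rule simple_function_compose2[OF sf])
  have [measurable]: "f \<in> borel_measurable M" "g \<in> borel_measurable M" "h \<in> borel_measurable M"
    using sf sh borel_measurable_simple_function by blast+
  have "emeasure M {x \<in> space M. h x \<noteq> 0} \<le> emeasure M ({x \<in> space M. f x \<noteq> 0} \<union> {x \<in> space M. g x \<noteq> 0})"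
    using assms(4) by (intro emeasure_mono) (auto simp: h)
  also have "\<dots> \<le> emeasure M {x \<in> space M. f x \<noteq> 0} + emeasure M {x \<in> space M. g x \<noteq> 0}"
    by (intro emeasure_subadditive) auto
  also have "\<dots> < \<infinity>" using f g unfolding simple_space_iff by simp
  finally have "emeasure M {x \<in> space M. h x \<noteq> 0} < \<infinity>" .
  moreover have "\<forall>x. x \<notin> space M \<longrightarrow> h x = 0"
    using f g assms(3,4) unfolding simple_space_iff by metis
  ultimately show ?thesis using sh unfolding simple_space_iff by blast
qed

lemma simple_space_compose:
  fixes f :: "'a \<Rightarrow> 'k::{real_normed_field, euclidean_space}"
    and H :: "'k \<Rightarrow> 'm::{real_normed_field, euclidean_space}"
  assumes "f \<in> simple_space M" "H 0 = 0"
  shows "(\<lambda>x. H (f x)) \<in> simple_space M"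
  by (rule simple_space_compose2[of f _ f _ "\<lambda>u v. H u"]) (use assms in auto)

lemma simple_space_add: "f \<in> simple_space M \<Longrightarrow> g \<in> simple_space M \<Longrightarrow> (\<lambda>x. f x + g x) \<in> simple_space M"
  by (rule simple_space_compose2[of f _ g _ "(+)"]) auto

lemma simple_space_cmult: "f \<in> simple_space M \<Longrightarrow> (\<lambda>x. c * f x) \<in> simple_space M"
  by (rule simple_space_compose) auto

lemma simple_space_diff: "f \<in> simple_space M \<Longrightarrow> g \<in> simple_space M \<Longrightarrow> (\<lambda>x. f x - g x) \<in> simple_space M"
  by (rule simple_space_compose2[of f _ g _ "(-)"]) auto

lemma simple_space_0: "(\<lambda>x. 0) \<in> simple_space M"
  by (simp add: simple_space_iff)

lemma simple_space_indicator: "E \<in> sets M \<Longrightarrow> emeasure M E < \<infinity> \<Longrightarrow> indicator E \<in> simple_space M"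
  using sets.sets_into_space[of E M]
  by (auto simp: simple_space_iff indicator_def Collect_conj_eq Int_absorb1 Int_commute)

lemma simple_space_measurable [measurable_dest]: "f \<in> simple_space M \<Longrightarrow> f \<in> borel_measurable M"
  by (auto simp: simple_space_iff intro: borel_measurable_simple_function)

lemma simple_space_sum:
  "(\<And>i. i \<in> I \<Longrightarrow> f i \<in> simple_space M) \<Longrightarrow> (\<lambda>x. \<Sum>i\<in>I. f i x) \<in> simple_space M"
  by (induction I rule: infinite_finite_induct) (auto intro: simple_space_0 simple_space_add)

lemma modulus_add_le: "modulus (\<lambda>x. f x + g x) x \<le> modulus f x + modulus g x"
  by (simp add: modulus_def norm_triangle_ineq ennreal_leI flip: ennreal_plus)

lemma modulus_cmult: "modulus (\<lambda>x. c * f x) = (\<lambda>x. ennreal (norm c) * modulus f x)"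
  for c :: "'k::real_normed_field"
  by (simp add: modulus_def norm_mult ennreal_mult)

section \<open>Completeness of the target functional\<close>

context power_avg
begin

definition seminorm :: "('b \<Rightarrow> 'k::{real_normed_field, euclidean_space}) \<Rightarrow> ennreal" where
  "seminorm h = \<sigma> (modulus h)"

lemma seminorm_cong:
  "f \<in> borel_measurable N \<Longrightarrow> g \<in> borel_measurable N \<Longrightarrow> AE y in N. f y = g y \<Longrightarrow> seminorm f = seminorm g"
  unfolding seminorm_def by (intro \<sigma>_cong) (auto simp: modulus_def elim!: eventually_mono)

lemma seminorm_add:
  assumes [measurable]: "f \<in> borel_measurable N" "g \<in> borel_measurable N"
  shows "seminorm (\<lambda>x. f x + g x) \<le> seminorm f + seminorm g"
proof -
  have "seminorm (\<lambda>x. f x + g x) \<le> \<sigma> (\<lambda>x. modulus f x + modulus g x)"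
    unfolding seminorm_def by (intro \<sigma>_mono AE_I2 modulus_add_le) auto
  also have "\<dots> \<le> seminorm f + seminorm g" unfolding seminorm_def by (intro \<sigma>_add) auto
  finally show ?thesis .
qed

lemma seminorm_cmult:
  "f \<in> borel_measurable N \<Longrightarrow> seminorm (\<lambda>x. c * f x) = ennreal (norm c) * seminorm f"
  by (simp add: seminorm_def modulus_cmult \<sigma>_cmult)

lemma seminorm_0 [simp]: "seminorm (\<lambda>x. 0) = 0"
  by (simp add: seminorm_def modulus_def)

lemma seminorm_eq_0D:
  assumes [measurable]: "f \<in> borel_measurable N" and "seminorm f = 0"
  shows "AE y in N. f y = 0"
  using \<sigma>_eq_0D[of "modulus f"] assms(2) by (simp add: seminorm_def modulus_def)

text \<open>The Riesz-Fischer argument: by \<open>\<sigma>_suminf\<close> the series of moduli of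
  increments has finite norm, hence is finite almost everywhere by \<open>\<sigma>_finD\<close>. The
  sequence thus converges almost everywhere, and the tails of the numerical series bound the
  distance to the limit.\<close>

lemma seminorm_complete:
  fixes h :: "nat \<Rightarrow> 'b \<Rightarrow> 'k::{real_normed_field, euclidean_space}"
  assumes h [measurable]: "\<And>n. h n \<in> borel_measurable N"
    and sum: "(\<Sum>n. seminorm (\<lambda>y. h (Suc n) y - h n y)) < \<infinity>"
  obtains k where "k \<in> borel_measurable N" "(\<lambda>n. seminorm (\<lambda>y. k y - h n y)) \<longlonglongrightarrow> 0"
proof -
  define d where "d n y = h (Suc n) y - h n y" for n y
  have d [measurable]: "d n \<in> borel_measurable N" for n unfolding d_def by measurable
  define k where "k y = lim (\<lambda>n. h n y)" for y
  have k [measurable]: "k \<in> borel_measurable N" unfolding k_def by (rule borel_measurable_lim_metric) measurable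
  have "\<sigma> (\<lambda>y. \<Sum>n. modulus (d n) y) \<le> (\<Sum>n. seminorm (d n))"
    unfolding seminorm_def by (rule \<sigma>_suminf) measurable
  also have "\<dots> < \<infinity>" using sum by (simp add: d_def[abs_def])
  finally have "AE y in N. (\<Sum>n. modulus (d n) y) < \<infinity>" by (intro \<sigma>_finD) measurable
  then have bound: "AE y in N. \<forall>n. modulus (\<lambda>y. k y - h n y) y \<le> (\<Sum>i. modulus (d (i + n)) y)"
  proof (rule eventually_mono)
    fix y assume fin: "(\<Sum>n. modulus (d n) y) < \<infinity>"
    then have s: "summable (\<lambda>n. norm (d n y))"
      by (intro summable_suminf_not_top) (auto simp: modulus_def)
    then have "summable (\<lambda>n. d n y)" by (rule summable_norm_cancel)
    then have "convergent (\<lambda>n. \<Sum>i<n. d i y)" by (simp add: summable_iff_convergent)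
    moreover have tel: "(\<Sum>i<n. d i y) = h n y - h 0 y" for n
      unfolding d_def by (rule sum_lessThan_telescope)
    ultimately obtain l where "(\<lambda>n. h n y - h 0 y) \<longlonglongrightarrow> l" by (auto simp: convergent_def)
    then have "(\<lambda>n. (h n y - h 0 y) + h 0 y) \<longlonglongrightarrow> l + h 0 y" by (intro tendsto_intros)
    then have "convergent (\<lambda>n. h n y)" by (auto simp: convergent_def)
    then have lim: "(\<lambda>n. h n y) \<longlonglongrightarrow> k y" unfolding k_def by (simp add: convergent_LIMSEQ_iff)
    show "\<forall>n. modulus (\<lambda>y. k y - h n y) y \<le> (\<Sum>i. modulus (d (i + n)) y)"
    proof
      fix n
      have sn: "summable (\<lambda>i. norm (d (i + n) y))" using s by (subst summable_iff_shift)
      have "(\<lambda>i. d (i + n) y) sums (k y - h n y)"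
        using telescope_sums[OF LIMSEQ_ignore_initial_segment[OF lim, of n]] by (simp add: d_def)
      then have "norm (k y - h n y) \<le> (\<Sum>i. norm (d (i + n) y))"
        using summable_norm[OF sn] by (simp add: sums_iff)
      then show "modulus (\<lambda>y. k y - h n y) y \<le> (\<Sum>i. modulus (d (i + n)) y)"
        unfolding modulus_def by (subst suminf_ennreal2[OF _ sn]) (auto intro: ennreal_leI)
    qed
  qed
  have le: "seminorm (\<lambda>y. k y - h n y) \<le> (\<Sum>i. seminorm (d (i + n)))" for n
  proof -
    have "seminorm (\<lambda>y. k y - h n y) \<le> \<sigma> (\<lambda>y. \<Sum>i. modulus (d (i + n)) y)"
      unfolding seminorm_def using bound by (intro \<sigma>_mono) (auto elim!: eventually_mono)
    also have "\<dots> \<le> (\<Sum>i. seminorm (d (i + n)))"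
      unfolding seminorm_def by (rule \<sigma>_suminf) measurable
    finally show ?thesis .
  qed
  define r where "r n = enn2real (seminorm (d n))" for n
  have fin: "(\<Sum>n. seminorm (d n)) \<noteq> top" using sum by (simp add: d_def[abs_def])
  have dr: "seminorm (d n) = ennreal (r n)" for n
    unfolding r_def using ennreal_suminf_lessD[of "\<lambda>n. seminorm (d n)" top n] fin by (simp add: less_top)
  have r0: "0 \<le> r n" for n by (simp add: r_def)
  have sr: "summable r"
    using fin unfolding dr by (intro summable_suminf_not_top) (auto simp: r_def)
  have "(\<lambda>n. \<Sum>i. r (i + n)) \<longlonglongrightarrow> 0"
    using suminf_exist_split2[OF sr] .
  then have "(\<lambda>n. ennreal (\<Sum>i. r (i + n))) \<longlonglongrightarrow> ennreal 0" by (rule tendsto_ennrealI)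
  moreover have "(\<Sum>i. seminorm (d (i + n))) = ennreal (\<Sum>i. r (i + n))" for n
    unfolding dr using sr r0 by (intro suminf_ennreal2) (auto simp: summable_iff_shift)
  ultimately have "(\<lambda>n. \<Sum>i. seminorm (d (i + n))) \<longlonglongrightarrow> 0" by simp
  then have "(\<lambda>n. seminorm (\<lambda>y. k y - h n y)) \<longlonglongrightarrow> 0"
    by (rule tendsto_sandwich[OF _ _ tendsto_const, rotated 2]) (use le in auto)
  with k that show ?thesis by blast
qed

end

context interpolation
begin

lemma \<Lambda>_modulus_add:
  fixes f g :: "'a \<Rightarrow> 'k::{real_normed_field, euclidean_space}"
  assumes [measurable]: "f \<in> borel_measurable M" "g \<in> borel_measurable M"
  shows "X.qnorm (\<lambda>x. f x + g x) \<le> 2 * (X.qnorm f + X.qnorm g)"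
  by (rule order_trans[OF X.\<Lambda>_mono X.\<Lambda>_add]) (auto intro: modulus_add_le)

lemma \<Lambda>_modulus_cmult:
  "f \<in> borel_measurable M \<Longrightarrow> X.qnorm (\<lambda>x. c * f x) = ennreal (norm c) * X.qnorm f"
  for c :: "'k::{real_normed_field, euclidean_space}"
  by (simp add: modulus_cmult X.\<Lambda>_cmult)

lemma \<Lambda>_modulus_diff:
  fixes f g :: "'a \<Rightarrow> 'k::{real_normed_field, euclidean_space}"
  assumes [measurable]: "f \<in> borel_measurable M" "g \<in> borel_measurable M"
  shows "X.qnorm (\<lambda>x. f x - g x) \<le> 2 * (X.qnorm f + X.qnorm g)"
  using \<Lambda>_modulus_add[of f "\<lambda>x. - 1 * g x"] \<Lambda>_modulus_cmult[of g "- 1"] by simp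

text \<open>The approximants satisfy \<open>norm (s i x) \<le> 2 * norm (f x)\<close>. This
  dominates the error by three times the modulus of \<open>f\<close>, and it also confines the
  support of each approximant to a super-level set of \<open>f\<close>, of finite measure by
  \<open>X.distr_fun_finite\<close>.\<close>

lemma simple_space_dense:
  fixes f :: "'a \<Rightarrow> 'k::{real_normed_field, euclidean_space}"
  assumes f [measurable]: "f \<in> borel_measurable M" and fin: "X.qnorm f < \<infinity>" and e: "0 < e"
  obtains s where "s \<in> simple_space M" "X.qnorm (\<lambda>x. f x - s x) < e"
proof -
  obtain H where H: "\<And>i. simple_function M (H i)" "\<And>x. x \<in> space M \<Longrightarrow> (\<lambda>i. H i x) \<longlonglongrightarrow> f x"
    "\<And>i x. x \<in> space M \<Longrightarrow> dist (H i x) 0 \<le> 2 * dist (f x) 0"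
    using borel_measurable_implies_sequence_metric[OF f, of 0] by blast
  define s where "s i x = (if x \<in> space M then H i x else 0)" for i x
  have s_simple: "s i \<in> simple_space M" for i
  proof -
    have ss: "simple_function M (s i)"
      using H(1)[of i] by (rule simple_function_cong[THEN iffD1, rotated]) (simp add: s_def)
    have sm [measurable]: "s i \<in> borel_measurable M" using ss by (rule borel_measurable_simple_function)
    define V where "V = norm ` (s i ` space M - {0})"
    have V: "finite V" unfolding V_def using simple_functionD(1)[OF ss] by simp
    \<comment> \<open>Inserting 1 covers the zero function, for which \<open>V\<close> is empty.
      Nonzero values have norm at least \<open>d\<close>, so there the norm of \<open>f\<close> is
      at least \<open>d / 2\<close>; the level \<open>d / 4\<close> makes this strict.\<close>
    define d where "d = Min (insert 1 V)"
    have d: "0 < d" unfolding d_def using V by (auto simp: V_def)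
    have "distr_fun M (modulus f) (d / 4) < \<infinity>"
      using fin d by (intro X.distr_fun_finite \<Phi>_top) auto
    moreover have "{x \<in> space M. s i x \<noteq> 0} \<subseteq> {x \<in> space M. ennreal (d / 4) < modulus f x}"
    proof safe
      fix x assume x: "x \<in> space M" "s i x \<noteq> 0"
      then have "norm (s i x) \<in> V" by (auto simp: V_def)
      then have "d \<le> norm (s i x)" unfolding d_def using V by (intro Min_le) auto
      also have "\<dots> \<le> 2 * norm (f x)" using H(3)[of x i] x by (simp add: s_def)
      finally show "ennreal (d / 4) < modulus f x"
        using d by (simp add: modulus_def ennreal_less_iff)
    qed
    then have "emeasure M {x \<in> space M. s i x \<noteq> 0} \<le> distr_fun M (modulus f) (d / 4)"
      unfolding distr_fun_def by (intro emeasure_mono) auto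
    ultimately have "emeasure M {x \<in> space M. s i x \<noteq> 0} < \<infinity>" by simp
    then show ?thesis using ss unfolding simple_space_iff by (simp add: s_def)
  qed
  have [measurable]: "s i \<in> borel_measurable M" for i using s_simple by (rule simple_space_measurable)
  have 3: "X.\<Lambda> (\<lambda>x. ennreal 3 * modulus f x) < \<infinity>"
    using fin by (subst X.\<Lambda>_cmult) (auto simp: ennreal_mult_less_top)
  have "(\<lambda>i. X.qnorm (\<lambda>x. f x - s i x)) \<longlonglongrightarrow> 0"
  proof (rule X.\<Lambda>_tendsto_0[where g="\<lambda>x. ennreal 3 * modulus f x"])
    fix i x assume x: "x \<in> space M"
    have "norm (f x - s i x) \<le> norm (f x) + norm (s i x)" by (rule norm_triangle_ineq4)
    also have "norm (s i x) \<le> 2 * norm (f x)" using H(3)[of x i] x by (simp add: s_def)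
    finally have "ennreal (norm (f x - s i x)) \<le> ennreal (3 * norm (f x))" by (intro ennreal_leI) simp
    also have "\<dots> = ennreal 3 * ennreal (norm (f x))" by (rule ennreal_mult) auto
    finally show "modulus (\<lambda>x. f x - s i x) x \<le> ennreal 3 * modulus f x"
      by (simp add: modulus_def)
  next
    fix x assume x: "x \<in> space M"
    have "(\<lambda>i. ennreal (norm (f x - H i x))) \<longlonglongrightarrow> ennreal (norm (f x - f x))"
      by (intro tendsto_intros tendsto_ennrealI H x)
    then show "(\<lambda>i. modulus (\<lambda>x. f x - s i x) x) \<longlonglongrightarrow> 0" using x by (simp add: modulus_def s_def)
  next
    fix l :: real assume "0 < l"
    then show "distr_fun M (\<lambda>x. ennreal 3 * modulus f x) l < \<infinity>"
      using 3 by (intro X.distr_fun_finite \<Phi>_top) auto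
  qed (use 3 in auto)
  then have "\<forall>\<^sub>F i in sequentially. X.qnorm (\<lambda>x. f x - s i x) < e"
    using e by (rule order_tendstoD)
  then obtain i where "X.qnorm (\<lambda>x. f x - s i x) < e" by (auto simp: eventually_sequentially)
  with s_simple that show ?thesis by blast
qed

end

section \<open>Boundedness on simple functions\<close>

locale operator_on_indicators = interpolation M Xbar N Ybar p q
  for M :: "'a measure" and Xbar and N :: "'b measure" and Ybar p q +
  fixes B :: "('a \<Rightarrow> 'k::{real_normed_field, euclidean_space}) \<Rightarrow> 'b \<Rightarrow> 'k" and K :: real
  assumes B: "linear_op N (simple_space M) B" and K: "0 \<le> K"
    and B_indicator: "\<And>E. E \<in> sets M \<Longrightarrow> emeasure M E < \<infinity> \<Longrightarrow>
      Y.seminorm (B (indicator E)) \<le> ennreal K * X.\<Phi> (emeasure M E)"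
begin

lemma B_measurable [measurable]: "f \<in> simple_space M \<Longrightarrow> B f \<in> borel_measurable N"
  using B by (auto simp: linear_op_def)

lemma B_add: "f \<in> simple_space M \<Longrightarrow> g \<in> simple_space M \<Longrightarrow> AE y in N. B (\<lambda>x. f x + g x) y = B f y + B g y"
  using B unfolding linear_op_def by blast

lemma B_cmult: "f \<in> simple_space M \<Longrightarrow> AE y in N. B (\<lambda>x. c * f x) y = c * B f y"
  using B unfolding linear_op_def by blast

lemma B_diff:
  assumes "f \<in> simple_space M" "g \<in> simple_space M"
  shows "AE y in N. B (\<lambda>x. f x - g x) y = B f y - B g y"
  using B_add[OF assms(1) simple_space_cmult[OF assms(2), of "- 1"]] B_cmult[OF assms(2), of "- 1"]
  by eventually_elim simp

lemma seminorm_B_add: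
  assumes "f \<in> simple_space M" "g \<in> simple_space M"
  shows "Y.seminorm (B (\<lambda>x. f x + g x)) \<le> Y.seminorm (B f) + Y.seminorm (B g)"
proof -
  have "Y.seminorm (B (\<lambda>x. f x + g x)) = Y.seminorm (\<lambda>y. B f y + B g y)"
    using assms by (intro Y.seminorm_cong B_add B_measurable simple_space_add borel_measurable_add)
  also have "\<dots> \<le> Y.seminorm (B f) + Y.seminorm (B g)"
    using assms by (intro Y.seminorm_add B_measurable)
  finally show ?thesis .
qed

lemma seminorm_B_cmult:
  assumes "f \<in> simple_space M"
  shows "Y.seminorm (B (\<lambda>x. c * f x)) = ennreal (norm c) * Y.seminorm (B f)"
proof -
  have "Y.seminorm (B (\<lambda>x. c * f x)) = Y.seminorm (\<lambda>y. c * B f y)"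
    using assms by (intro Y.seminorm_cong B_cmult B_measurable simple_space_cmult borel_measurable_times) auto
  also have "\<dots> = ennreal (norm c) * Y.seminorm (B f)"
    using assms by (intro Y.seminorm_cmult B_measurable)
  finally show ?thesis .
qed

lemma seminorm_B_0: "Y.seminorm (B (\<lambda>x. 0)) = 0"
  using seminorm_B_cmult[OF simple_space_0, of 0] by simp

lemma seminorm_B_sum:
  assumes "\<And>i. i \<in> I \<Longrightarrow> f i \<in> simple_space M"
  shows "Y.seminorm (B (\<lambda>x. \<Sum>i\<in>I. f i x)) \<le> (\<Sum>i\<in>I. Y.seminorm (B (f i)))"
  using assms
proof (induction I rule: infinite_finite_induct)
  case (insert j I)
  have "Y.seminorm (B (\<lambda>x. f j x + (\<Sum>i\<in>I. f i x))) \<le> Y.seminorm (B (f j)) + Y.seminorm (B (\<lambda>x. \<Sum>i\<in>I. f i x))"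
    using insert.prems by (intro seminorm_B_add simple_space_sum) auto
  also have "\<dots> \<le> Y.seminorm (B (f j)) + (\<Sum>i\<in>I. Y.seminorm (B (f i)))"
    using insert by (intro add_left_mono) auto
  finally show ?case using insert.hyps by simp
qed (simp_all add: seminorm_B_0)

text \<open>Peeling off the layer below the smallest positive value of \<open>g\<close>.\<close>

lemma seminorm_B_nonneg:
  fixes g :: "'a \<Rightarrow> real"
  assumes "g \<in> simple_space M" "\<And>x. 0 \<le> g x"
  shows "Y.seminorm (B (\<lambda>x. of_real (g x))) \<le> ennreal K * X.\<Lambda> (\<lambda>x. ennreal (g x))"
  using assms
proof (induction "card (g ` space M - {0})" arbitrary: g rule: less_induct)
  case less
  note g = less.prems
  have off: "g x = 0" if "x \<notin> space M" for x using g(1) that unfolding simple_space_iff by blast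
  have gm [measurable]: "g \<in> borel_measurable M" using g(1) by (rule simple_space_measurable)
  define V where "V = g ` space M - {0}"
  have V: "finite V" unfolding V_def using g(1) unfolding simple_space_iff by (auto dest: simple_functionD(1))
  show ?case
  proof (cases "V = {}")
    case True
    then have "g x = 0" for x using off[of x] by (cases "x \<in> space M") (auto simp: V_def)
    then show ?thesis by (simp add: seminorm_B_0)
  next
    case False
    define m where "m = Min V"
    have m: "m \<in> V" "\<And>v. v \<in> V \<Longrightarrow> m \<le> v" unfolding m_def using V False by auto
    have m0: "0 < m" using m(1) g(2) by (auto simp: V_def less_le)
    define E where "E = {x \<in> space M. g x \<noteq> 0}"
    have E [measurable]: "E \<in> sets M" unfolding E_def by measurable
    have Efin: "emeasure M E < \<infinity>" unfolding E_def using g(1) unfolding simple_space_iff by blast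
    define g' where "g' x = (if g x = 0 then 0 else g x - m)" for x
    have g': "g' \<in> simple_space M"
      unfolding g'_def by (rule simple_space_compose[OF g(1)]) simp
    have [measurable]: "g' \<in> borel_measurable M" using g' by (rule simple_space_measurable)
    have mle: "m \<le> g x" if "g x \<noteq> 0" for x
      using m(2)[of "g x"] off[of x] that by (auto simp: V_def)
    have g'0: "0 \<le> g' x" for x using mle[of x] by (simp add: g'_def)
    \<comment> \<open>Subtracting \<open>m\<close> turns the value \<open>m\<close> into 0 and only
      translates the others, so the number of nonzero values drops and the induction hypothesis
      applies.\<close>
    have "g' ` space M - {0} \<subseteq> (\<lambda>v. v - m) ` (V - {m})"
      by (auto simp: g'_def V_def split: if_splits)
    then have "card (g' ` space M - {0}) \<le> card (V - {m})"
      using V by (intro surj_card_le) auto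
    also have "\<dots> < card V" using V m(1) by (intro card_Diff1_less) auto
    finally have IH: "Y.seminorm (B (\<lambda>x. of_real (g' x))) \<le> ennreal K * X.\<Lambda> (\<lambda>x. ennreal (g' x))"
      using g' g'0 unfolding V_def by (intro less.hyps)
    have eq: "(\<lambda>x. of_real (g x)) = (\<lambda>x. of_real m * indicator E x + of_real (g' x) :: 'k)"
    proof
      show "of_real (g x) = (of_real m * indicator E x + of_real (g' x) :: 'k)" for x
        using off[of x] by (cases "x \<in> E") (auto simp: E_def g'_def)
    qed
    have "Y.seminorm (B (\<lambda>x. of_real (g x))) \<le> Y.seminorm (B (\<lambda>x. of_real m * indicator E x)) + Y.seminorm (B (\<lambda>x. of_real (g' x)))"
      unfolding eq
    proof (rule seminorm_B_add)
      show "(\<lambda>x. of_real m * indicator E x :: 'k) \<in> simple_space M"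
        by (intro simple_space_cmult simple_space_indicator E Efin)
      show "(\<lambda>x. of_real (g' x) :: 'k) \<in> simple_space M"
        by (rule simple_space_compose[OF g']) simp
    qed
    also have "Y.seminorm (B (\<lambda>x. of_real m * indicator E x)) = ennreal m * Y.seminorm (B (indicator E))"
      using E Efin m0 by (subst seminorm_B_cmult) (auto intro: simple_space_indicator)
    also have "ennreal m * Y.seminorm (B (indicator E)) + Y.seminorm (B (\<lambda>x. of_real (g' x)))
       \<le> ennreal m * (ennreal K * X.\<Phi> (emeasure M E)) + ennreal K * X.\<Lambda> (\<lambda>x. ennreal (g' x))"
      by (intro add_mono mult_left_mono B_indicator E Efin IH) auto
    also have "\<dots> = ennreal K * (ennreal m * X.\<Phi> (emeasure M E) + X.\<Lambda> (\<lambda>x. ennreal (g' x)))"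
      by (simp add: distrib_left mult.left_commute)
    also have "ennreal m * X.\<Phi> (emeasure M E) + X.\<Lambda> (\<lambda>x. ennreal (g' x)) = X.\<Lambda> (\<lambda>x. ennreal (g x))"
    proof -
      have 1: "(\<lambda>x. ennreal (g' x) * indicator E x) = (\<lambda>x. ennreal (g' x))"
        using off by (auto simp: fun_eq_iff indicator_def E_def g'_def)
      have 2: "(\<lambda>x. (ennreal m + ennreal (g' x)) * indicator E x) = (\<lambda>x. ennreal (g x))"
      proof
        show "(ennreal m + ennreal (g' x)) * indicator E x = ennreal (g x)" for x
          using off[of x] m0 mle[of x] by (cases "x \<in> E") (auto simp: E_def g'_def simp flip: ennreal_plus)
      qed
      show ?thesis
        using X.\<Lambda>_split_layer[of "\<lambda>x. ennreal (g' x)" E m] m0 unfolding 1 2 by simp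
    qed
    finally show ?thesis .
  qed
qed

text \<open>One \<open>K\<close> for the positive and one for the negative part of each real
  coordinate of the scalars.\<close>

definition bound :: real where "bound = 2 * real DIM('k) * K"

lemma bound_nonneg: "0 \<le> bound"
  using K by (simp add: bound_def)

text \<open>Layers exist only for nonnegative functions, so \<open>f\<close> is split along the real
  basis of the scalar field. A basis element \<open>b\<close> serves both as a direction for the
  inner product and as a scalar of norm 1, which linearity moves out of \<open>B\<close>;
  \<open>P b\<close> and \<open>P (- b)\<close> are the positive and negative parts of one
  coordinate.\<close>

lemma seminorm_B_le:
  assumes f: "f \<in> simple_space M"
  shows "Y.seminorm (B f) \<le> ennreal bound * X.qnorm f"
proof -
  have [measurable]: "f \<in> borel_measurable M" using f by (rule simple_space_measurable)
  define P where "P b x = max 0 (f x \<bullet> b)" for b x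
  have P: "P b \<in> simple_space M" for b
    unfolding P_def by (rule simple_space_compose[OF f]) simp
  have oP: "(\<lambda>x. of_real (P b x) :: 'k) \<in> simple_space M" for b
    by (rule simple_space_compose[OF P]) simp
  have B1: "Y.seminorm (B (\<lambda>x. c * of_real (P b x))) \<le> ennreal K * X.qnorm f"
    if "norm c = 1" "norm b = 1" for b c
  proof -
    have "Y.seminorm (B (\<lambda>x. c * of_real (P b x))) = Y.seminorm (B (\<lambda>x. of_real (P b x)))"
      using that oP[of b] by (subst seminorm_B_cmult) auto
    also have "\<dots> \<le> ennreal K * X.\<Lambda> (\<lambda>x. ennreal (P b x))"
      by (intro seminorm_B_nonneg P) (auto simp: P_def)
    also have "\<dots> \<le> ennreal K * X.qnorm f"
    proof (intro mult_left_mono X.\<Lambda>_mono AE_I2)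
      have "f x \<bullet> b \<le> norm (f x)" for x using norm_cauchy_schwarz[of "f x" b] that(2) by simp
      then show "ennreal (P b x) \<le> modulus f x" for x
        by (auto simp: P_def modulus_def intro!: ennreal_leI)
      show "(\<lambda>x. ennreal (P b x)) \<in> borel_measurable M"
        using simple_space_measurable[OF P[of b]] by measurable
    qed auto
    finally show ?thesis .
  qed
  have "f x = (\<Sum>b\<in>Basis. b * of_real (P b x) + (- b) * of_real (P (- b) x))" for x
  proof -
    have "b * of_real (P b x) + (- b) * of_real (P (- b) x) = (f x \<bullet> b) *\<^sub>R b" for b
      by (cases "0 \<le> f x \<bullet> b") (auto simp: P_def scaleR_conv_of_real mult.commute)
    then show ?thesis by (simp add: euclidean_representation)
  qed
  then have "f = (\<lambda>x. \<Sum>b\<in>Basis. b * of_real (P b x) + (- b) * of_real (P (- b) x))"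
    by (rule ext)
  then have "Y.seminorm (B f) = Y.seminorm (B (\<lambda>x. \<Sum>b\<in>Basis. b * of_real (P b x) + (- b) * of_real (P (- b) x)))"
    by (rule arg_cong)
  also have "\<dots> \<le> (\<Sum>b\<in>Basis. Y.seminorm (B (\<lambda>x. b * of_real (P b x) + (- b) * of_real (P (- b) x))))"
    using P by (intro seminorm_B_sum simple_space_add simple_space_cmult oP)
  also have "\<dots> \<le> (\<Sum>b\<in>(Basis :: 'k set). ennreal K * X.qnorm f + ennreal K * X.qnorm f)"
  proof (rule sum_mono)
    fix b :: 'k assume b: "b \<in> Basis"
    show "Y.seminorm (B (\<lambda>x. b * of_real (P b x) + (- b) * of_real (P (- b) x))) \<le> ennreal K * X.qnorm f + ennreal K * X.qnorm f"
      using b by (intro order_trans[OF seminorm_B_add] add_mono B1 simple_space_cmult oP) auto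
  qed
  also have "\<dots> = ennreal (real DIM('k)) * (ennreal 2 * (ennreal K * X.qnorm f))"
    by (simp add: mult_2 ennreal_of_nat_eq_real_of_nat)
  also have "\<dots> = ennreal bound * X.qnorm f"
    using K by (simp add: bound_def ennreal_mult mult_ac)
  finally show ?thesis .
qed

end

lemma (in Lambda_space) \<Lambda>_simple_finite:
  fixes f :: "'a \<Rightarrow> 'k::{real_normed_field, euclidean_space}"
  assumes f: "f \<in> simple_space M"
  shows "\<Lambda> (modulus f) < \<infinity>"
proof -
  have [measurable]: "f \<in> borel_measurable M" using f by (rule simple_space_measurable)
  define E where "E = {x \<in> space M. f x \<noteq> 0}"
  have E [measurable]: "E \<in> sets M" unfolding E_def by measurable
  have Efin: "emeasure M E < \<infinity>" unfolding E_def using f unfolding simple_space_iff by blast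
  define V where "V = insert 0 ((\<lambda>x. norm (f x)) ` space M)"
  have V: "finite V"
    using f unfolding V_def simple_space_iff by (auto dest!: simple_functionD(1) simp: image_image[of norm f, symmetric])
  have "\<Lambda> (modulus f) \<le> \<Lambda> (\<lambda>x. ennreal (Max V) * indicator E x)"
    using V by (intro \<Lambda>_mono AE_I2) (auto simp: modulus_def indicator_def E_def V_def intro!: ennreal_leI Max_ge)
  also have "\<dots> = ennreal (Max V) * \<Phi> (emeasure M E)"
    using V by (subst \<Lambda>_cmult) (auto simp: \<Lambda>_indicator V_def intro!: Max_ge)
  also have "\<dots> < \<infinity>" using \<Phi>_less_top[of "emeasure M E"] Efin by (simp add: ennreal_mult_less_top)
  finally show ?thesis .
qed

section \<open>Extension by density and its uniqueness\<close>

context operator_on_indicators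
begin

text \<open>
  \<open>h\<close> is a value of the extension at \<open>f\<close>; working with this relation instead of a chosen sequence
  makes linearity and uniqueness immediate.
\<close>

definition approx :: "('a \<Rightarrow> 'k) \<Rightarrow> ('b \<Rightarrow> 'k) \<Rightarrow> bool" where
  "approx f h \<longleftrightarrow> f \<in> borel_measurable M \<and> h \<in> borel_measurable N \<and>
    (\<forall>e>0. \<exists>s\<in>simple_space M. X.qnorm (\<lambda>x. f x - s x) < ennreal e \<and> Y.seminorm (\<lambda>y. h y - B s y) < ennreal e)"

lemma approxD:
  assumes "approx f h" "0 < e"
  obtains s where "s \<in> simple_space M" "X.qnorm (\<lambda>x. f x - s x) < ennreal e"
    "Y.seminorm (\<lambda>y. h y - B s y) < ennreal e"
  using assms unfolding approx_def by blast

lemma approx_measurable: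
  "approx f h \<Longrightarrow> f \<in> borel_measurable M" "approx f h \<Longrightarrow> h \<in> borel_measurable N"
  unfolding approx_def by blast+

lemma approx_add:
  assumes f: "approx f h" and g: "approx g k"
  shows "approx (\<lambda>x. f x + g x) (\<lambda>y. h y + k y)"
proof -
  note [measurable] = approx_measurable[OF f] approx_measurable[OF g]
  show ?thesis
    unfolding approx_def
  proof (intro conjI allI impI)
    fix e :: real assume "0 < e"
    \<comment> \<open>Two summands and the factor 2 of the Lorentz functional: a quarter of
      \<open>e\<close> for each.\<close>
    then have e4: "0 < e / 4" by simp
    obtain s where s: "s \<in> simple_space M" "X.qnorm (\<lambda>x. f x - s x) < ennreal (e / 4)"
      "Y.seminorm (\<lambda>y. h y - B s y) < ennreal (e / 4)" using approxD[OF f e4] by blast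
    obtain t where t: "t \<in> simple_space M" "X.qnorm (\<lambda>x. g x - t x) < ennreal (e / 4)"
      "Y.seminorm (\<lambda>y. k y - B t y) < ennreal (e / 4)" using approxD[OF g e4] by blast
    note [measurable] = simple_space_measurable[OF s(1)] simple_space_measurable[OF t(1)] B_measurable[OF s(1)] B_measurable[OF t(1)]
    have st: "(\<lambda>x. s x + t x) \<in> simple_space M" using s t by (intro simple_space_add)
    note [measurable] = B_measurable[OF st]
    have "X.qnorm (\<lambda>x. f x + g x - (s x + t x)) = X.qnorm (\<lambda>x. (f x - s x) + (g x - t x))"
      by (simp add: algebra_simps)
    also have "\<dots> \<le> 2 * (X.qnorm (\<lambda>x. f x - s x) + X.qnorm (\<lambda>x. g x - t x))"
      by (rule \<Lambda>_modulus_add) measurable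
    also have "\<dots> < 2 * (ennreal (e / 4) + ennreal (e / 4))"
      using s t by (intro ennreal_mult_strict_left_mono add_strict_mono) auto
    also have "\<dots> = ennreal 2 * ennreal (e / 4 + e / 4)" using \<open>0 < e\<close> by (subst ennreal_plus) auto
    also have "\<dots> = ennreal e" using \<open>0 < e\<close> by (subst ennreal_mult[symmetric]) auto
    finally have 1: "X.qnorm (\<lambda>x. f x + g x - (s x + t x)) < ennreal e" .
    have "Y.seminorm (\<lambda>y. h y + k y - B (\<lambda>x. s x + t x) y) = Y.seminorm (\<lambda>y. (h y - B s y) + (k y - B t y))"
      using B_add[OF s(1) t(1)] by (intro Y.seminorm_cong) (auto elim!: eventually_mono)
    also have "\<dots> \<le> Y.seminorm (\<lambda>y. h y - B s y) + Y.seminorm (\<lambda>y. k y - B t y)"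
      by (rule Y.seminorm_add) measurable
    also have "\<dots> < ennreal (e / 4) + ennreal (e / 4)"
      using s t by (intro add_strict_mono)
    also have "\<dots> = ennreal (e / 4 + e / 4)" using \<open>0 < e\<close> by (subst ennreal_plus) auto
    also have "\<dots> \<le> ennreal e" using \<open>0 < e\<close> by (intro ennreal_leI) auto
    finally have 2: "Y.seminorm (\<lambda>y. h y + k y - B (\<lambda>x. s x + t x) y) < ennreal e" .
    show "\<exists>s\<in>simple_space M. X.qnorm (\<lambda>x. f x + g x - s x) < ennreal e \<and> Y.seminorm (\<lambda>y. h y + k y - B s y) < ennreal e"
      by (rule bexI[where x="\<lambda>x. s x + t x", OF _ st]) (rule conjI[OF 1 2])
  qed measurable
qed

text \<open>Dividing by \<open>c + 1\<close> instead of \<open>c\<close> admits \<open>c = 0\<close>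
  and leaves room for strictness.\<close>

lemma mult_quotient_less:
  assumes "x < ennreal (e / (c + 1))" "0 < e" "0 \<le> c"
  shows "ennreal c * x < ennreal e"
proof -
  have "ennreal c * x \<le> ennreal c * ennreal (e / (c + 1))"
    using assms by (intro mult_left_mono) auto
  also have "\<dots> = ennreal (c * (e / (c + 1)))" using assms by (subst ennreal_mult) auto
  also have "\<dots> < ennreal e" using assms by (intro ennreal_lessI) (auto simp: field_simps)
  finally show ?thesis .
qed

lemma approx_cmult:
  assumes f: "approx f h"
  shows "approx (\<lambda>x. c * f x) (\<lambda>y. c * h y)"
proof -
  note [measurable] = approx_measurable[OF f]
  show ?thesis
    unfolding approx_def
  proof (intro conjI allI impI)
    fix e :: real assume e: "0 < e"
    then have "0 < e / (norm c + 1)" by (simp add: add_nonneg_pos)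
    then obtain s where s: "s \<in> simple_space M" "X.qnorm (\<lambda>x. f x - s x) < ennreal (e / (norm c + 1))"
      "Y.seminorm (\<lambda>y. h y - B s y) < ennreal (e / (norm c + 1))" using approxD[OF f] by blast
    note [measurable] = simple_space_measurable[OF s(1)] B_measurable[OF s(1)]
    have cs: "(\<lambda>x. c * s x) \<in> simple_space M" using s by (intro simple_space_cmult)
    note [measurable] = B_measurable[OF cs]
    have "X.qnorm (\<lambda>x. c * f x - c * s x) = ennreal (norm c) * X.qnorm (\<lambda>x. f x - s x)"
      by (subst \<Lambda>_modulus_cmult[symmetric]) (auto simp: right_diff_distrib)
    also have "\<dots> < ennreal e" using s(2) e by (intro mult_quotient_less) auto
    finally have 1: "X.qnorm (\<lambda>x. c * f x - c * s x) < ennreal e" .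
    have "Y.seminorm (\<lambda>y. c * h y - B (\<lambda>x. c * s x) y) = Y.seminorm (\<lambda>y. c * (h y - B s y))"
      using B_cmult[OF s(1), of c] by (intro Y.seminorm_cong) (auto elim!: eventually_mono simp: right_diff_distrib)
    also have "\<dots> = ennreal (norm c) * Y.seminorm (\<lambda>y. h y - B s y)"
      by (rule Y.seminorm_cmult) measurable
    also have "\<dots> < ennreal e" using s(3) e by (intro mult_quotient_less) auto
    finally have 2: "Y.seminorm (\<lambda>y. c * h y - B (\<lambda>x. c * s x) y) < ennreal e" .
    show "\<exists>s\<in>simple_space M. X.qnorm (\<lambda>x. c * f x - s x) < ennreal e \<and> Y.seminorm (\<lambda>y. c * h y - B s y) < ennreal e"
      by (rule bexI[where x="\<lambda>x. c * s x", OF _ cs]) (rule conjI[OF 1 2])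
  qed measurable
qed

lemma \<Lambda>_0: "X.qnorm (\<lambda>x. 0 :: 'k) = 0"
  using \<Lambda>_modulus_cmult[of "\<lambda>x. 0 :: 'k" 0] by simp

lemma approx_simple: "s \<in> simple_space M \<Longrightarrow> approx s (B s)"
  unfolding approx_def
  by (auto simp: \<Lambda>_0 intro!: simple_space_measurable B_measurable bexI[of _ s])

text \<open>The constant doubles because the functional of the approximant \<open>s\<close> is
  estimated through \<open>f - (f - s)\<close>, that is, by the triangle inequality with factor
  2.\<close>

lemma approx_bound:
  assumes f: "approx f h"
  shows "Y.seminorm h \<le> ennreal (2 * bound) * X.qnorm f"
proof (rule ennreal_le_epsilon)
  fix e :: real assume e: "0 < e"
  note [measurable] = approx_measurable[OF f]
  have "0 < e / (2 * bound + 1)" using e bound_nonneg by (simp add: add_nonneg_pos)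
  then obtain s where s: "s \<in> simple_space M" "X.qnorm (\<lambda>x. f x - s x) < ennreal (e / (2 * bound + 1))"
    "Y.seminorm (\<lambda>y. h y - B s y) < ennreal (e / (2 * bound + 1))" using approxD[OF f] by blast
  note [measurable] = simple_space_measurable[OF s(1)] B_measurable[OF s(1)]
  have "Y.seminorm h = Y.seminorm (\<lambda>y. (h y - B s y) + B s y)" by simp
  also have "\<dots> \<le> Y.seminorm (\<lambda>y. h y - B s y) + Y.seminorm (B s)" by (rule Y.seminorm_add) measurable
  also have "Y.seminorm (B s) \<le> ennreal bound * X.qnorm s" by (rule seminorm_B_le[OF s(1)])
  also have "X.qnorm s = X.qnorm (\<lambda>x. f x - (f x - s x))" by simp
  also have "\<dots> \<le> 2 * (X.qnorm f + X.qnorm (\<lambda>x. f x - s x))" by (rule \<Lambda>_modulus_diff) measurable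
  also have "\<dots> \<le> 2 * (X.qnorm f + ennreal (e / (2 * bound + 1)))"
    using s(2) by (intro mult_left_mono add_left_mono) auto
  also have "ennreal bound * (2 * (X.qnorm f + ennreal (e / (2 * bound + 1)))) =
      ennreal (2 * bound) * X.qnorm f + ennreal (2 * bound) * ennreal (e / (2 * bound + 1))"
    using bound_nonneg by (simp add: ennreal_mult distrib_left mult_ac)
  finally have "Y.seminorm h \<le> Y.seminorm (\<lambda>y. h y - B s y) +
      (ennreal (2 * bound) * X.qnorm f + ennreal (2 * bound) * ennreal (e / (2 * bound + 1)))"
    by (simp add: add_left_mono mult_left_mono)
  also have "\<dots> \<le> ennreal (e / (2 * bound + 1)) +
      (ennreal (2 * bound) * X.qnorm f + ennreal (2 * bound) * ennreal (e / (2 * bound + 1)))"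
    using s(3) by (intro add_right_mono) auto
  also have "\<dots> = ennreal (2 * bound) * X.qnorm f +
      (ennreal (e / (2 * bound + 1)) + ennreal (2 * bound) * ennreal (e / (2 * bound + 1)))"
    by (simp only: add.left_commute)
  also have "ennreal (e / (2 * bound + 1)) + ennreal (2 * bound) * ennreal (e / (2 * bound + 1)) = ennreal e"
  proof -
    have "e / (2 * bound + 1) + 2 * bound * (e / (2 * bound + 1)) = (2 * bound + 1) * (e / (2 * bound + 1))"
      by (simp only: distrib_right mult_1 add.commute)
    also have "\<dots> = e" using bound_nonneg by simp
    finally show ?thesis
      using e bound_nonneg by (subst ennreal_mult[symmetric]) (auto simp del: ennreal_plus simp flip: ennreal_plus)
  qed
  finally show "Y.seminorm h \<le> ennreal (2 * bound) * X.qnorm f + ennreal e" .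
qed

text \<open>The relation is linear, so the difference of two values approximates the operator at 0,
  where \<open>approx_bound\<close> makes the seminorm vanish.\<close>

lemma approx_unique:
  assumes h: "approx f h" and k: "approx f k"
  shows "AE y in N. h y = k y"
proof -
  note [measurable] = approx_measurable[OF h] approx_measurable[OF k]
  have "approx (\<lambda>x. f x + - 1 * f x) (\<lambda>y. h y + - 1 * k y)"
    by (rule approx_add[OF h approx_cmult[OF k]])
  from approx_bound[OF this] have "Y.seminorm (\<lambda>y. h y - k y) = 0" by (simp add: \<Lambda>_0)
  then have "AE y in N. h y - k y = 0" by (intro Y.seminorm_eq_0D) measurable
  then show ?thesis by simp
qed

text \<open>Approximants within \<open>(1 / 2) ^ n\<close> of \<open>f\<close> have images whose
  increments are summable in the seminorm, which is what \<open>seminorm_complete\<close> asks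
  for.\<close>

lemma approx_exists:
  assumes f [measurable]: "f \<in> borel_measurable M" and fin: "X.qnorm f < \<infinity>"
  shows "\<exists>h. approx f h"
proof -
  have "\<exists>s\<in>simple_space M. X.qnorm (\<lambda>x. f x - s x) < ennreal ((1 / 2) ^ n)" for n :: nat
  proof -
    have "0 < ennreal ((1 / 2) ^ n)" by simp
    from simple_space_dense[OF f fin this] show ?thesis by blast
  qed
  then obtain s where s: "\<And>n. s n \<in> simple_space M" "\<And>n. X.qnorm (\<lambda>x. f x - s n x) < ennreal ((1 / 2) ^ n)"
    by metis
  have [measurable]: "s n \<in> borel_measurable M" "B (s n) \<in> borel_measurable N" for n
    using simple_space_measurable[OF s(1)] B_measurable[OF s(1)] by auto
  \<comment> \<open>The 4 consists of the factor 2 of the triangle inequality and two distances to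
    \<open>f\<close>, each at most \<open>(1 / 2) ^ n\<close>.\<close>
  have step: "Y.seminorm (\<lambda>y. B (s (Suc n)) y - B (s n) y) \<le> ennreal (4 * bound * (1 / 2) ^ n)" for n
  proof -
    have "Y.seminorm (\<lambda>y. B (s (Suc n)) y - B (s n) y) = Y.seminorm (B (\<lambda>x. s (Suc n) x - s n x))"
      using B_diff[OF s(1) s(1), of "Suc n" n] simple_space_diff[OF s(1) s(1), of "Suc n" n]
      by (intro Y.seminorm_cong) (auto elim!: eventually_mono intro: B_measurable)
    also have "\<dots> \<le> ennreal bound * X.qnorm (\<lambda>x. s (Suc n) x - s n x)"
      by (intro seminorm_B_le simple_space_diff s)
    also have "(\<lambda>x. s (Suc n) x - s n x) = (\<lambda>x. (f x - s n x) - (f x - s (Suc n) x))" by auto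
    also have "ennreal bound * X.qnorm (\<lambda>x. (f x - s n x) - (f x - s (Suc n) x)) \<le>
        ennreal bound * (2 * (X.qnorm (\<lambda>x. f x - s n x) + X.qnorm (\<lambda>x. f x - s (Suc n) x)))"
      by (intro mult_left_mono \<Lambda>_modulus_diff) auto
    also have "\<dots> \<le> ennreal bound * (2 * (ennreal ((1 / 2) ^ n) + ennreal ((1 / 2) ^ n)))"
    proof (intro mult_left_mono add_mono)
      show "X.qnorm (\<lambda>x. f x - s n x) \<le> ennreal ((1 / 2) ^ n)" using s(2)[of n] by simp
      have "X.qnorm (\<lambda>x. f x - s (Suc n) x) \<le> ennreal ((1 / 2) ^ Suc n)" using s(2)[of "Suc n"] by (rule less_imp_le)
      also have "\<dots> \<le> ennreal ((1 / 2) ^ n)" by (intro ennreal_leI power_decreasing) auto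
      finally show "X.qnorm (\<lambda>x. f x - s (Suc n) x) \<le> ennreal ((1 / 2) ^ n)" .
    qed auto
    also have "\<dots> = ennreal bound * (ennreal 2 * ennreal ((1 / 2) ^ n + (1 / 2) ^ n))"
      by (subst ennreal_plus) auto
    also have "\<dots> = ennreal (bound * (2 * ((1 / 2) ^ n + (1 / 2) ^ n)))"
      using bound_nonneg by (subst ennreal_mult[symmetric], simp, simp)+ simp
    also have "bound * (2 * ((1 / 2) ^ n + (1 / 2) ^ n)) = 4 * bound * (1 / 2) ^ n" by simp
    finally show ?thesis .
  qed
  have sm: "summable (\<lambda>n. 4 * bound * (1 / 2 :: real) ^ n)" by (intro summable_mult summable_geometric) simp
  have "(\<Sum>n. Y.seminorm (\<lambda>y. B (s (Suc n)) y - B (s n) y)) \<le> (\<Sum>n. ennreal (4 * bound * (1 / 2) ^ n))"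
    by (intro suminf_le step) auto
  also have "\<dots> = ennreal (\<Sum>n. 4 * bound * (1 / 2) ^ n)"
    using bound_nonneg sm by (intro suminf_ennreal2) auto
  also have "\<dots> < \<infinity>" by simp
  finally obtain h where h: "h \<in> borel_measurable N" "(\<lambda>n. Y.seminorm (\<lambda>y. h y - B (s n) y)) \<longlonglongrightarrow> 0"
    using Y.seminorm_complete[of "\<lambda>n. B (s n)"] by auto
  have "\<exists>t\<in>simple_space M. X.qnorm (\<lambda>x. f x - t x) < ennreal e \<and> Y.seminorm (\<lambda>y. h y - B t y) < ennreal e"
    if e: "0 < e" for e
  proof -
    have "\<forall>\<^sub>F n in sequentially. Y.seminorm (\<lambda>y. h y - B (s n) y) < ennreal e"
      using h(2) e by (intro order_tendstoD) auto
    moreover have "(\<lambda>n. (1 / 2 :: real) ^ n) \<longlonglongrightarrow> 0" by (rule LIMSEQ_power_zero) simp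
    then have "\<forall>\<^sub>F n in sequentially. (1 / 2) ^ n < e" using e by (rule order_tendstoD)
    ultimately have "\<forall>\<^sub>F n in sequentially. Y.seminorm (\<lambda>y. h y - B (s n) y) < ennreal e \<and> (1 / 2) ^ n < e"
      by (rule eventually_conj)
    then obtain n where n: "Y.seminorm (\<lambda>y. h y - B (s n) y) < ennreal e" "(1 / 2) ^ n < e"
      by (auto simp: eventually_sequentially)
    have "X.qnorm (\<lambda>x. f x - s n x) < ennreal e"
      using s(2)[of n] ennreal_lessI[OF e n(2)] by (rule less_trans)
    with n(1) s(1) show ?thesis by blast
  qed
  note ex = this
  have "approx f h"
    unfolding approx_def by (intro conjI allI impI f h(1) ex)
  then show ?thesis by (rule exI[of "approx f" h])
qed

abbreviation space_\<Lambda> :: "('a \<Rightarrow> 'k) set" where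
  "space_\<Lambda> \<equiv> fn_space M (Lambda_norm M Xbar)"

lemma space_\<Lambda>_iff: "f \<in> space_\<Lambda> \<longleftrightarrow> f \<in> borel_measurable M \<and> X.qnorm f < \<infinity>"
  unfolding fn_space_def by (auto simp: X.Lambda_norm_eq)

lemma Lambda_norm_modulus: "f \<in> borel_measurable M \<Longrightarrow> Lambda_norm M Xbar (modulus f) = X.qnorm f" for f :: "'a \<Rightarrow> 'k"
  by (simp add: X.Lambda_norm_eq)

text \<open>The choice is made for each \<open>f\<close> separately; \<open>approx_unique\<close>
  makes the result linear almost everywhere.\<close>

definition extension :: "('a \<Rightarrow> 'k) \<Rightarrow> 'b \<Rightarrow> 'k" where
  "extension f = (SOME h. approx f h)"

lemma approx_extension: "f \<in> space_\<Lambda> \<Longrightarrow> approx f (extension f)"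
  unfolding extension_def
  by (rule someI_ex[of "approx f"], rule approx_exists) (simp_all add: space_\<Lambda>_iff)

lemma simple_in_space_\<Lambda>: "s \<in> simple_space M \<Longrightarrow> s \<in> space_\<Lambda>"
  unfolding space_\<Lambda>_iff using X.\<Lambda>_simple_finite simple_space_measurable by blast

lemma space_\<Lambda>_add: "f \<in> space_\<Lambda> \<Longrightarrow> g \<in> space_\<Lambda> \<Longrightarrow> (\<lambda>x. f x + g x) \<in> space_\<Lambda>"
  unfolding space_\<Lambda>_iff
  by (auto intro!: order_le_less_trans[OF \<Lambda>_modulus_add] simp: ennreal_mult_less_top)

lemma space_\<Lambda>_cmult: "f \<in> space_\<Lambda> \<Longrightarrow> (\<lambda>x. c * f x) \<in> space_\<Lambda>"
  unfolding space_\<Lambda>_iff by (auto simp: \<Lambda>_modulus_cmult ennreal_mult_less_top)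

lemma extension_bounded_linear:
  "bounded_linear_extension M N (Lambda_norm M Xbar) (power_avg_norm N Ybar p) B extension"
  unfolding bounded_linear_extension_def
proof (intro conjI ballI)
  show "s \<in> space_\<Lambda>" "AE y in N. extension s y = B s y" if "s \<in> simple_space M" for s
    using simple_in_space_\<Lambda>[OF that] approx_unique[OF approx_extension approx_simple[OF that]] by auto
  show "linear_op N space_\<Lambda> extension"
    unfolding linear_op_def
  proof (intro conjI ballI allI)
    show "extension f \<in> borel_measurable N" if "f \<in> space_\<Lambda>" for f
      using approx_extension[OF that] by (rule approx_measurable)
    show "AE y in N. extension (\<lambda>x. f x + g x) y = extension f y + extension g y"
      if "f \<in> space_\<Lambda>" "g \<in> space_\<Lambda>" for f g
      by (rule approx_unique[OF approx_extension[OF space_\<Lambda>_add[OF that]] approx_add[OF that[THEN approx_extension]]])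
    show "AE y in N. extension (\<lambda>x. c * f x) y = c * extension f y" if "f \<in> space_\<Lambda>" for c f
      by (rule approx_unique[OF approx_extension[OF space_\<Lambda>_cmult[OF that]] approx_cmult[OF that[THEN approx_extension]]])
  qed
  show "bounded_op M (Lambda_norm M Xbar) (power_avg_norm N Ybar p) extension"
    unfolding bounded_op_def
  proof (intro exI ballI)
    fix f assume f: "f \<in> space_\<Lambda>"
    then show "power_avg_norm N Ybar p (modulus (extension f)) \<le> ennreal (2 * bound) * Lambda_norm M Xbar (modulus f)"
      using approx_bound[OF approx_extension[OF f]]
      by (simp add: Y.seminorm_def Lambda_norm_modulus space_\<Lambda>_iff)
  qed
qed

text \<open>Any competitor \<open>T\<close> satisfies \<open>approx f (T f)\<close>: for simple
  \<open>s\<close> the difference of \<open>T f\<close> and \<open>B s\<close> is \<open>T\<close>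
  at \<open>f - s\<close>, small by the boundedness of \<open>T\<close> itself. Then
  \<open>approx_unique\<close> applies.\<close>

lemma extension_unique:
  assumes T: "bounded_linear_extension M N (Lambda_norm M Xbar) (power_avg_norm N Ybar p) B T" and f: "f \<in> space_\<Lambda>"
  shows "AE y in N. T f y = extension f y"
proof (rule approx_unique[OF _ approx_extension[OF f]])
  have lin: "linear_op N space_\<Lambda> T" using T by (simp add: bounded_linear_extension_def)
  obtain C where C: "\<And>g. g \<in> space_\<Lambda> \<Longrightarrow> power_avg_norm N Ybar p (modulus (T g)) \<le> ennreal C * Lambda_norm M Xbar (modulus g)"
    using T unfolding bounded_linear_extension_def bounded_op_def by blast
  have Tm: "T g \<in> borel_measurable N" if "g \<in> space_\<Lambda>" for g using lin that unfolding linear_op_def by blast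
  have T_add: "AE y in N. T (\<lambda>x. g x + h x) y = T g y + T h y" if "g \<in> space_\<Lambda>" "h \<in> space_\<Lambda>" for g h
    using lin that unfolding linear_op_def by blast
  have T_cmult: "AE y in N. T (\<lambda>x. c * g x) y = c * T g y" if "g \<in> space_\<Lambda>" for c g
    using lin that unfolding linear_op_def by blast
  have fm [measurable]: "f \<in> borel_measurable M" and ffin: "X.qnorm f < \<infinity>" using f by (auto simp: space_\<Lambda>_iff)
  show "approx f (T f)"
    unfolding approx_def
  proof (intro conjI allI impI)
    fix e :: real assume e: "0 < e"
    \<comment> \<open>Small enough both for the distance to \<open>f\<close> and, after
      multiplication by \<open>C\<close>, for that of the images. The real constant \<open>C\<close>
      may be negative, where \<open>ennreal C\<close> is 0, hence the maximum.\<close>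
    define e' where "e' = min e (e / (max 0 C + 1))"
    have "0 < e'" using e by (simp add: e'_def add_nonneg_pos)
    then obtain s where s: "s \<in> simple_space M" "X.qnorm (\<lambda>x. f x - s x) < ennreal e'"
      using simple_space_dense[OF fm ffin, of "ennreal e'"] by auto
    have "ennreal e' \<le> ennreal e" "ennreal e' \<le> ennreal (e / (max 0 C + 1))" by (auto simp: e'_def intro!: ennreal_leI)
    with s(2) have s2: "X.qnorm (\<lambda>x. f x - s x) < ennreal e" "X.qnorm (\<lambda>x. f x - s x) < ennreal (e / (max 0 C + 1))"
      by (auto intro: order_less_le_trans)
    have sS: "s \<in> space_\<Lambda>" "(\<lambda>x. - 1 * s x) \<in> space_\<Lambda>" using simple_in_space_\<Lambda>[OF s(1)] space_\<Lambda>_cmult by blast+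
    have d: "(\<lambda>x. f x - s x) \<in> space_\<Lambda>" using space_\<Lambda>_add[OF f sS(2)] by simp
    have "AE y in N. T (\<lambda>x. f x + - 1 * s x) y = T f y + T (\<lambda>x. - 1 * s x) y"
      by (rule T_add[OF f sS(2)])
    moreover have "AE y in N. T (\<lambda>x. - 1 * s x) y = - 1 * T s y"
      by (rule T_cmult[OF sS(1)])
    moreover have "AE y in N. T s y = B s y" using T s(1) unfolding bounded_linear_extension_def by blast
    ultimately have "AE y in N. T f y - B s y = T (\<lambda>x. f x - s x) y"
      by eventually_elim simp
    then have "Y.seminorm (\<lambda>y. T f y - B s y) = Y.seminorm (T (\<lambda>x. f x - s x))"
      using Tm[OF f] B_measurable[OF s(1)] Tm[OF d] by (intro Y.seminorm_cong) auto
    also have "\<dots> \<le> ennreal C * X.qnorm (\<lambda>x. f x - s x)"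
      using C[OF d] d by (simp add: Y.seminorm_def Lambda_norm_modulus space_\<Lambda>_iff)
    also have "\<dots> \<le> ennreal (max 0 C) * X.qnorm (\<lambda>x. f x - s x)"
      by (intro mult_right_mono ennreal_leI) auto
    also have "\<dots> < ennreal e" using s2(2) e by (intro mult_quotient_less) auto
    finally show "\<exists>s\<in>simple_space M. X.qnorm (\<lambda>x. f x - s x) < ennreal e \<and> Y.seminorm (\<lambda>y. T f y - B s y) < ennreal e"
      using s(1) s2(1) by blast
  qed (use Tm[OF f] in auto)
qed

end

lemma ri_norm_leb_interval_0:
  assumes "ri_norm (leb_interval 0) \<rho>"
  shows "\<rho> f = 0"
proof -
  have "interval 0 = {}" by (auto simp: interval_def)
  then have "space (leb_interval 0) = {}" by simp
  then have "f \<in> borel_measurable (leb_interval 0)" "AE x in leb_interval 0. f x = 0"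
    by (auto simp: measurable_def intro!: AE_I2)
  then show ?thesis by (simp add: ri_norm_eq_0_iff[OF assms])
qed

lemma bounded_linear_extension_trivial:
  fixes B :: "('a \<Rightarrow> 'k::{real_normed_field, euclidean_space}) \<Rightarrow> 'b \<Rightarrow> 'k"
  assumes "emeasure N (space N) = 0" and "\<And>h. power_avg_norm N \<rho> p h = 0"
    and "\<And>s :: 'a \<Rightarrow> 'k. s \<in> simple_space M \<Longrightarrow> s \<in> fn_space M \<Lambda>"
  shows "bounded_linear_extension M N \<Lambda> (power_avg_norm N \<rho> p) B (\<lambda>f y. 0)"
proof -
  have "AE y in N. P y" for P
    by (rule AE_I[of _ _ "space N"]) (use assms(1) in auto)
  then show ?thesis
    using assms(2,3) by (auto simp: bounded_linear_extension_def linear_op_def bounded_op_def)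
qed

theorem theorem1p5:
  fixes M :: "'a measure" and N :: "'b measure"
    and X :: "('a \<Rightarrow> ennreal) \<Rightarrow> ennreal" and Y :: "('b \<Rightarrow> ennreal) \<Rightarrow> ennreal"
    and Xbar Ybar :: "(real \<Rightarrow> ennreal) \<Rightarrow> ennreal"
    and B G :: "('a \<Rightarrow> 'k::{real_normed_field, euclidean_space}) \<Rightarrow> 'b \<Rightarrow> 'k"
    and p q lam :: real
  assumes "sigma_finite_measure M" and "nonatomic M"
    and "sigma_finite_measure N" and "nonatomic N"
    and "ri_norm M X" and "representation_norm M X Xbar"
    and "ri_norm N Y" and "representation_norm N Y Ybar"
    and "((\<lambda>t. Xbar (indicator {0<..<t})) \<longlongrightarrow> 0) (at_right 0)"
    and "1 < p" and "p < q" and "0 < lam" and "lam < 1" and "lam * p > 1"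
    and "linear_op N (simple_space M) B"
    and "sawyerable (lam * p) (lam * q) M N G"
    and "order_preserving M N (sawyerable_domain M (lam * p) (lam * q)) G"
    and "R_bounded (total_mass M) p q Xbar Ybar"
    and "\<exists>C>0. \<forall>E\<in>sets M. emeasure M E < \<infinity> \<longrightarrow>
           (AE y in N. norm (B (indicator E) y) \<le> C * norm (G (indicator E) y) powr lam)"
    and "total_mass M = \<infinity> \<Longrightarrow> 0 < total_mass N \<Longrightarrow> total_mass N < \<infinity> \<Longrightarrow>
           \<exists>c>0. \<forall>t\<ge>1. ennreal (c * t powr (1 / q)) \<le> fundamental Xbar t"
  shows "\<exists>T. bounded_linear_extension M N (Lambda_norm M Xbar) (power_avg_norm N Ybar p) B T \<and>
           (\<forall>T'. bounded_linear_extension M N (Lambda_norm M Xbar) (power_avg_norm N Ybar p) B T' \<longrightarrow>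
              (\<forall>f\<in>fn_space M (Lambda_norm M Xbar). AE y in N. T' f y = T f y))"
proof -
  interpret M: sigma_finite_measure M by fact
  interpret N: sigma_finite_measure N by fact
  have fund0: "(fundamental Xbar \<longlongrightarrow> 0) (at_right 0)"
    using assms(9) by (simp add: fundamental_def[abs_def])
  interpret FX: fundamental_function "total_mass M" Xbar
    using assms(6) by unfold_locales (simp add: representation_norm_def)
  interpret LX: mono_locally_Lipschitz FX.F
    using fund0 by (rule FX.mono_locally_LipschitzI)
  interpret X: Lambda_space M Xbar
    by unfold_locales (fact fund0)
  have riY: "ri_norm (leb_interval (total_mass N)) Ybar"
    using assms(8) by (simp add: representation_norm_def)
  show ?thesis
  \<comment> \<open>\<open>interpolation\<close> needs a target of positive measure. Over a null
    target all functions agree almost everywhere, so the zero operator is the extension and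
    uniqueness is immediate.\<close>
  proof (cases "total_mass N = 0")
    case True
    have ae: "AE y in N. P y" for P
      by (rule AE_I[of _ _ "space N"]) (use True in auto)
    have "power_avg_norm N Ybar p h = 0" for h
      unfolding power_avg_norm_def using riY True by (intro ri_norm_leb_interval_0) simp
    moreover have "s \<in> fn_space M (Lambda_norm M Xbar)" if "s \<in> simple_space M" for s :: "'a \<Rightarrow> 'k"
      using X.\<Lambda>_simple_finite[OF that] simple_space_measurable[OF that]
      by (auto simp: fn_space_def X.Lambda_norm_eq)
    ultimately have "bounded_linear_extension M N (Lambda_norm M Xbar) (power_avg_norm N Ybar p) B (\<lambda>f y. 0)"
      using True by (intro bounded_linear_extension_trivial)
    then show ?thesis using ae by blast
  next
    case False
    interpret I: interpolation M Xbar N Ybar p q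
    proof unfold_locales
      show "0 < total_mass N" using False by (simp add: zero_less_iff_neq_zero)
      then show "total_mass M = \<infinity> \<Longrightarrow> total_mass N < \<infinity> \<Longrightarrow>
        \<exists>c>0. \<forall>t\<ge>1. ennreal (c * t powr (1 / q)) \<le> fundamental Xbar t" by (intro assms(20))
    qed (fact riY assms)+
    obtain C where C: "0 < C" "\<And>E. E \<in> sets M \<Longrightarrow> emeasure M E < \<infinity> \<Longrightarrow>
        AE y in N. norm (B (indicator E) y) \<le> C * norm (G (indicator E) y) powr lam"
      using assms(19) by blast
    obtain K where K: "0 \<le> K"
      "\<And>E b :: 'b \<Rightarrow> 'k. E \<in> sets M \<Longrightarrow> emeasure M E < \<infinity> \<Longrightarrow> b \<in> borel_measurable N \<Longrightarrow>
         AE y in N. norm (b y) \<le> C * norm (G (indicator E) y) powr lam \<Longrightarrow>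
         I.Y.\<sigma> (modulus b) \<le> ennreal K * X.\<Phi> (emeasure M E)"
      using I.sawyerable_bound[OF assms(12,16) C(1)] by blast
    interpret O: operator_on_indicators M Xbar N Ybar p q B K
    proof unfold_locales
      fix E assume E: "E \<in> sets M" "emeasure M E < \<infinity>"
      have "B (indicator E) \<in> borel_measurable N"
        using assms(15) simple_space_indicator[OF E] unfolding linear_op_def by blast
      then show "I.Y.seminorm (B (indicator E)) \<le> ennreal K * X.\<Phi> (emeasure M E)"
        unfolding I.Y.seminorm_def by (intro K(2) E C(2))
    qed fact+
    show ?thesis
      using O.extension_bounded_linear O.extension_unique by blast
  qed
qed

end
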